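(* Assume (H), (A1), (A2), (A3) and (A4) from the context. Let $\bar x_k=\frac1k\sum_{i=1}^k x_i$, $\bar\mu_k=\frac1k\sum_{i=1}^k\mu_i$ and $\bar w_k=(\bar x_k,\bar\mu_k)$ for $k\ge 1$. Then for every $k\ge 1$ and every $w=(x,\mu)\in(\mathcal C_p\times\mathcal C_d)\cap(\operatorname{dom}(g)\times\operatorname{dom}(l^* ))$, $$\mathbb E\left[\mathcal L(\bar x_k,\mu)-\mathcal L(x,\bar\mu_k)\right]\le\frac{\frac1{\Lambda_0}D(w,w_0)-M(w,w_0)}{k}+\frac{\sum_{i=0}^{k-1}\mathbb E\left[\langle\Delta_i,w-w_{i+1}\rangle\right]}{k}.$$ In particular, if moreover (A5) holds, then every almost sure weak sequential cluster point of $(\bar w_k)_k$ is optimal in mean: if $\bar w_{k_j}\rightharpoonup w_\infty$ almost surely along a subsequence, then $\mathbb E(w_\infty)$ is a saddle point of $\mathcal L$.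
   Context: Problem and assumption (H). $\mathcal X_p,\mathcal X_d$ are real reflexive Banach spaces with topological duals $\mathcal X_p^*,\mathcal X_d^*$ and duality pairing $\langle\cdot,\cdot\rangle$. $\Gamma_0(\mathcal X)$ is the set of proper convex lower semicontinuous functions $\mathcal X\to\mathbb R\cup\{+\infty\}$; $\partial$ is the convex subdifferential, differentiability and gradients are in the Gâteaux sense, $\iota_{\mathcal C}$ is the indicator function of $\mathcal C$, $\operatorname{int}$ is the interior, a superscript $*$ on a function is the Fenchel conjugate. (H): $\mathcal C_p\subset\mathcal X_p$, $\mathcal C_d\subset\mathcal X_d$ are nonempty closed convex; $f,g\in\Gamma_0(\mathcal X_p)$; $h,l\in\Gamma_0(\mathcal X_d^* )$ (so $h^*,l^*\in\Gamma_0(\mathcal X_d)$); $\mathcal C_p\subset\operatorname{dom}(f)$, $\mathcal C_d\subset\operatorname{dom}(h^* )$, $f$ is differentiable on $\operatorname{int}\mathcal C_p$ and $h^*$ on $\operatorname{int}\mathcal C_d$; $\mathcal C_p\cap\operatorname{dom}(g)\ne\emptyset$, $\mathcal C_d\cap\operatorname{dom}(l^* )\neq\emptyset$; $T:\mathcal X_p\to\mathcal X_d^*$ is linear and continuous; the set of saddle points of $$\mathcal L(x,\mu)=f(x)+g(x)+\iota_{\mathcal C_p}(x)+\langle Tx,\mu\rangle-h^*(\mu)-l^*(\mu)-\iota_{\mathcal C_d}(\mu)$$ is nonempty, where $(x^\star,\mu^\star)$ is a saddle point if $\mathcal L(x^\star,\mu)\le\mathcal L(x^\star,\mu^\star)\le\mathcal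 L(x,\mu^\star)$ for all $(x,\mu)\in\mathcal X_p\times\mathcal X_d$. Bregman divergences. For $\phi$ differentiable on $\operatorname{int}\operatorname{dom}(\phi)$, $D_\phi(x,y)=\phi(x)-\phi(y)-\langle\nabla\phi(y),x-y\rangle$ if $x\in\operatorname{dom}(\phi)$, $y\in\operatorname{int}\operatorname{dom}(\phi)$, and $+\infty$ otherwise. A function $F$ is $L$-smooth with respect to $\phi$ if $F$ is differentiable on $\operatorname{int}\operatorname{dom}(\phi)$ and $L\phi-F$ is convex there. For two entropies $\phi_p,\phi_d$ put $D_p=D_{\phi_p}$, $D_d=D_{\phi_d}$. Set $\mathcal U_p=\operatorname{int}\operatorname{dom}(\phi_p)\cap\operatorname{dom}(\partial g)$, $\mathcal U_d=\operatorname{int}\operatorname{dom}(\phi_d)\cap\operatorname{dom}(\partial l^* )$, $\tilde{\mathcal U}_p=\operatorname{dom}(\phi_p)\cap\operatorname{dom}(\partial g)$, $\tilde{\mathcal U}_d=\operatorname{dom}(\phi_d)\cap\operatorname{dom}(\partial l^* )$. Algorithm (SBPD). Let $\lambda_k,\nu_k>0$ be step sizes, $\delta^p_k,\delta^d_k$ ($k\in\mathbb N=\{0,1,\dots\}$) random variables on a probability space $(\Omega,\mathcal F,\mathbb P)$ with values in $\mathcal X_p^*,\mathcal X_d^*$, and $w_0=(x_0,\mu_0)\in\mathcal U_p\times\mathcal U_d$ deterministic. For $k=0,1,\dots$, $$x_{k+1}=\operatorname*{argmin}_{x\in\mathcal C_p}\Big\{g(x)+\langle\nabla f(x_k)+\delta^p_k,x\rangle+\langle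 Tx,\mu_k\rangle+\tfrac1{\lambda_k}D_p(x,x_k)\Big\},$$ $$\mu_{k+1}=\operatorname*{argmin}_{\mu\in\mathcal C_d}\Big\{l^*(\mu)+\langle\nabla h^*(\mu_k)+\delta^d_k,\mu\rangle-\langle T(2x_{k+1}-x_k),\mu\rangle+\tfrac1{\nu_k}D_d(\mu,\mu_k)\Big\}.$$ Write $w_k=(x_k,\mu_k)$, $\Delta_k=(\delta^p_k,\delta^d_k)$, $\langle\Delta_k,w-w'\rangle=\langle\delta^p_k,x-x'\rangle+\langle\delta^d_k,\mu-\mu'\rangle$. Let $\mathcal F_k=\sigma(w_0,\dots,w_k)$ and $\mathfrak F=(\mathcal F_k)_k$. $\ell^1_+$ is the set of nonnegative summable real sequences, and $\ell^1_+(\mathfrak F)$ the set of sequences $(a_k)$ of $[0,+\infty)$-valued random variables with $a_k$ $\mathcal F_k$-measurable and $\sum_k a_k<+\infty$ a.s. All relations between random quantities hold $\mathbb P$-a.s. Notation. For $w_i=(x_i,\mu_i)$: $D(w_1,w_2)=D_p(x_1,x_2)+D_d(\mu_1,\mu_2)$, $\frac1{\Lambda_k}D(w_1,w_2)=\frac1{\lambda_k}D_p(x_1,x_2)+\frac1{\nu_k}D_d(\mu_1,\mu_2)$, $(\frac1{\Lambda_\infty}-L)D(w_1,w_2)=(\frac1{\lambda_\infty}-L_p)D_p(x_1,x_2)+(\frac1{\nu_\infty}-L_d)D_d(\mu_1,\mu_2)$, $M(w_1,w_2)=\langle T(x_1-x_2),\mu_1-\mu_2\rangle$. (A1) $\phi_p\in\Gamma_0(\mathcal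 X_p)$, $\phi_d\in\Gamma_0(\mathcal X_d)$ are differentiable on the interiors of their domains, $\operatorname{dom}(\phi_p)=\mathcal C_p$, $\operatorname{dom}(\phi_d)=\mathcal C_d$; $f$ is $L_p$-smooth with respect to $\phi_p$ and $h^*$ is $L_d$-smooth with respect to $\phi_d$; the mappings $(\nabla\phi_p+\lambda_k\partial g)^{-1}$ and $(\nabla\phi_d+\nu_k\partial l^* )^{-1}$ are nonempty and single-valued, with values in $\operatorname{int}\operatorname{dom}(\phi_p)$ and $\operatorname{int}\operatorname{dom}(\phi_d)$ respectively, at the dual points where the algorithm (with or without errors) evaluates them, so that the iterates are uniquely defined and stay in $\operatorname{int}\operatorname{dom}(\phi_p)\times\operatorname{int}\operatorname{dom}(\phi_d)$. (A2) $(\lambda_k)$, $(\nu_k)$ are positive, nondecreasing, bounded above, with limits $\lambda_\infty,\nu_\infty$. (A3) (A2) holds and there are a function $d:(\mathcal X_p\times\mathcal X_d)^2\to\mathbb R_+$ and $\varepsilon\ge0$ with $$\inf_{w_1\in\tilde{\mathcal U}_p\times\tilde{\mathcal U}_d,\ w_2\in\mathcal U_p\times\mathcal U_d,\ w_1\ne w_2}\frac{(\frac1{\Lambda_\infty}-L)D(w_1,w_2)-M(w_1,w_2)}{d(w_1,w_2)}\ge\varepsilon.$$ (A4) $\mathbb E[\delta^p_k\mid\mathcal F_k]=0$ and $\mathbb E[\delta^d_k\mid\mathcal F_k]=0$ for all $k$. (A5) One of the following holds. (I) $\delta^p_k=0$, $\delta^d_k=0$ a.s. for all $k$. (II) $(\mathbb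 E[\|\delta^p_k\|_{\mathcal X_p^*}\mid\mathcal F_k])_k,(\mathbb E[\|\delta^d_k\|_{\mathcal X_d^*}\mid\mathcal F_k])_k\in\ell^1_+(\mathfrak F)$, $(\mathbb E\|\delta^p_k\|_{\mathcal X_p^*})_k,(\mathbb E\|\delta^d_k\|_{\mathcal X_d^*})_k\in\ell^1_+$, and $\mathcal U_p,\mathcal U_d$ are bounded with positive diameter. (III) $\phi_p,\phi_d$ are strongly convex with moduli $\sigma_p,\sigma_d>0$ with respect to the squared norms, i.e. $D_p(x,y)\ge\frac{\sigma_p}2\|x-y\|_{\mathcal X_p}^2$ and $D_d(\mu,\eta)\ge\frac{\sigma_d}2\|\mu-\eta\|_{\mathcal X_d}^2$; (A2) holds with $\nu_\infty\lambda_\infty<\sigma_p\sigma_d/\|T\|^2$, $\|T\|$ being the operator norm from $\mathcal X_p$ to $\mathcal X_d^*$; and $(\mathbb E[\|\delta^p_k\|^2_{\mathcal X_p^*}\mid\mathcal F_k])_k,(\mathbb E[\|\delta^d_k\|^2_{\mathcal X_d^*}\mid\mathcal F_k])_k\in\ell^1_+(\mathfrak F)$, $(\mathbb E\|\delta^p_k\|^2_{\mathcal X_p^*})_k,(\mathbb E\|\delta^d_k\|^2_{\mathcal X_d^*})_k\in\ell^1_+$. *)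

theory Defs
  imports "HOL-Probability.Probability"
begin

text \<open>The dual of \<open>'a\<close> is \<open>'a \<Rightarrow>\<^sub>L real\<close>, with the operator norm, and the duality pairing is
  \<open>blinfun_apply\<close>. An operator from \<open>'p\<close> into the dual of \<open>'d\<close> has type
  \<open>'p \<Rightarrow>\<^sub>L 'd \<Rightarrow>\<^sub>L real\<close>. Extended-real functions take values in \<open>ereal\<close>, where
  \<open>\<infinity> - \<infinity> = \<infinity>\<close> and \<open>0 * \<infinity> = 0\<close>.\<close>


section \<open>Convex analysis on a Banach space\<close>

definition reflexive_space :: "'a::real_normed_vector itself \<Rightarrow> bool" where
  "reflexive_space _ \<longleftrightarrow>
     (\<forall>\<Phi> :: ('a \<Rightarrow>\<^sub>L real) \<Rightarrow>\<^sub>L real. \<exists>x. \<forall>p. blinfun_apply \<Phi> p = blinfun_apply p x)"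

definition weakly_converges :: "(nat \<Rightarrow> 'a::real_normed_vector) \<Rightarrow> 'a \<Rightarrow> bool" where
  "weakly_converges u x \<longleftrightarrow>
     (\<forall>p :: 'a \<Rightarrow>\<^sub>L real. (\<lambda>n. blinfun_apply p (u n)) \<longlonglongrightarrow> blinfun_apply p x)"

definition eff_dom :: "('a \<Rightarrow> ereal) \<Rightarrow> 'a set" where
  "eff_dom F = {x. F x < \<infinity>}"

definition Gamma0 :: "('a::real_normed_vector \<Rightarrow> ereal) set" where
  "Gamma0 = {F.
     (\<forall>x. F x \<noteq> -\<infinity>) \<and> (\<exists>x. F x \<noteq> \<infinity>) \<and>
     (\<forall>x y. \<forall>t\<in>{0..1}. F ((1 - t) *\<^sub>R x + t *\<^sub>R y) \<le> ereal (1 - t) * F x + ereal t * F y) \<and>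
     (\<forall>x. F x \<le> Liminf (at x) F)}"

definition set_indicator :: "'a set \<Rightarrow> 'a \<Rightarrow> ereal" where
  "set_indicator C x = (if x \<in> C then 0 else \<infinity>)"

text \<open>Conjugate of a function on the dual, regarded as a function on the space itself: the bidual
  is identified with the space by reflexivity.\<close>

definition conjugate :: "(('a::real_normed_vector \<Rightarrow>\<^sub>L real) \<Rightarrow> ereal) \<Rightarrow> 'a \<Rightarrow> ereal" where
  "conjugate h \<mu> = (SUP y. ereal (blinfun_apply y \<mu>) - h y)"

definition subdiff :: "('a::real_normed_vector \<Rightarrow> ereal) \<Rightarrow> 'a \<Rightarrow> ('a \<Rightarrow>\<^sub>L real) set" where
  "subdiff F x = {p. \<forall>y. F x + ereal (blinfun_apply p (y - x)) \<le> F y}"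

definition dom_subdiff :: "('a::real_normed_vector \<Rightarrow> ereal) \<Rightarrow> 'a set" where
  "dom_subdiff F = {x. subdiff F x \<noteq> {}}"

definition has_gateaux_gradient ::
    "('a::real_normed_vector \<Rightarrow> ereal) \<Rightarrow> ('a \<Rightarrow>\<^sub>L real) \<Rightarrow> 'a \<Rightarrow> bool" where
  "has_gateaux_gradient F p x \<longleftrightarrow> x \<in> interior (eff_dom F) \<and>
     (\<forall>v. ((\<lambda>t. real_of_ereal (F (x + t *\<^sub>R v))) has_real_derivative blinfun_apply p v) (at 0))"

definition gateaux_differentiable :: "('a::real_normed_vector \<Rightarrow> ereal) \<Rightarrow> 'a \<Rightarrow> bool" where
  "gateaux_differentiable F x \<longleftrightarrow> (\<exists>p. has_gateaux_gradient F p x)"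

definition grad :: "('a::real_normed_vector \<Rightarrow> ereal) \<Rightarrow> 'a \<Rightarrow> ('a \<Rightarrow>\<^sub>L real)" where
  "grad F x = (THE p. has_gateaux_gradient F p x)"

definition bregman :: "('a::real_normed_vector \<Rightarrow> ereal) \<Rightarrow> 'a \<Rightarrow> 'a \<Rightarrow> ereal" where
  "bregman \<phi> x y =
     (if x \<in> eff_dom \<phi> \<and> y \<in> interior (eff_dom \<phi>)
      then \<phi> x - \<phi> y - ereal (blinfun_apply (grad \<phi> y) (x - y)) else \<infinity>)"

definition rel_smooth ::
    "real \<Rightarrow> ('a::real_normed_vector \<Rightarrow> ereal) \<Rightarrow> ('a \<Rightarrow> ereal) \<Rightarrow> bool" where
  "rel_smooth L F \<phi> \<longleftrightarrow>
     (\<forall>x\<in>interior (eff_dom \<phi>). gateaux_differentiable F x) \<and>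
     convex_on (interior (eff_dom \<phi>)) (\<lambda>x. L * real_of_ereal (\<phi> x) - real_of_ereal (F x))"

text \<open>The set \<open>(\<nabla>\<phi> + \<gamma> \<partial>F)\<^sup>-\<^sup>1(\<zeta>)\<close>, and the condition that it is a singleton
  contained in \<open>int dom \<phi>\<close>.\<close>

definition bregman_resolvent ::
    "('a::real_normed_vector \<Rightarrow> ereal) \<Rightarrow> real \<Rightarrow> ('a \<Rightarrow> ereal) \<Rightarrow> ('a \<Rightarrow>\<^sub>L real) \<Rightarrow> 'a set" where
  "bregman_resolvent \<phi> \<gamma> F \<zeta> =
     {x. gateaux_differentiable \<phi> x \<and> (\<exists>p\<in>subdiff F x. \<zeta> = grad \<phi> x + \<gamma> *\<^sub>R p)}"

definition resolvent_single ::
    "('a::real_normed_vector \<Rightarrow> ereal) \<Rightarrow> real \<Rightarrow> ('a \<Rightarrow> ereal) \<Rightarrow> ('a \<Rightarrow>\<^sub>L real) \<Rightarrow> bool" where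
  "resolvent_single \<phi> \<gamma> F \<zeta> \<longleftrightarrow>
     (\<exists>x\<in>interior (eff_dom \<phi>). bregman_resolvent \<phi> \<gamma> F \<zeta> = {x})"


section \<open>Random elements of a Banach space\<close>

text \<open>The spaces are not assumed separable, so random elements are strongly measurable functions
  (pointwise limits of simple functions); in a separable space this is Borel measurability.
  \<open>has_bochner_expectation\<close> is \<open>has_bochner_integral\<close> with strong measurability instead
  of Borel measurability and without the class constraint \<open>second_countable_topology\<close>.\<close>

definition strongly_measurable :: "'w measure \<Rightarrow> ('w \<Rightarrow> 'a::topological_space) \<Rightarrow> bool" where
  "strongly_measurable M X \<longleftrightarrow>
     (\<exists>s. (\<forall>n. simple_function M (s n)) \<and> (\<forall>\<omega>\<in>space M. (\<lambda>n. s n \<omega>) \<longlonglongrightarrow> X \<omega>))"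

definition has_bochner_expectation ::
    "'w measure \<Rightarrow> ('w \<Rightarrow> 'a::real_normed_vector) \<Rightarrow> 'a \<Rightarrow> bool" where
  "has_bochner_expectation M X I \<longleftrightarrow> strongly_measurable M X \<and>
     (\<exists>s. (\<forall>n. Bochner_Integration.simple_bochner_integrable M (s n)) \<and>
          (\<lambda>n. \<integral>\<^sup>+\<omega>. ennreal (norm (X \<omega> - s n \<omega>)) \<partial>M) \<longlonglongrightarrow> 0 \<and>
          (\<lambda>n. Bochner_Integration.simple_bochner_integral M (s n)) \<longlonglongrightarrow> I)"

text \<open>\<open>Y\<close> is a version of the conditional expectation of the Bochner integrable \<open>X\<close>
  given \<open>F\<close>.\<close>

definition is_cond_expectation ::
    "'w measure \<Rightarrow> 'w measure \<Rightarrow> ('w \<Rightarrow> 'a::real_normed_vector) \<Rightarrow> ('w \<Rightarrow> 'a) \<Rightarrow> bool" where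
  "is_cond_expectation M F X Y \<longleftrightarrow>
     (\<exists>I. has_bochner_expectation M X I) \<and> strongly_measurable F Y \<and>
     (\<forall>A\<in>sets F. \<exists>I. has_bochner_expectation M (\<lambda>\<omega>. indicator A \<omega> *\<^sub>R X \<omega>) I \<and>
                      has_bochner_expectation M (\<lambda>\<omega>. indicator A \<omega> *\<^sub>R Y \<omega>) I)"

text \<open>Expectation of an extended-real random variable, \<open>E X = E X\<^sup>+ - E X\<^sup>-\<close>, with the usual
  convention of minimization that it is \<open>\<infinity>\<close> when both parts are infinite.
  (\<open>e2ennreal\<close> truncates negative values to \<open>0\<close>.)\<close>

definition ext_expectation :: "'w measure \<Rightarrow> ('w \<Rightarrow> ereal) \<Rightarrow> ereal" where
  "ext_expectation M X =
     enn2ereal (\<integral>\<^sup>+\<omega>. e2ennreal (X \<omega>) \<partial>M) - enn2ereal (\<integral>\<^sup>+\<omega>. e2ennreal (- X \<omega>) \<partial>M)"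

definition history ::
    "'w measure \<Rightarrow> (nat \<Rightarrow> 'w \<Rightarrow> 'a::topological_space) \<Rightarrow> nat \<Rightarrow> 'w measure" where
  "history M w k = sigma (space M) {w i -` B \<inter> space M | i B. i \<le> k \<and> B \<in> sets borel}"

definition ell1_plus :: "(nat \<Rightarrow> real) set" where
  "ell1_plus = {a. (\<forall>k. 0 \<le> a k) \<and> summable a}"

definition ell1_plus_rv :: "'w measure \<Rightarrow> (nat \<Rightarrow> 'w measure) \<Rightarrow> (nat \<Rightarrow> 'w \<Rightarrow> real) set" where
  "ell1_plus_rv M F = {a. (\<forall>k. a k \<in> borel_measurable (F k)) \<and> (AE \<omega> in M. (\<lambda>k. a k \<omega>) \<in> ell1_plus)}"

definition summable_in_mean ::
    "'w measure \<Rightarrow> (nat \<Rightarrow> 'w measure) \<Rightarrow> (nat \<Rightarrow> 'w \<Rightarrow> real) \<Rightarrow> bool" where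
  "summable_in_mean M F N \<longleftrightarrow>
     (\<forall>k. integrable M (N k)) \<and>
     (\<lambda>k. real_cond_exp M (F k) (N k)) \<in> ell1_plus_rv M F \<and>
     (\<lambda>k. \<integral>\<omega>. N k \<omega> \<partial>M) \<in> ell1_plus"


section \<open>The saddle point problem\<close>

text \<open>With \<open>\<infinity> - \<infinity> = \<infinity>\<close> the Lagrangian is \<open>\<infinity>\<close> whenever the primal part is \<open>\<infinity>\<close>.
  The convention does not affect saddle points: under the standing assumptions both components
  of a saddle point have finite primal and dual parts.\<close>

definition lagrangian ::
    "'p set \<Rightarrow> 'd set \<Rightarrow> ('p::real_normed_vector \<Rightarrow> ereal) \<Rightarrow> ('p \<Rightarrow> ereal) \<Rightarrow>
     (('d::real_normed_vector \<Rightarrow>\<^sub>L real) \<Rightarrow> ereal) \<Rightarrow> (('d \<Rightarrow>\<^sub>L real) \<Rightarrow> ereal) \<Rightarrow>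
     ('p \<Rightarrow>\<^sub>L 'd \<Rightarrow>\<^sub>L real) \<Rightarrow> 'p \<Rightarrow> 'd \<Rightarrow> ereal" where
  "lagrangian Cp Cd f g h l T x \<mu> =
     f x + g x + set_indicator Cp x + ereal (blinfun_apply (blinfun_apply T x) \<mu>)
       - conjugate h \<mu> - conjugate l \<mu> - set_indicator Cd \<mu>"

definition saddle_point :: "('p \<Rightarrow> 'd \<Rightarrow> ereal) \<Rightarrow> 'p \<times> 'd \<Rightarrow> bool" where
  "saddle_point L w \<longleftrightarrow>
     (\<forall>x \<mu>. L (fst w) \<mu> \<le> L (fst w) (snd w) \<and> L (fst w) (snd w) \<le> L x (snd w))"

definition hypothesis_H ::
    "'p set \<Rightarrow> 'd set \<Rightarrow> ('p::banach \<Rightarrow> ereal) \<Rightarrow> ('p \<Rightarrow> ereal) \<Rightarrow>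
     (('d::banach \<Rightarrow>\<^sub>L real) \<Rightarrow> ereal) \<Rightarrow> (('d \<Rightarrow>\<^sub>L real) \<Rightarrow> ereal) \<Rightarrow>
     ('p \<Rightarrow>\<^sub>L 'd \<Rightarrow>\<^sub>L real) \<Rightarrow> bool" where
  "hypothesis_H Cp Cd f g h l T \<longleftrightarrow>
     reflexive_space TYPE('p) \<and> reflexive_space TYPE('d) \<and>
     Cp \<noteq> {} \<and> closed Cp \<and> convex Cp \<and> Cd \<noteq> {} \<and> closed Cd \<and> convex Cd \<and>
     f \<in> Gamma0 \<and> g \<in> Gamma0 \<and> h \<in> Gamma0 \<and> l \<in> Gamma0 \<and>
     Cp \<subseteq> eff_dom f \<and> Cd \<subseteq> eff_dom (conjugate h) \<and>
     (\<forall>x\<in>interior Cp. gateaux_differentiable f x) \<and>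
     (\<forall>\<mu>\<in>interior Cd. gateaux_differentiable (conjugate h) \<mu>) \<and>
     Cp \<inter> eff_dom g \<noteq> {} \<and> Cd \<inter> eff_dom (conjugate l) \<noteq> {} \<and>
     (\<exists>w. saddle_point (lagrangian Cp Cd f g h l T) w)"


section \<open>The algorithm and its assumptions\<close>

definition adjoint_op ::
    "('p::real_normed_vector \<Rightarrow>\<^sub>L 'd::real_normed_vector \<Rightarrow>\<^sub>L real) \<Rightarrow> 'd \<Rightarrow> ('p \<Rightarrow>\<^sub>L real)" where
  "adjoint_op T \<mu> = Blinfun (\<lambda>x. blinfun_apply (blinfun_apply T x) \<mu>)"

lemma blinfun_apply_adjoint_op:
  "blinfun_apply (adjoint_op T \<mu>) x = blinfun_apply (blinfun_apply T x) \<mu>"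
  unfolding adjoint_op_def
  by (subst bounded_linear_Blinfun_apply)
     (auto intro!: bounded_linear_intros)

definition coupling ::
    "('p::real_normed_vector \<Rightarrow>\<^sub>L 'd::real_normed_vector \<Rightarrow>\<^sub>L real) \<Rightarrow> 'p \<times> 'd \<Rightarrow> 'p \<times> 'd \<Rightarrow> real" where
  "coupling T w w' = blinfun_apply (blinfun_apply T (fst w - fst w')) (snd w - snd w')"

text \<open>With \<open>a = 1/\<lambda>\<^sub>k\<close>, \<open>b = 1/\<nu>\<^sub>k\<close> this is \<open>(1/\<Lambda>\<^sub>k) D(w, w')\<close>; with
  \<open>a = 1/\<lambda>\<^sub>\<infinity> - L\<^sub>p\<close>, \<open>b = 1/\<nu>\<^sub>\<infinity> - L\<^sub>d\<close> it is \<open>(1/\<Lambda>\<^sub>\<infinity> - L) D(w, w')\<close>.\<close>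

definition weighted_bregman ::
    "real \<Rightarrow> real \<Rightarrow> ('p::real_normed_vector \<Rightarrow> ereal) \<Rightarrow> ('d::real_normed_vector \<Rightarrow> ereal) \<Rightarrow>
     'p \<times> 'd \<Rightarrow> 'p \<times> 'd \<Rightarrow> ereal" where
  "weighted_bregman a b \<phi>p \<phi>d w w' =
     ereal a * bregman \<phi>p (fst w) (fst w') + ereal b * bregman \<phi>d (snd w) (snd w')"

definition noise_pairing ::
    "('p::real_normed_vector \<Rightarrow>\<^sub>L real) \<Rightarrow> ('d::real_normed_vector \<Rightarrow>\<^sub>L real) \<Rightarrow> 'p \<times> 'd \<Rightarrow> real" where
  "noise_pairing \<delta>p \<delta>d w = blinfun_apply \<delta>p (fst w) + blinfun_apply \<delta>d (snd w)"

text \<open>\<open>\<U>\<close> and \<open>\<U>\<close> with a tilde.\<close>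

definition U_set :: "('a::real_normed_vector \<Rightarrow> ereal) \<Rightarrow> ('a \<Rightarrow> ereal) \<Rightarrow> 'a set" where
  "U_set \<phi> F = interior (eff_dom \<phi>) \<inter> dom_subdiff F"

definition U_tilde_set :: "('a::real_normed_vector \<Rightarrow> ereal) \<Rightarrow> ('a \<Rightarrow> ereal) \<Rightarrow> 'a set" where
  "U_tilde_set \<phi> F = eff_dom \<phi> \<inter> dom_subdiff F"

text \<open>The objectives of the two subproblems; \<open>hs\<close>, \<open>ls\<close> stand for the conjugates of
  \<open>h\<close>, \<open>l\<close>, and \<open>x'\<close> for the new primal iterate.\<close>

definition primal_objective ::
    "('p::real_normed_vector \<Rightarrow> ereal) \<Rightarrow> ('p \<Rightarrow> ereal) \<Rightarrow>
     ('p \<Rightarrow>\<^sub>L 'd::real_normed_vector \<Rightarrow>\<^sub>L real) \<Rightarrow> ('p \<Rightarrow> ereal) \<Rightarrow> real \<Rightarrow> ('p \<Rightarrow>\<^sub>L real) \<Rightarrow>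
     'p \<Rightarrow> 'd \<Rightarrow> 'p \<Rightarrow> ereal" where
  "primal_objective f g T \<phi>p lam \<delta> x \<mu> = (\<lambda>y.
     g y + ereal (blinfun_apply (grad f x + \<delta>) y) + ereal (blinfun_apply (blinfun_apply T y) \<mu>)
       + ereal (1 / lam) * bregman \<phi>p y x)"

definition dual_objective ::
    "('d::real_normed_vector \<Rightarrow> ereal) \<Rightarrow> ('d \<Rightarrow> ereal) \<Rightarrow>
     ('p::real_normed_vector \<Rightarrow>\<^sub>L 'd \<Rightarrow>\<^sub>L real) \<Rightarrow> ('d \<Rightarrow> ereal) \<Rightarrow> real \<Rightarrow> ('d \<Rightarrow>\<^sub>L real) \<Rightarrow>
     'p \<Rightarrow> 'p \<Rightarrow> 'd \<Rightarrow> 'd \<Rightarrow> ereal" where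
  "dual_objective hs ls T \<phi>d nu \<delta> x x' \<mu> = (\<lambda>\<eta>.
     ls \<eta> + ereal (blinfun_apply (grad hs \<mu> + \<delta>) \<eta>)
       - ereal (blinfun_apply (blinfun_apply T (2 *\<^sub>R x' - x)) \<eta>)
       + ereal (1 / nu) * bregman \<phi>d \<eta> \<mu>)"

text \<open>The dual points at which the resolvents are evaluated. By the optimality condition, the
  primal step from \<open>(x, \<mu>)\<close> with error \<open>\<delta>\<close> is the resolvent of \<open>g\<close> at
  \<open>\<nabla>\<phi>\<^sub>p(x) - lam (\<nabla>f(x) + \<delta> + T\<^sup>* \<mu>)\<close>, and similarly for the dual step.\<close>

definition primal_point ::
    "('p::real_normed_vector \<Rightarrow> ereal) \<Rightarrow> ('p \<Rightarrow>\<^sub>L 'd::real_normed_vector \<Rightarrow>\<^sub>L real) \<Rightarrow>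
     ('p \<Rightarrow> ereal) \<Rightarrow> real \<Rightarrow> ('p \<Rightarrow>\<^sub>L real) \<Rightarrow> 'p \<Rightarrow> 'd \<Rightarrow> ('p \<Rightarrow>\<^sub>L real)" where
  "primal_point f T \<phi>p lam \<delta> x \<mu> = grad \<phi>p x - lam *\<^sub>R (grad f x + \<delta> + adjoint_op T \<mu>)"

definition dual_point ::
    "('d::real_normed_vector \<Rightarrow> ereal) \<Rightarrow> ('p::real_normed_vector \<Rightarrow>\<^sub>L 'd \<Rightarrow>\<^sub>L real) \<Rightarrow>
     ('d \<Rightarrow> ereal) \<Rightarrow> real \<Rightarrow> ('d \<Rightarrow>\<^sub>L real) \<Rightarrow> 'p \<Rightarrow> 'p \<Rightarrow> 'd \<Rightarrow> ('d \<Rightarrow>\<^sub>L real)" where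
  "dual_point hs T \<phi>d nu \<delta> x x' \<mu> =
     grad \<phi>d \<mu> - nu *\<^sub>R (grad hs \<mu> + \<delta> - blinfun_apply T (2 *\<^sub>R x' - x))"

definition assumption_A1_static ::
    "'p set \<Rightarrow> 'd set \<Rightarrow> ('p::real_normed_vector \<Rightarrow> ereal) \<Rightarrow> ('d::real_normed_vector \<Rightarrow> ereal) \<Rightarrow>
     ('p \<Rightarrow> ereal) \<Rightarrow> ('d \<Rightarrow> ereal) \<Rightarrow> real \<Rightarrow> real \<Rightarrow> bool" where
  "assumption_A1_static Cp Cd f hs \<phi>p \<phi>d Lp Ld \<longleftrightarrow>
     \<phi>p \<in> Gamma0 \<and> \<phi>d \<in> Gamma0 \<and>
     (\<forall>x\<in>interior (eff_dom \<phi>p). gateaux_differentiable \<phi>p x) \<and>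
     (\<forall>\<mu>\<in>interior (eff_dom \<phi>d). gateaux_differentiable \<phi>d \<mu>) \<and>
     eff_dom \<phi>p = Cp \<and> eff_dom \<phi>d = Cd \<and>
     rel_smooth Lp f \<phi>p \<and> rel_smooth Ld hs \<phi>d"

text \<open>The resolvents are well defined at the points evaluated by one step of the algorithm from
  the current iterate \<open>(x, \<mu>)\<close>: with the errors \<open>\<delta>p\<close>, \<open>\<delta>d\<close> (leading to the new primal
  iterate \<open>x'\<close>), and without errors (leading to \<open>z\<close>).\<close>

definition assumption_A1_step ::
    "('p::real_normed_vector \<Rightarrow> ereal) \<Rightarrow> ('p \<Rightarrow> ereal) \<Rightarrow>
     ('d::real_normed_vector \<Rightarrow> ereal) \<Rightarrow> ('d \<Rightarrow> ereal) \<Rightarrow> ('p \<Rightarrow>\<^sub>L 'd \<Rightarrow>\<^sub>L real) \<Rightarrow>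
     ('p \<Rightarrow> ereal) \<Rightarrow> ('d \<Rightarrow> ereal) \<Rightarrow> real \<Rightarrow> real \<Rightarrow> ('p \<Rightarrow>\<^sub>L real) \<Rightarrow> ('d \<Rightarrow>\<^sub>L real) \<Rightarrow>
     'p \<Rightarrow> 'd \<Rightarrow> 'p \<Rightarrow> bool" where
  "assumption_A1_step f g hs ls T \<phi>p \<phi>d lam nu \<delta>p \<delta>d x \<mu> x' \<longleftrightarrow>
     resolvent_single \<phi>p lam g (primal_point f T \<phi>p lam \<delta>p x \<mu>) \<and>
     resolvent_single \<phi>d nu ls (dual_point hs T \<phi>d nu \<delta>d x x' \<mu>) \<and>
     resolvent_single \<phi>p lam g (primal_point f T \<phi>p lam 0 x \<mu>) \<and>
     (\<forall>z\<in>bregman_resolvent \<phi>p lam g (primal_point f T \<phi>p lam 0 x \<mu>).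
        resolvent_single \<phi>d nu ls (dual_point hs T \<phi>d nu 0 x z \<mu>))"

definition assumption_A2 :: "(nat \<Rightarrow> real) \<Rightarrow> real \<Rightarrow> bool" where
  "assumption_A2 lam lam_inf \<longleftrightarrow>
     (\<forall>k. 0 < lam k) \<and> incseq lam \<and> bdd_above (range lam) \<and> lam \<longlonglongrightarrow> lam_inf"

text \<open>The quotient is taken in \<open>ereal\<close>: where \<open>d\<close> vanishes it is \<open>\<infinity>\<close>, \<open>0\<close> or \<open>-\<infinity>\<close>
  according to the sign of the numerator.\<close>

definition assumption_A3 ::
    "('p::real_normed_vector \<Rightarrow> ereal) \<Rightarrow> ('d::real_normed_vector \<Rightarrow> ereal) \<Rightarrow>
     ('p \<Rightarrow>\<^sub>L 'd \<Rightarrow>\<^sub>L real) \<Rightarrow> ('p \<Rightarrow> ereal) \<Rightarrow> ('d \<Rightarrow> ereal) \<Rightarrow>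
     real \<Rightarrow> real \<Rightarrow> real \<Rightarrow> real \<Rightarrow> bool" where
  "assumption_A3 g ls T \<phi>p \<phi>d Lp Ld lam_inf nu_inf \<longleftrightarrow>
     (\<exists>(d :: 'p \<times> 'd \<Rightarrow> 'p \<times> 'd \<Rightarrow> real) \<epsilon>. (\<forall>w w'. 0 \<le> d w w') \<and> 0 \<le> \<epsilon> \<and>
        ereal \<epsilon> \<le> (INF (w1, w2) \<in> {(w1, w2).
             w1 \<in> U_tilde_set \<phi>p g \<times> U_tilde_set \<phi>d ls \<and> w2 \<in> U_set \<phi>p g \<times> U_set \<phi>d ls \<and> w1 \<noteq> w2}.
           (weighted_bregman (1 / lam_inf - Lp) (1 / nu_inf - Ld) \<phi>p \<phi>d w1 w2 - ereal (coupling T w1 w2))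
             / ereal (d w1 w2)))"

definition assumption_A5_I ::
    "'w measure \<Rightarrow> (nat \<Rightarrow> 'w \<Rightarrow> ('p::real_normed_vector \<Rightarrow>\<^sub>L real)) \<Rightarrow>
     (nat \<Rightarrow> 'w \<Rightarrow> ('d::real_normed_vector \<Rightarrow>\<^sub>L real)) \<Rightarrow> bool" where
  "assumption_A5_I M \<delta>p \<delta>d \<longleftrightarrow> (AE \<omega> in M. \<forall>k. \<delta>p k \<omega> = 0 \<and> \<delta>d k \<omega> = 0)"

definition assumption_A5_II ::
    "'w measure \<Rightarrow> (nat \<Rightarrow> 'w measure) \<Rightarrow> (nat \<Rightarrow> 'w \<Rightarrow> ('p::real_normed_vector \<Rightarrow>\<^sub>L real)) \<Rightarrow>
     (nat \<Rightarrow> 'w \<Rightarrow> ('d::real_normed_vector \<Rightarrow>\<^sub>L real)) \<Rightarrow>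
     ('p \<Rightarrow> ereal) \<Rightarrow> ('d \<Rightarrow> ereal) \<Rightarrow> ('p \<Rightarrow> ereal) \<Rightarrow> ('d \<Rightarrow> ereal) \<Rightarrow> bool" where
  "assumption_A5_II M F \<delta>p \<delta>d g ls \<phi>p \<phi>d \<longleftrightarrow>
     summable_in_mean M F (\<lambda>k \<omega>. norm (\<delta>p k \<omega>)) \<and>
     summable_in_mean M F (\<lambda>k \<omega>. norm (\<delta>d k \<omega>)) \<and>
     bounded (U_set \<phi>p g) \<and> 0 < diameter (U_set \<phi>p g) \<and>
     bounded (U_set \<phi>d ls) \<and> 0 < diameter (U_set \<phi>d ls)"

text \<open>The quotient by \<open>\<parallel>T\<parallel>\<^sup>2\<close> is taken in \<open>ereal\<close>, so it is \<open>\<infinity>\<close> for \<open>T = 0\<close>.\<close>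

definition assumption_A5_III ::
    "'w measure \<Rightarrow> (nat \<Rightarrow> 'w measure) \<Rightarrow> (nat \<Rightarrow> 'w \<Rightarrow> ('p::real_normed_vector \<Rightarrow>\<^sub>L real)) \<Rightarrow>
     (nat \<Rightarrow> 'w \<Rightarrow> ('d::real_normed_vector \<Rightarrow>\<^sub>L real)) \<Rightarrow> ('p \<Rightarrow>\<^sub>L 'd \<Rightarrow>\<^sub>L real) \<Rightarrow>
     ('p \<Rightarrow> ereal) \<Rightarrow> ('d \<Rightarrow> ereal) \<Rightarrow> real \<Rightarrow> real \<Rightarrow> bool" where
  "assumption_A5_III M F \<delta>p \<delta>d T \<phi>p \<phi>d lam_inf nu_inf \<longleftrightarrow>
     (\<exists>\<sigma>p \<sigma>d. 0 < \<sigma>p \<and> 0 < \<sigma>d \<and>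
        (\<forall>x y. ereal (\<sigma>p / 2 * (norm (x - y))\<^sup>2) \<le> bregman \<phi>p x y) \<and>
        (\<forall>\<mu> \<eta>. ereal (\<sigma>d / 2 * (norm (\<mu> - \<eta>))\<^sup>2) \<le> bregman \<phi>d \<mu> \<eta>) \<and>
        ereal (nu_inf * lam_inf) < ereal (\<sigma>p * \<sigma>d) / ereal ((norm T)\<^sup>2)) \<and>
     summable_in_mean M F (\<lambda>k \<omega>. (norm (\<delta>p k \<omega>))\<^sup>2) \<and>
     summable_in_mean M F (\<lambda>k \<omega>. (norm (\<delta>d k \<omega>))\<^sup>2)"

definition ergodic_mean :: "(nat \<Rightarrow> 'w \<Rightarrow> 'a::real_vector) \<Rightarrow> nat \<Rightarrow> 'w \<Rightarrow> 'a" where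
  "ergodic_mean u k \<omega> = (1 / real k) *\<^sub>R (\<Sum>i=1..k. u i \<omega>)"

end

theory Submission
  imports Defs
begin

text \<open>Write \<open>w\<^sub>k\<close> for the iterates, \<open>M\<close> for the coupling, and \<open>gap w v\<close> for the difference of Lagrangian
  values \<open>\<L>(w\<^sub>1, v\<^sub>2) - \<L>(v\<^sub>1, w\<^sub>2)\<close>, so that a saddle point is a feasible point with nonpositive gap against
  every feasible \<open>v\<close>. The proof follows the energy \<open>E\<^sub>k(v) = (1/\<Lambda>\<^sub>k) D(v, w\<^sub>k) - M(v, w\<^sub>k)\<close> along a path.

  The optimality conditions of the two subproblems, the three-point identity for Bregman distances and
  relative smoothness give, for every feasible \<open>v\<close>,
  \<open>gap w\<^sub>k\<^sub>+\<^sub>1 v + E\<^sub>k\<^sub>+\<^sub>1(v) \<le> E\<^sub>k(v) + \<langle>\<Delta>\<^sub>k, v - w\<^sub>k\<^sub>+\<^sub>1\<rangle>\<close> (\<open>step_estimate\<close>). The bilinear terms fit together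
  because of the extrapolation in the dual step, and the term left over between \<open>w\<^sub>k\<^sub>+\<^sub>1\<close> and \<open>w\<^sub>k\<close> is
  nonnegative by the compatibility of step sizes and entropies. Telescoping and convexity of the gap bound
  the gap of the averages (\<open>mean_gap_bound\<close>), and integration yields the first assertion
  (\<open>expected_gap_bound\<close>). Two points need care. A minimizer of a subproblem is identified with the resolvent
  point (\<open>arg_min_in_resolvent\<close>), because it could a priori lie on the boundary. And \<open>E\<^sub>k(v) \<ge> 0\<close> comes from the
  compatibility assumption, which speaks only about points where \<open>\<partial>g\<close> and \<open>\<partial>l\<^sup>*\<close> are nonempty; it extends to
  feasible \<open>v\<close> by approximation, a consequence of Ekeland's variational principle
  (\<open>subdiff_near_point\<close>, \<open>U_set_approximation\<close>).

  For the second assertion, let \<open>e\<close> be the expectation of the weak limit. It suffices that affine minorants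
  of \<open>gap \<cdot> v\<close> are nonpositive at \<open>e\<close> (\<open>gap_nonpos_of_minorants\<close>, by Hahn-Banach). Such a minorant has
  expectation at most \<open>O(1/k)\<close> at the averages as soon as the sums of the expectations of
  \<open>\<langle>\<Delta>\<^sub>i, v - w\<^sub>i\<^sub>+\<^sub>1\<rangle>\<close> are bounded above, and expectations of functionals pass to the weak limit when the iterates are bounded in mean square
  (\<open>saddle_of_L2_bounded\<close>). This covers bounded domains. Without noise the method is deterministic and the
  limit is constant (\<open>saddle_noiseless\<close>). In the strongly convex case the noise is paired with the noiseless
  successor of \<open>w\<^sub>k\<close>, against which it has mean zero (\<open>saddle_strongly_convex\<close>); that this successor is
  strongly measurable rests on continuity of convex functions (Baire), demicontinuity of Gateaux gradients
  and a form of Pettis' theorem (\<open>weak_limit_strongly_measurable\<close>).\<close>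

section \<open>Sublinear functionals and the Hahn-Banach theorem\<close>

definition sublinear :: "('a::real_vector \<Rightarrow> real) \<Rightarrow> bool" where
  "sublinear q \<longleftrightarrow> (\<forall>x y. q (x + y) \<le> q x + q y) \<and> (\<forall>t x. 0 \<le> t \<longrightarrow> q (t *\<^sub>R x) = t * q x)"

lemma sublinear_add: "sublinear q \<Longrightarrow> q (x + y) \<le> q x + q y"
  and sublinear_scale: "sublinear q \<Longrightarrow> 0 \<le> t \<Longrightarrow> q (t *\<^sub>R x) = t * q x"
  by (auto simp: sublinear_def)

lemma sublinear_zero: "sublinear q \<Longrightarrow> q 0 = 0"
  using sublinear_scale[of q 0 0] by simp

lemma sublinear_minus: "sublinear q \<Longrightarrow> - q (- x) \<le> q x"
  using sublinear_add[of q x "- x"] sublinear_zero[of q] by simp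

text \<open>Homogeneity need only be checked as an inequality, because \<open>t\<close> may be replaced by \<open>1 / t\<close>.\<close>

lemma sublinearI:
  assumes add: "\<And>x y. q (x + y) \<le> q x + q y" and zero: "q 0 = 0"
    and scale: "\<And>t x. 0 < t \<Longrightarrow> q (t *\<^sub>R x) \<le> t * q x"
  shows "sublinear q"
proof -
  have "q (t *\<^sub>R x) = t * q x" if "0 \<le> t" for t x
  proof (cases "t = 0")
    case False
    then have t: "0 < t" using that by simp
    have "q ((1 / t) *\<^sub>R (t *\<^sub>R x)) \<le> (1 / t) * q (t *\<^sub>R x)" using t by (intro scale) simp
    then have "t * q x \<le> q (t *\<^sub>R x)" using t by (simp add: field_simps)
    with scale[OF t, of x] show ?thesis by simp
  qed (simp add: zero)
  with add show ?thesis by (simp add: sublinear_def)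
qed

text \<open>The largest sublinear functional below \<open>q\<close> whose value at \<open>- x\<close> is at most \<open>- q x\<close>. It serves twice:
  to show that minimal sublinear functionals are odd, and to fix the value at a given point.\<close>

definition flatten_along :: "('a::real_vector \<Rightarrow> real) \<Rightarrow> 'a \<Rightarrow> 'a \<Rightarrow> real" where
  "flatten_along q x v = (INF t\<in>{0..}. q (v + t *\<^sub>R x) - t * q x)"

lemma flatten_along_bdd:
  assumes q: "sublinear q"
  shows "bdd_below ((\<lambda>t. q (v + t *\<^sub>R x) - t * q x) ` {0..})"
proof (rule bdd_belowI2)
  fix t :: real assume "t \<in> {0..}"
  then have "t * q x = q (t *\<^sub>R x)" using q by (simp add: sublinear_scale)
  also have "\<dots> \<le> q (v + t *\<^sub>R x) + q (- v)"
    using sublinear_add[OF q, of "v + t *\<^sub>R x" "- v"] by simp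
  finally show "- q (- v) \<le> q (v + t *\<^sub>R x) - t * q x" by simp
qed

lemma flatten_along_le:
  assumes "sublinear q" "0 \<le> t"
  shows "flatten_along q x v \<le> q (v + t *\<^sub>R x) - t * q x"
  unfolding flatten_along_def using assms by (intro cINF_lower flatten_along_bdd) auto

lemma sublinear_flatten_along:
  assumes q: "sublinear q"
  shows "sublinear (flatten_along q x)"
proof (rule sublinearI)
  fix u v
  have st: "flatten_along q x (u + v) \<le> (q (u + s *\<^sub>R x) - s * q x) + (q (v + t *\<^sub>R x) - t * q x)"
    if "0 \<le> s" "0 \<le> t" for s t
  proof -
    have "flatten_along q x (u + v) \<le> q (u + v + (s + t) *\<^sub>R x) - (s + t) * q x"
      using that by (intro flatten_along_le q) simp
    also have "u + v + (s + t) *\<^sub>R x = (u + s *\<^sub>R x) + (v + t *\<^sub>R x)" by (simp add: algebra_simps)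
    finally show ?thesis using sublinear_add[OF q, of "u + s *\<^sub>R x" "v + t *\<^sub>R x"]
      by (simp add: algebra_simps)
  qed
  have "flatten_along q x (u + v) - (q (u + s *\<^sub>R x) - s * q x) \<le> flatten_along q x v" if "0 \<le> s" for s
    unfolding flatten_along_def[of q x v] using st[OF that] by (intro cINF_greatest) (auto simp: algebra_simps)
  then have "flatten_along q x (u + v) - flatten_along q x v \<le> flatten_along q x u"
    unfolding flatten_along_def[of q x u] by (intro cINF_greatest) (auto simp: algebra_simps)
  then show "flatten_along q x (u + v) \<le> flatten_along q x u + flatten_along q x v" by simp
next
  have "flatten_along q x 0 \<le> 0" using flatten_along_le[OF q, of 0 x 0] by (simp add: sublinear_zero[OF q])
  moreover have "0 \<le> flatten_along q x 0"
    unfolding flatten_along_def by (intro cINF_greatest) (auto simp: sublinear_scale[OF q])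
  ultimately show "flatten_along q x 0 = 0" by simp
next
  fix t :: real and v assume t: "0 < t"
  have "flatten_along q x (t *\<^sub>R v) / t \<le> q (v + s *\<^sub>R x) - s * q x" if "0 \<le> s" for s
  proof -
    have "flatten_along q x (t *\<^sub>R v) \<le> q (t *\<^sub>R v + (t * s) *\<^sub>R x) - (t * s) * q x"
      using that t by (intro flatten_along_le q) simp
    also have "t *\<^sub>R v + (t * s) *\<^sub>R x = t *\<^sub>R (v + s *\<^sub>R x)" by (simp add: algebra_simps)
    also have "q (t *\<^sub>R (v + s *\<^sub>R x)) = t * q (v + s *\<^sub>R x)" using t by (intro sublinear_scale[OF q]) simp
    finally have "flatten_along q x (t *\<^sub>R v) \<le> t * (q (v + s *\<^sub>R x) - s * q x)"
      by (simp add: algebra_simps)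
    then show ?thesis using t by (simp add: field_simps)
  qed
  then have "flatten_along q x (t *\<^sub>R v) / t \<le> flatten_along q x v"
    unfolding flatten_along_def[of q x v] by (intro cINF_greatest) auto
  then show "flatten_along q x (t *\<^sub>R v) \<le> t * flatten_along q x v" using t by (simp add: field_simps)
qed

lemma flatten_along_neg:
  assumes "sublinear q" shows "flatten_along q x (- x) \<le> - q x"
  using flatten_along_le[OF assms, of 1 x "- x"] by (simp add: sublinear_zero[OF assms])

text \<open>Zorn's lemma: the pointwise infimum of a chain is finite because every sublinear \<open>a \<le> q\<close> satisfies
  \<open>- q (- v) \<le> a v\<close>, and it is subadditive because any two members of the chain are comparable.\<close>

lemma exists_minimal_sublinear:
  fixes q :: "'a::real_vector \<Rightarrow> real"
  assumes q: "sublinear q"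
  obtains m where "sublinear m" "m \<le> q" "\<And>p. sublinear p \<Longrightarrow> p \<le> m \<Longrightarrow> p = m"
proof -
  let ?A = "{p. sublinear p \<and> p \<le> q}"
  have "\<exists>m\<in>?A. \<forall>a\<in>?A. a \<le> m \<longrightarrow> a = m"
  proof (rule predicate_Zorn)
    show "partial_order_on ?A (relation_of (\<lambda>a b. b \<le> a) ?A)"
      by (auto simp: partial_order_on_def preorder_on_def refl_on_def trans_def antisym_def relation_of_def)
  next
    fix C assume C: "C \<in> Chains (relation_of (\<lambda>a b. b \<le> a) ?A)"
    then have chain: "a \<le> b \<or> b \<le> a" if "a \<in> C" "b \<in> C" for a b
      using that by (auto simp: Chains_def relation_of_def)
    have CA: "sublinear a" "a \<le> q" if "a \<in> C" for a
      using C that by (auto simp: Chains_def relation_of_def)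
    show "\<exists>u\<in>?A. \<forall>a\<in>C. u \<le> a"
    proof (cases "C = {}")
      case True then show ?thesis using q by auto
    next
      case False
      define u where "u v = (INF a\<in>C. a v)" for v
      have bdd: "bdd_below ((\<lambda>a. a v) ` C)" for v
      proof (rule bdd_belowI2)
        fix a assume "a \<in> C"
        then show "- q (- v) \<le> a v"
          using sublinear_minus[OF CA(1), of a v] le_funD[OF CA(2), of a "- v"] by simp
      qed
      have ua: "u v \<le> a v" if "a \<in> C" for a v
        unfolding u_def using that bdd by (intro cINF_lower)
      have ug: "c \<le> u v" if "\<And>a. a \<in> C \<Longrightarrow> c \<le> a v" for c v
        unfolding u_def using that False by (intro cINF_greatest)
      have "sublinear u"
      proof (rule sublinearI)
        fix x y
        have "u (x + y) \<le> a x + b y" if "a \<in> C" "b \<in> C" for a b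
        proof -
          have "\<exists>c\<in>C. c \<le> a \<and> c \<le> b" using chain[OF that] that by auto
          then obtain c where c: "c \<in> C" "c \<le> a" "c \<le> b" by blast
          have "u (x + y) \<le> c x + c y" using ua[OF c(1)] sublinear_add[OF CA(1)[OF c(1)]] order_trans by blast
          then show ?thesis using le_funD[OF c(2), of x] le_funD[OF c(3), of y] by simp
        qed
        then have "u (x + y) - a x \<le> b y" if "a \<in> C" "b \<in> C" for a b
          using that by (smt (verit))
        then have "u (x + y) - a x \<le> u y" if "a \<in> C" for a
          using that by (intro ug)
        then have "u (x + y) - u y \<le> u x" by (intro ug) (simp add: algebra_simps)
        then show "u (x + y) \<le> u x + u y" by simp
      next
        show "u 0 = 0" unfolding u_def using False CA(1) by (simp add: sublinear_zero cong: INF_cong)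
      next
        fix t :: real and x assume t: "0 < t"
        have "u (t *\<^sub>R x) / t \<le> u x"
        proof (rule ug)
          fix a assume a: "a \<in> C"
          have "u (t *\<^sub>R x) \<le> t * a x" using ua[OF a, of "t *\<^sub>R x"] t CA(1)[OF a] by (simp add: sublinear_scale)
          then show "u (t *\<^sub>R x) / t \<le> a x" using t by (simp add: field_simps)
        qed
        then show "u (t *\<^sub>R x) \<le> t * u x" using t by (simp add: field_simps)
      qed
      moreover have "u \<le> q"
      proof (rule le_funI)
        fix v obtain a where "a \<in> C" using False by blast
        then show "u v \<le> q v" using ua le_funD[OF CA(2)] order_trans by blast
      qed
      ultimately show ?thesis using ua by (auto intro!: bexI[of _ u] le_funI)
    qed
  qed
  then show thesis using that by (smt (verit) mem_Collect_eq order_trans)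
qed

text \<open>A minimal sublinear functional is linear: flattening it along any \<open>x\<close> changes nothing, which
  forces \<open>m (- x) = - m x\<close>. To prescribe the value at \<open>x\<close>, the functional is flattened along \<open>x\<close>
  before a minimal one is chosen.\<close>

theorem hahn_banach_sublinear:
  fixes q :: "'a::real_vector \<Rightarrow> real"
  assumes q: "sublinear q"
  obtains p where "linear p" "\<And>v. p v \<le> q v" "p x = q x"
proof -
  obtain m where m: "sublinear m" "m \<le> flatten_along q x"
    and minimal: "\<And>p. sublinear p \<Longrightarrow> p \<le> m \<Longrightarrow> p = m"
    using exists_minimal_sublinear[OF sublinear_flatten_along[OF q]] by blast
  have mq: "m v \<le> q v" for v
    using le_funD[OF m(2), of v] flatten_along_le[OF q, of 0 x v] by simp
  have odd: "m (- y) = - m y" for y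
  proof -
    have "flatten_along m y = m"
      using flatten_along_le[OF m(1), of 0 y] by (intro minimal sublinear_flatten_along m le_funI) simp
    then have "m (- y) \<le> - m y" using flatten_along_neg[OF m(1), of y] by simp
    then show ?thesis using sublinear_minus[OF m(1), of "- y"] by simp
  qed
  have "linear m"
  proof (rule linearI)
    fix a b
    have "m (- a + - b) \<le> m (- a) + m (- b)" by (rule sublinear_add[OF m(1)])
    moreover have "m (- a + - b) = - m (a + b)" using odd[of "a + b"] by (simp add: add.commute)
    ultimately show "m (a + b) = m a + m b" using sublinear_add[OF m(1), of a b] by (simp add: odd)
  next
    fix t a show "m (t *\<^sub>R a) = t *\<^sub>R m a"
    proof (cases "0 \<le> t")
      case False
      then have "m ((- t) *\<^sub>R a) = (- t) * m a" by (intro sublinear_scale[OF m(1)]) simp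
      then show ?thesis using odd[of "t *\<^sub>R a"] by simp
    qed (simp add: sublinear_scale[OF m(1)])
  qed
  moreover have "m x = q x"
    using mq[of x] le_funD[OF m(2), of "- x"] flatten_along_neg[OF q, of x] odd[of x] by simp
  ultimately show thesis using that mq by blast
qed

text \<open>Dominated by \<open>K \<parallel>v\<parallel>\<close>, the functional is continuous.\<close>

corollary hahn_banach_blinfun:
  fixes q :: "'a::real_normed_vector \<Rightarrow> real"
  assumes q: "sublinear q" and K: "\<And>v. q v \<le> K * norm v" "0 \<le> K"
  obtains p :: "'a \<Rightarrow>\<^sub>L real" where "norm p \<le> K" "\<And>v. blinfun_apply p v \<le> q v" "blinfun_apply p x = q x"
proof -
  obtain p where p: "linear p" "\<And>v. p v \<le> q v" "p x = q x" using hahn_banach_sublinear[OF q] by blast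
  have bound: "norm (p v) \<le> K * norm v" for v
    using p(2)[of v] p(2)[of "- v"] K(1)[of v] K(1)[of "- v"] linear_neg[OF p(1), of v] by (simp add: abs_le_iff)
  have "bounded_linear p"
    using p(1) bound by (intro bounded_linear.intro bounded_linear_axioms.intro exI[of _ K]) (auto simp: mult.commute)
  then have ap: "blinfun_apply (Blinfun p) = p" by (rule bounded_linear_Blinfun_apply)
  have "norm (Blinfun p) \<le> K" using bound K(2) by (intro norm_blinfun_bound) (auto simp: ap)
  then show thesis using that[of "Blinfun p"] ap p by simp
qed

corollary norming_functional:
  fixes x :: "'a::real_normed_vector"
  obtains p :: "'a \<Rightarrow>\<^sub>L real" where "norm p \<le> 1" "blinfun_apply p x = norm x"
proof -
  have "sublinear (norm :: 'a \<Rightarrow> real)" by (rule sublinearI) (auto simp: norm_triangle_ineq)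
  from hahn_banach_blinfun[OF this, of 1 x] show thesis using that by auto
qed

lemma blinfun_separates:
  fixes x y :: "'a::real_normed_vector"
  assumes "\<And>p :: 'a \<Rightarrow>\<^sub>L real. blinfun_apply p x = blinfun_apply p y"
  shows "x = y"
proof -
  obtain p :: "'a \<Rightarrow>\<^sub>L real" where "blinfun_apply p (x - y) = norm (x - y)"
    using norming_functional by blast
  then show ?thesis using assms[of p] by (simp add: blinfun.diff_right)
qed

text \<open>The functional is obtained below the distance to \<open>Y\<close>, which is sublinear because \<open>Y\<close> is a
  subspace; being nonpositive on \<open>Y = - Y\<close>, it vanishes there.\<close>

corollary annihilator_of_subspace:
  fixes Y :: "'a::real_normed_vector set"
  assumes Y: "subspace Y" and x: "x \<notin> closure Y"
  obtains p :: "'a \<Rightarrow>\<^sub>L real" where "\<And>y. y \<in> Y \<Longrightarrow> blinfun_apply p y = 0" "blinfun_apply p x \<noteq> 0"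
proof -
  have ne: "Y \<noteq> {}" using subspace_0[OF Y] by auto
  have sub: "sublinear (\<lambda>v. infdist v Y)"
  proof (rule sublinearI)
    fix u v
    have "infdist (u + v) Y - dist v b \<le> infdist u Y" if b: "b \<in> Y" for b
      unfolding infdist_notempty[OF ne, of u]
    proof (rule cINF_greatest[OF ne])
      fix a assume a: "a \<in> Y"
      have "infdist (u + v) Y \<le> dist (u + v) (a + b)" using subspace_add[OF Y a b] by (rule infdist_le)
      also have "\<dots> \<le> dist u a + dist v b" by (rule dist_triangle_add)
      finally show "infdist (u + v) Y - dist v b \<le> dist u a" by simp
    qed
    then have "infdist (u + v) Y - infdist u Y \<le> infdist v Y"
      unfolding infdist_notempty[OF ne, of v] by (intro cINF_greatest[OF ne]) (simp add: algebra_simps)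
    then show "infdist (u + v) Y \<le> infdist u Y + infdist v Y" by simp
  next
    show "infdist 0 Y = 0" using subspace_0[OF Y] by simp
  next
    fix t :: real and v assume t: "0 < t"
    have "infdist (t *\<^sub>R v) Y / t \<le> infdist v Y" unfolding infdist_notempty[OF ne, of v]
    proof (rule cINF_greatest[OF ne])
      fix a assume "a \<in> Y"
      then have "infdist (t *\<^sub>R v) Y \<le> dist (t *\<^sub>R v) (t *\<^sub>R a)" by (intro infdist_le subspace_scale[OF Y])
      also have "dist (t *\<^sub>R v) (t *\<^sub>R a) = t * dist v a"
        using t by (simp add: dist_norm flip: scaleR_diff_right)
      finally show "infdist (t *\<^sub>R v) Y / t \<le> dist v a" using t by (simp add: field_simps)
    qed
    then show "infdist (t *\<^sub>R v) Y \<le> t * infdist v Y" using t by (simp add: field_simps)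
  qed
  have "infdist v Y \<le> 1 * norm v" for v using infdist_le[OF subspace_0[OF Y], of v] by simp
  from hahn_banach_blinfun[OF sub this, of x] obtain p :: "'a \<Rightarrow>\<^sub>L real"
    where p: "\<And>v. blinfun_apply p v \<le> infdist v Y" "blinfun_apply p x = infdist x Y" by auto
  have "blinfun_apply p y = 0" if "y \<in> Y" for y
    using p(1)[of y] p(1)[of "- y"] that subspace_neg[OF Y that] by (simp add: blinfun.minus_right)
  moreover have "blinfun_apply p x \<noteq> 0" using x ne p(2) by (simp add: in_closure_iff_infdist_zero)
  ultimately show thesis by (rule that)
qed

text \<open>A convex function that stays above the cone \<open>\<alpha> - K \<parallel>z - y\<parallel>\<close> is separated from it by an affine
  function. The sublinear functional to which Hahn-Banach is applied is the inf-convolution of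
  \<open>K \<parallel>\<cdot>\<parallel>\<close> with the smallest sublinear functional above which \<open>f (y + \<cdot>) - \<alpha>\<close> lies.\<close>

lemma convex_on_cone_sandwich:
  fixes f :: "'a::real_normed_vector \<Rightarrow> real"
  assumes f: "convex_on S f" and K: "0 \<le> K" and le: "\<And>z. z \<in> S \<Longrightarrow> \<alpha> - K * norm (z - y) \<le> f z"
  obtains p :: "'a \<Rightarrow>\<^sub>L real" where "norm p \<le> K" "\<And>z. z \<in> S \<Longrightarrow> \<alpha> + blinfun_apply p (z - y) \<le> f z"
proof (cases "S = {}")
  case True
  then show thesis using that[of 0] K by simp
next
  case False
  define G where "G v = (\<lambda>(t, z). t * (f z - \<alpha>) + K * norm (v - t *\<^sub>R (z - y)))" for v
  define q where "q v = (INF a\<in>{0..} \<times> S. G v a)" for v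
  have ne: "{0::real..} \<times> S \<noteq> {}" using False by auto
  have low: "- (K * norm v) \<le> G v (t, z)" if "0 \<le> t" "z \<in> S" for v t z
  proof -
    have "K * (t * norm (z - y)) \<le> K * (norm v + norm (v - t *\<^sub>R (z - y)))"
      using norm_triangle_sub[of "t *\<^sub>R (z - y)" v] K that(1)
      by (intro mult_left_mono) (auto simp: norm_minus_commute)
    moreover have "t * (- (K * norm (z - y))) \<le> t * (f z - \<alpha>)" using le[OF that(2)] that(1) by (intro mult_left_mono) auto
    moreover have "t * - (K * norm (z - y)) = - (K * (t * norm (z - y)))" by simp
    ultimately show ?thesis unfolding G_def distrib_left prod.case by linarith
  qed
  have bdd: "bdd_below (G v ` ({0..} \<times> S))" for v using low by (intro bdd_belowI2[of _ "- (K * norm v)"]) auto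
  have qle: "q v \<le> G v (t, z)" if "0 \<le> t" "z \<in> S" for v t z
    unfolding q_def using that by (intro cINF_lower bdd) auto
  have qge: "c \<le> q v" if "\<And>t z. 0 \<le> t \<Longrightarrow> z \<in> S \<Longrightarrow> c \<le> G v (t, z)" for c v
    unfolding q_def using that by (intro cINF_greatest ne) auto
  have "sublinear q"
  proof (rule sublinearI)
    fix u v
    have "q (u + v) \<le> G u (s, a) + G v (t, b)" if s: "0 \<le> s" "a \<in> S" and t: "0 \<le> t" "b \<in> S" for s a t b
    proof -
      obtain c where c: "c \<in> S" "(s + t) * f c \<le> s * f a + t * f b" "(s + t) *\<^sub>R c = s *\<^sub>R a + t *\<^sub>R b"
      proof (cases "s + t = 0")
        case True
        then have "s = 0" "t = 0" using s t by auto
        then show thesis using that[of a] s by simp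
      next
        case False
        then have st: "0 < s + t" using s t by simp
        define \<theta> where "\<theta> = t / (s + t)"
        have \<theta>: "0 \<le> \<theta>" "\<theta> \<le> 1" "(s + t) * \<theta> = t" "(s + t) * (1 - \<theta>) = s"
          using s t st by (auto simp: \<theta>_def field_simps)
        let ?c = "(1 - \<theta>) *\<^sub>R a + \<theta> *\<^sub>R b"
        have "?c \<in> S" using f s t \<theta> by (auto simp: convex_on_def convex_def)
        moreover have "(s + t) * f ?c \<le> (s + t) * ((1 - \<theta>) * f a + \<theta> * f b)"
          using convex_onD[OF f \<theta>(1,2) s(2) t(2)] st by (intro mult_left_mono) auto
        moreover have "(s + t) * ((1 - \<theta>) * f a + \<theta> * f b) = s * f a + t * f b"
          using \<theta>(3,4) by (metis distrib_left mult.assoc)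
        moreover have "(s + t) *\<^sub>R ?c = s *\<^sub>R a + t *\<^sub>R b"
          using \<theta>(3,4) by (simp add: scaleR_add_right)
        ultimately show thesis using that[of ?c] by simp
      qed
      have "u + v - (s + t) *\<^sub>R (c - y) = (u - s *\<^sub>R (a - y)) + (v - t *\<^sub>R (b - y))"
        using c(3) by (simp add: algebra_simps)
      then have "norm (u + v - (s + t) *\<^sub>R (c - y)) \<le> norm (u - s *\<^sub>R (a - y)) + norm (v - t *\<^sub>R (b - y))"
        by (metis norm_triangle_ineq)
      then have "K * norm (u + v - (s + t) *\<^sub>R (c - y)) \<le> K * (norm (u - s *\<^sub>R (a - y)) + norm (v - t *\<^sub>R (b - y)))"
        using K by (rule mult_left_mono)
      moreover have "q (u + v) \<le> G (u + v) (s + t, c)" using s t c by (intro qle) auto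
      ultimately show ?thesis using c(2) by (simp add: G_def algebra_simps)
    qed
    then have "q (u + v) - G u (s, a) \<le> q v" if "0 \<le> s" "a \<in> S" for s a
      using that by (intro qge) (simp add: algebra_simps)
    then have "q (u + v) - q v \<le> q u" by (intro qge) (simp add: algebra_simps)
    then show "q (u + v) \<le> q u + q v" by simp
  next
    obtain a where "a \<in> S" using False by blast
    then have "q 0 \<le> 0" using qle[of 0 a 0] by (simp add: G_def)
    moreover have "0 \<le> q 0" using low[of _ _ 0] by (intro qge) auto
    ultimately show "q 0 = 0" by simp
  next
    fix t :: real and v assume t: "0 < t"
    have "q (t *\<^sub>R v) / t \<le> q v"
    proof (rule qge)
      fix s a assume sa: "0 \<le> (s::real)" "a \<in> S"
      have "t *\<^sub>R v - (t * s) *\<^sub>R (a - y) = t *\<^sub>R (v - s *\<^sub>R (a - y))" by (simp add: algebra_simps)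
      then have "norm (t *\<^sub>R v - (t * s) *\<^sub>R (a - y)) = t * norm (v - s *\<^sub>R (a - y))" using t by simp
      then have "G (t *\<^sub>R v) (t * s, a) = t * G v (s, a)"
        unfolding G_def prod.case by (simp only: distrib_left mult.assoc mult.left_commute)
      then show "q (t *\<^sub>R v) / t \<le> G v (s, a)" using qle[of "t * s" a "t *\<^sub>R v"] t sa by (simp add: field_simps)
    qed
    then show "q (t *\<^sub>R v) \<le> t * q v" using t by (simp add: field_simps)
  qed
  moreover have "q v \<le> K * norm v" for v
  proof -
    obtain a where "a \<in> S" using False by blast
    then show ?thesis using qle[of 0 a v] by (simp add: G_def)
  qed
  ultimately obtain p :: "'a \<Rightarrow>\<^sub>L real" where p: "norm p \<le> K" "\<And>v. blinfun_apply p v \<le> q v"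
    using hahn_banach_blinfun[of q K] K by blast
  have "\<alpha> + blinfun_apply p (z - y) \<le> f z" if "z \<in> S" for z
    using p(2)[of "z - y"] qle[of 1 z "z - y"] that by (simp add: G_def)
  then show thesis using that p(1) by blast
qed

section \<open>Lower semicontinuous convex functions\<close>

abbreviation realval :: "('a \<Rightarrow> ereal) \<Rightarrow> 'a \<Rightarrow> real" where
  "realval F x \<equiv> real_of_ereal (F x)"

lemma Gamma0_not_MInf: "F \<in> Gamma0 \<Longrightarrow> F x \<noteq> - \<infinity>"
  by (simp add: Gamma0_def)

lemma Gamma0_finite: "F \<in> Gamma0 \<Longrightarrow> x \<in> eff_dom F \<Longrightarrow> F x = ereal (realval F x)"
  using Gamma0_not_MInf[of F x] by (cases "F x") (auto simp: eff_dom_def)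

lemma not_eff_dom: "x \<notin> eff_dom F \<Longrightarrow> F x = \<infinity>"
  by (simp add: eff_dom_def)

lemma Gamma0_eff_dom_ne: "F \<in> Gamma0 \<Longrightarrow> eff_dom F \<noteq> {}"
  by (auto simp: Gamma0_def eff_dom_def less_top)

lemma eff_domI: "F x \<le> ereal c \<Longrightarrow> x \<in> eff_dom F"
  by (auto simp: eff_dom_def)

lemma Gamma0_lsc:
  assumes F: "F \<in> Gamma0" and c: "c < F x"
  shows "\<forall>\<^sub>F y in nhds x. c < F y"
proof -
  have "F x \<le> Liminf (at x) F" using F by (simp add: Gamma0_def)
  then have "\<forall>\<^sub>F y in at x. c < F y" using c by (auto simp: le_Liminf_iff)
  then show ?thesis using c by (auto simp: eventually_at_filter elim: eventually_mono)
qed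

lemma Gamma0_convex_on:
  assumes F: "F \<in> Gamma0"
  shows "convex_on (eff_dom F) (realval F)"
proof -
  have *: "F ((1 - t) *\<^sub>R x + t *\<^sub>R y) \<le> ereal ((1 - t) * realval F x + t * realval F y)"
    if "0 \<le> t" "t \<le> 1" "x \<in> eff_dom F" "y \<in> eff_dom F" for t x y
  proof -
    have "F ((1 - t) *\<^sub>R x + t *\<^sub>R y) \<le> ereal (1 - t) * F x + ereal t * F y"
      using F that by (auto simp: Gamma0_def)
    also have "\<dots> = ereal ((1 - t) * realval F x + t * realval F y)"
      by (subst (1 2) Gamma0_finite[OF F]) (use that in auto)
    finally show ?thesis .
  qed
  have conv: "convex (eff_dom F)"
    unfolding convex_alt using * by (blast intro: eff_domI)
  show ?thesis
  proof (rule convex_onI[OF _ conv])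
    fix t x y assume t: "0 < (t::real)" "t < 1" and xy: "x \<in> eff_dom F" "y \<in> eff_dom F"
    then have le: "F ((1 - t) *\<^sub>R x + t *\<^sub>R y) \<le> ereal ((1 - t) * realval F x + t * realval F y)" using * by auto
    show "realval F ((1 - t) *\<^sub>R x + t *\<^sub>R y) \<le> (1 - t) * realval F x + t * realval F y"
      using le Gamma0_finite[OF F eff_domI, OF le] by (metis ereal_less_eq(3))
  qed
qed

lemma Gamma0_convex_dom: "F \<in> Gamma0 \<Longrightarrow> convex (eff_dom F)"
  using Gamma0_convex_on by (auto simp: convex_on_def)

lemma Gamma0I:
  assumes "\<And>x. F x \<noteq> - \<infinity>" and ne: "x0 \<in> eff_dom F"
    and conv: "\<And>x y t. x \<in> eff_dom F \<Longrightarrow> y \<in> eff_dom F \<Longrightarrow> 0 \<le> t \<Longrightarrow> t \<le> 1 \<Longrightarrow>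
      F ((1 - t) *\<^sub>R x + t *\<^sub>R y) \<le> ereal ((1 - t) * realval F x + t * realval F y)"
    and lsc: "\<And>x c. ereal c < F x \<Longrightarrow> \<forall>\<^sub>F y in nhds x. ereal c < F y"
  shows "F \<in> Gamma0"
proof -
  have fin: "F x = ereal (realval F x)" if "x \<in> eff_dom F" for x
    using that assms(1)[of x] by (cases "F x") (auto simp: eff_dom_def)
  have "F ((1 - t) *\<^sub>R x + t *\<^sub>R y) \<le> ereal (1 - t) * F x + ereal t * F y" if t: "t \<in> {0..1}" for t x y
  proof (cases "x \<in> eff_dom F \<and> y \<in> eff_dom F")
    case True
    then obtain a b where "F x = ereal a" "F y = ereal b" using fin by blast
    then have "ereal (1 - t) * F x + ereal t * F y = ereal ((1 - t) * realval F x + t * realval F y)"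
      by simp
    then show ?thesis using conv[of x y t] True t by simp
  next
    case False
    consider "t = 0" | "t = 1" | "0 < t" "t < 1" using t by force
    then show ?thesis
    proof cases
      case 1
      then show ?thesis by (simp flip: zero_ereal_def one_ereal_def)
    next
      case 2
      then show ?thesis by (simp flip: zero_ereal_def one_ereal_def)
    next
      case 3
      then have "ereal (1 - t) * F x + ereal t * F y = \<infinity>"
        using False assms(1)[of x] assms(1)[of y] not_eff_dom[of x F] not_eff_dom[of y F]
        by (cases "F x"; cases "F y") auto
      then show ?thesis by (simp only: ereal_less_eq(1))
    qed
  qed
  moreover have "F x \<le> Liminf (at x) F" for x
    unfolding le_Liminf_iff
  proof (intro allI impI)
    fix c assume "c < F x"
    then obtain d where d: "c < ereal d" "ereal d < F x" using ereal_dense2 by blast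
    have "\<forall>\<^sub>F y in nhds x. c < F y" using lsc[OF d(2)] d(1) by (auto elim!: eventually_mono)
    then show "\<forall>\<^sub>F y in at x. c < F y" by (auto simp: eventually_at_filter elim: eventually_mono)
  qed
  ultimately show ?thesis using assms(1) ne by (auto simp: Gamma0_def eff_dom_def)
qed

lemma eff_dom_add:
  assumes "\<And>x. F x \<noteq> - \<infinity>" "\<And>x. G x \<noteq> - \<infinity>"
  shows "eff_dom (\<lambda>x. F x + G x) = eff_dom F \<inter> eff_dom G"
  using assms by (auto simp: eff_dom_def ereal_plus_eq_PInfty)

lemma Gamma0_add:
  assumes F: "F \<in> Gamma0" and G: "G \<in> Gamma0" and ne: "eff_dom F \<inter> eff_dom G \<noteq> {}"
  shows "(\<lambda>x. F x + G x) \<in> Gamma0"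
proof -
  have ed: "eff_dom (\<lambda>x. F x + G x) = eff_dom F \<inter> eff_dom G"
    using F G by (intro eff_dom_add) (auto simp: Gamma0_not_MInf)
  have val: "F x + G x = ereal (realval F x + realval G x)" if "x \<in> eff_dom F" "x \<in> eff_dom G" for x
    by (subst Gamma0_finite[OF F that(1)], subst Gamma0_finite[OF G that(2)]) simp
  obtain x0 where x0: "x0 \<in> eff_dom F" "x0 \<in> eff_dom G" using ne by blast
  show ?thesis
  proof (rule Gamma0I)
    show "F x + G x \<noteq> - \<infinity>" for x using Gamma0_not_MInf[OF F, of x] Gamma0_not_MInf[OF G, of x] by auto
    show "x0 \<in> eff_dom (\<lambda>x. F x + G x)" using x0 ed by simp
  next
    fix x y and t :: real
    assume xy: "x \<in> eff_dom (\<lambda>x. F x + G x)" "y \<in> eff_dom (\<lambda>x. F x + G x)" and t: "0 \<le> t" "t \<le> 1"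
    let ?z = "(1 - t) *\<^sub>R x + t *\<^sub>R y"
    have z: "?z \<in> eff_dom F" "?z \<in> eff_dom G"
      using Gamma0_convex_dom[OF F] Gamma0_convex_dom[OF G] xy t ed by (auto simp: convex_alt)
    have "realval F ?z \<le> (1 - t) * realval F x + t * realval F y"
      "realval G ?z \<le> (1 - t) * realval G x + t * realval G y"
      using convex_onD[OF Gamma0_convex_on[OF F], of t x y] convex_onD[OF Gamma0_convex_on[OF G], of t x y] xy t ed by auto
    then show "F ?z + G ?z \<le> ereal ((1 - t) * realval (\<lambda>x. F x + G x) x + t * realval (\<lambda>x. F x + G x) y)"
      using val[OF z] val[of x] val[of y] xy ed by (simp add: algebra_simps)
  next
    fix x and c :: real assume c: "ereal c < F x + G x"
    obtain a b where ab: "ereal a < F x" "ereal b < G x" "c \<le> a + b"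
    proof (cases "F x"; cases "G x")
      fix u v assume uv: "F x = ereal u" "G x = ereal v"
      define e where "e = (u + v - c) / 2"
      show thesis by (rule that[of "u - e" "v - e"]) (use uv c in \<open>auto simp: e_def field_simps\<close>)
    next
      fix u assume uv: "F x = ereal u" "G x = \<infinity>"
      show thesis by (rule that[of "u - 1" "c - u + 1"]) (use uv in auto)
    next
      fix v assume uv: "F x = \<infinity>" "G x = ereal v"
      show thesis by (rule that[of "c - v + 1" "v - 1"]) (use uv in auto)
    next
      assume uv: "F x = \<infinity>" "G x = \<infinity>"
      show thesis by (rule that[of c 0]) (use uv in auto)
    qed (use Gamma0_not_MInf[OF F] Gamma0_not_MInf[OF G] in auto)
    from Gamma0_lsc[OF F ab(1)] Gamma0_lsc[OF G ab(2)]
    show "\<forall>\<^sub>F y in nhds x. ereal c < F y + G y"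
    proof eventually_elim
      case (elim y)
      have "ereal a + ereal b < F y + G y" by (rule ereal_add_strict_mono2[OF elim])
      then show ?case using ab(3) by (metis ereal_less_eq(3) order_le_less_trans plus_ereal.simps(1))
    qed
  qed
qed

lemma eff_dom_indicator [simp]: "eff_dom (set_indicator C) = C"
  by (auto simp: eff_dom_def set_indicator_def)

lemma Gamma0_indicator:
  assumes "closed C" "convex C" "C \<noteq> {}"
  shows "set_indicator C \<in> Gamma0"
proof -
  obtain x0 where x0: "x0 \<in> C" using assms(3) by blast
  show ?thesis
  proof (rule Gamma0I)
    fix x c assume c: "ereal c < set_indicator C x"
    show "\<forall>\<^sub>F y in nhds x. ereal c < set_indicator C y"
    proof (cases "x \<in> C")
      case True
      then show ?thesis using c by (auto simp: set_indicator_def intro!: always_eventually)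
    next
      case False
      then have "\<forall>\<^sub>F y in nhds x. y \<in> - C"
        using assms(1) by (intro eventually_nhds_in_open) auto
      then show ?thesis by (rule eventually_mono) (simp add: set_indicator_def)
    qed
  qed (use x0 assms(2) in \<open>auto simp: set_indicator_def convex_alt\<close>)
qed

lemma conjugate_not_MInf:
  assumes "h y \<noteq> \<infinity>" shows "conjugate h \<mu> \<noteq> - \<infinity>"
proof -
  have "ereal (blinfun_apply y \<mu>) - h y \<le> conjugate h \<mu>" unfolding conjugate_def by (rule SUP_upper) simp
  moreover have "ereal (blinfun_apply y \<mu>) - h y \<noteq> - \<infinity>" using assms by (cases "h y") auto
  ultimately show ?thesis by auto
qed

lemma Gamma0_conjugate:
  assumes h: "h \<in> Gamma0" and ne: "\<mu>0 \<in> eff_dom (conjugate h)"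
  shows "conjugate h \<in> Gamma0"
proof -
  obtain y0 where "h y0 \<noteq> \<infinity>" using h by (auto simp: Gamma0_def)
  then have mi: "conjugate h \<mu> \<noteq> - \<infinity>" for \<mu> by (rule conjugate_not_MInf)
  have fin: "conjugate h x = ereal (realval (conjugate h) x)" if "x \<in> eff_dom (conjugate h)" for x
    using that mi[of x] by (cases "conjugate h x") (auto simp: eff_dom_def)
  show ?thesis
  proof (rule Gamma0I[OF mi ne])
    fix x y and t :: real
    assume xy: "x \<in> eff_dom (conjugate h)" "y \<in> eff_dom (conjugate h)" and t: "0 \<le> t" "t \<le> 1"
    let ?r = "realval (conjugate h)"
    show "conjugate h ((1 - t) *\<^sub>R x + t *\<^sub>R y) \<le> ereal ((1 - t) * ?r x + t * ?r y)"
      unfolding conjugate_def[of h "(1 - t) *\<^sub>R x + t *\<^sub>R y"]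
    proof (rule SUP_least)
      fix p
      show "ereal (blinfun_apply p ((1 - t) *\<^sub>R x + t *\<^sub>R y)) - h p \<le> ereal ((1 - t) * ?r x + t * ?r y)"
      proof (cases "h p")
        case (real c)
        have "blinfun_apply p z - c \<le> ?r z" if "z \<in> eff_dom (conjugate h)" for z
        proof -
          have "ereal (blinfun_apply p z) - h p \<le> conjugate h z" unfolding conjugate_def by (rule SUP_upper) simp
          then show ?thesis using real fin[OF that] by (metis ereal_less_eq(3) ereal_minus(1))
        qed
        then have "(1 - t) * (blinfun_apply p x - c) + t * (blinfun_apply p y - c) \<le> (1 - t) * ?r x + t * ?r y"
          using xy t by (intro add_mono mult_left_mono) auto
        moreover have "(1 - t) * (blinfun_apply p x - c) + t * (blinfun_apply p y - c)
            = blinfun_apply p ((1 - t) *\<^sub>R x + t *\<^sub>R y) - c"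
          unfolding blinfun.add_right blinfun.scaleR_right real_scaleR_def by (simp add: algebra_simps)
        ultimately show ?thesis using real by simp
      qed (use Gamma0_not_MInf[OF h, of p] in auto)
    qed
  next
    fix x c assume "ereal c < conjugate h x"
    then obtain p where p: "ereal c < ereal (blinfun_apply p x) - h p"
      unfolding conjugate_def less_SUP_iff by blast
    then have "h p \<noteq> \<infinity>" by (cases "h p") auto
    then obtain a where a: "h p = ereal a" using Gamma0_not_MInf[OF h, of p] by (cases "h p") auto
    have "((\<lambda>y. blinfun_apply p y) \<longlongrightarrow> blinfun_apply p x) (nhds x)"
      by (intro tendsto_intros filterlim_ident)
    then have "\<forall>\<^sub>F y in nhds x. c + a < blinfun_apply p y" using p a by (intro order_tendstoD(1)) auto
    then show "\<forall>\<^sub>F y in nhds x. ereal c < conjugate h y"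
    proof eventually_elim
      case (elim y)
      then have "ereal c < ereal (blinfun_apply p y) - h p" using a by simp
      then show ?case unfolding conjugate_def less_SUP_iff by blast
    qed
  qed
qed

lemma Gamma0_lsc_sequentially:
  assumes F: "F \<in> Gamma0" and u: "u \<longlonglongrightarrow> x" and le: "\<And>n. F (u n) \<le> ereal (c n)" and c: "c \<longlonglongrightarrow> d"
  shows "F x \<le> ereal d"
proof (rule ccontr)
  assume "\<not> F x \<le> ereal d"
  then obtain e where e: "ereal d < ereal e" "ereal e < F x" by (metis ereal_dense2 not_le)
  have "\<forall>\<^sub>F n in sequentially. ereal e < F (u n)"
    using Gamma0_lsc[OF F e(2)] u by (auto simp: filterlim_iff)
  moreover have "\<forall>\<^sub>F n in sequentially. c n < e" using c e(1) by (intro order_tendstoD(2)) auto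
  ultimately have "\<forall>\<^sub>F n in sequentially. False"
  proof eventually_elim
    case (elim n)
    then have "ereal e < ereal (c n)" using le[of n] by (meson order_less_le_trans)
    then show False using elim(2) by simp
  qed
  then show False by simp
qed

text \<open>Near a point of the domain the function exceeds its value there minus one; for a far point \<open>z\<close>,
  convexity on the segment transports this bound, which then decays at most linearly.\<close>

lemma Gamma0_growth:
  assumes F: "F \<in> Gamma0"
  obtains b a x1 where "0 \<le> b" "\<And>z. ereal (a - b * norm (z - x1)) \<le> F z"
proof -
  obtain x1 where x1: "x1 \<in> eff_dom F" using Gamma0_eff_dom_ne[OF F] by blast
  let ?f = "realval F"
  have "ereal (?f x1 - 1) < F x1" by (subst Gamma0_finite[OF F x1]) simp
  from Gamma0_lsc[OF F this] obtain r where r: "0 < r" "\<And>y. dist y x1 < r \<Longrightarrow> ereal (?f x1 - 1) < F y"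
    by (auto simp: eventually_nhds_metric)
  have "ereal ((?f x1 - 1) - 2 / r * norm (z - x1)) \<le> F z" for z
  proof (cases "dist z x1 < r \<or> z \<notin> eff_dom F")
    case True
    then show ?thesis
    proof
      assume "dist z x1 < r"
      have "ereal ((?f x1 - 1) - 2 / r * norm (z - x1)) \<le> ereal (?f x1 - 1)" using r(1) by simp
      then show ?thesis using r(2)[OF \<open>dist z x1 < r\<close>] by (meson less_imp_le order_trans)
    qed (simp add: not_eff_dom)
  next
    case False
    let ?n = "norm (z - x1)"
    have n: "r \<le> ?n" and z: "z \<in> eff_dom F" using False by (auto simp: dist_norm)
    define t where "t = r / (2 * ?n)"
    have n0: "0 < ?n" using n r(1) by linarith
    have t: "0 < t" "t < 1" "t * ?n = r / 2" using n n0 r(1) unfolding t_def by (simp_all add: divide_simps)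
    let ?y = "(1 - t) *\<^sub>R x1 + t *\<^sub>R z"
    have "?y - x1 = t *\<^sub>R (z - x1)" by (simp add: algebra_simps)
    then have "dist ?y x1 < r" using t r(1) by (simp add: dist_norm)
    moreover have y: "?y \<in> eff_dom F" using Gamma0_convex_dom[OF F] x1 z t by (auto simp: convex_alt)
    ultimately have "?f x1 - 1 < ?f ?y" using r(2) Gamma0_finite[OF F y] by (metis ereal_less_eq(3) not_le)
    also have "\<dots> \<le> (1 - t) * ?f x1 + t * ?f z" using convex_onD[OF Gamma0_convex_on[OF F], of t x1 z] t x1 z by auto
    finally have "t * (?f x1 - ?f z) < 1" by (simp add: algebra_simps)
    then have "?f x1 - ?f z < 1 / t" using t by (simp add: field_simps)
    also have "1 / t = 2 / r * ?n" using t r(1) n by (simp add: t_def field_simps)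
    finally show ?thesis by (subst Gamma0_finite[OF F z]) simp
  qed
  then show thesis using r(1) by (intro that[of "2 / r" "?f x1 - 1" x1]) auto
qed

text \<open>Close to \<open>y\<close> lower semicontinuity keeps \<open>F\<close> above \<open>\<alpha>\<close>; far from \<open>y\<close> the linear growth bound wins
  once the slope of the cone is large.\<close>

lemma Gamma0_cone_bound:
  assumes F: "F \<in> Gamma0" and \<alpha>: "ereal \<alpha> < F y"
  obtains K where "0 \<le> K" "\<And>z. ereal (\<alpha> - K * norm (z - y)) \<le> F z"
proof -
  obtain a b x1 where b: "0 \<le> b" and low: "\<And>z. ereal (a - b * norm (z - x1)) \<le> F z"
    by (rule Gamma0_growth[OF F]) (rule that; assumption)
  from Gamma0_lsc[OF F \<alpha>] obtain r where r: "0 < r" "\<And>z. dist z y < r \<Longrightarrow> ereal \<alpha> < F z"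
    by (auto simp: eventually_nhds_metric)
  define c where "c = \<bar>\<alpha> - a + b * norm (y - x1)\<bar> / r"
  have c: "0 \<le> c" using r(1) by (simp add: c_def)
  have "ereal (\<alpha> - (b + c) * norm (z - y)) \<le> F z" for z
  proof (cases "dist z y < r")
    case True
    have "ereal (\<alpha> - (b + c) * norm (z - y)) \<le> ereal \<alpha>" using b c by simp
    then show ?thesis using r(2)[OF True] by (meson less_imp_le order_trans)
  next
    case False
    then have n: "r \<le> norm (z - y)" by (simp add: dist_norm)
    have "\<alpha> - a + b * norm (y - x1) \<le> c * r" using r(1) by (simp add: c_def)
    also have "\<dots> \<le> c * norm (z - y)" using n c by (rule mult_left_mono)
    finally have 1: "\<alpha> - a + b * norm (y - x1) \<le> c * norm (z - y)" .
    have "b * norm (z - x1) \<le> b * (norm (z - y) + norm (y - x1))"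
      using norm_triangle_ineq[of "z - y" "y - x1"] b by (intro mult_left_mono) auto
    then have "\<alpha> - (b + c) * norm (z - y) \<le> a - b * norm (z - x1)" using 1 by (simp add: algebra_simps)
    then show ?thesis using low[of z] by (meson ereal_less_eq(3) order_trans)
  qed
  then show thesis using b c by (intro that[of "b + c"]) auto
qed

text \<open>A function in \<open>Gamma0\<close> is the supremum of its affine minorants: separate it from the cone of the
  preceding lemma.\<close>

theorem Gamma0_affine_minorant:
  assumes F: "F \<in> Gamma0" and \<alpha>: "ereal \<alpha> < F y"
  obtains p where "\<And>z. ereal (\<alpha> + blinfun_apply p (z - y)) \<le> F z"
proof -
  obtain K where K: "0 \<le> K" "\<And>z. ereal (\<alpha> - K * norm (z - y)) \<le> F z" using Gamma0_cone_bound[OF F \<alpha>] by blast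
  have "\<alpha> - K * norm (z - y) \<le> realval F z" if "z \<in> eff_dom F" for z
    using K(2)[of z] Gamma0_finite[OF F that] by (metis ereal_less_eq(3))
  from convex_on_cone_sandwich[OF Gamma0_convex_on[OF F] K(1) this]
  obtain p where p: "\<And>z. z \<in> eff_dom F \<Longrightarrow> \<alpha> + blinfun_apply p (z - y) \<le> realval F z" by blast
  show thesis
  proof (rule that)
    fix z show "ereal (\<alpha> + blinfun_apply p (z - y)) \<le> F z"
    proof (cases "z \<in> eff_dom F")
      case True
      then show ?thesis using p Gamma0_finite[OF F True] by (metis ereal_less_eq(3))
    qed (simp add: not_eff_dom)
  qed
qed

lemma dom_subdiff_eff_dom:
  assumes "F \<in> Gamma0" "x \<in> dom_subdiff F" shows "x \<in> eff_dom F"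
proof (rule ccontr)
  assume "x \<notin> eff_dom F"
  then have "F x = \<infinity>" by (rule not_eff_dom)
  then have "F y = \<infinity>" for y using assms(2) by (auto simp: dom_subdiff_def subdiff_def)
  then show False using assms(1) by (auto simp: Gamma0_def)
qed

text \<open>A Broendsted-Rockafellar theorem. Ekeland's variational principle on a small ball produces a point
  \<open>y\<close> at which a cone with apex on the graph lies below \<open>F\<close> on the ball; convexity makes the
  minorization global, and the affine function between cone and \<open>F\<close> is a subgradient. The slope
  \<open>K\<close> is chosen so large that \<open>y\<close> stays strictly inside the ball; it may grow without
  bound as the radius shrinks, which is harmless because only the location of \<open>y\<close> and the value \<open>F y\<close> are controlled.\<close>

theorem subdiff_near_point:
  fixes F :: "'a::banach \<Rightarrow> ereal"
  assumes F: "F \<in> Gamma0" and x: "x \<in> eff_dom F" and r: "0 < r"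
  obtains y where "norm (y - x) < r" "F y \<le> F x" "y \<in> dom_subdiff F"
proof -
  let ?f = "realval F"
  note fin = Gamma0_finite[OF F]
  define S where "S = cball x r \<inter> eff_dom F"
  obtain m where m: "\<And>z. z \<in> S \<Longrightarrow> m \<le> ?f z"
  proof -
    obtain a b x1 where b: "0 \<le> b" and low: "\<And>z. ereal (a - b * norm (z - x1)) \<le> F z"
      by (rule Gamma0_growth[OF F]) (rule that; assumption)
    have "a - b * (r + norm (x - x1)) \<le> ?f z" if "z \<in> S" for z
    proof -
      have "norm (z - x1) \<le> r + norm (x - x1)"
        using that norm_triangle_ineq[of "z - x" "x - x1"] by (simp add: S_def dist_norm norm_minus_commute)
      then have "b * norm (z - x1) \<le> b * (r + norm (x - x1))" using b by (intro mult_left_mono)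
      moreover have "a - b * norm (z - x1) \<le> ?f z"
        using low[of z] fin[of z] that by (simp add: S_def) (metis ereal_less_eq(3))
      ultimately show ?thesis by simp
    qed
    then show thesis using that by blast
  qed
  have xS: "x \<in> S" using x r by (simp add: S_def)
  (* This slope gives f x - m < K * r, so that the point found below cannot reach the boundary of the ball. *)
  define K where "K = (?f x - m + 1) / r"
  have K: "0 < K" using m[OF xS] r by (simp add: K_def)
  define below where "below y = {z \<in> S. ?f z + K * norm (z - y) \<le> ?f y}" for y
  have below_trans: "z \<in> below w" if "z \<in> below y" "y \<in> below w" for w y z
  proof -
    have "K * norm (z - w) \<le> K * (norm (z - y) + norm (y - w))"
      using norm_triangle_ineq[of "z - y" "y - w"] K by (intro mult_left_mono) auto
    then show ?thesis using that by (auto simp: below_def algebra_simps)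
  qed
  have refl: "y \<in> below y" if "y \<in> S" for y using that by (simp add: below_def)
  have below_le: "?f z \<le> ?f y" if "z \<in> below y" for y z
  proof -
    have "0 \<le> K * norm (z - y)" using K by simp
    then show ?thesis using that by (simp add: below_def)
  qed
  have bddS: "bdd_below (?f ` below y)" for y using m by (intro bdd_belowI2[of _ m]) (auto simp: below_def)
  have "\<exists>u. \<forall>n. (u n \<in> S \<and> (n = 0 \<longrightarrow> u n = x)) \<and>
     (u (Suc n) \<in> below (u n) \<and> ?f (u (Suc n)) \<le> Inf (?f ` below (u n)) + 1 / real (Suc n))"
  proof (rule dependent_nat_choice)
    show "\<exists>y. y \<in> S \<and> ((0::nat) = 0 \<longrightarrow> y = x)" using xS by auto
  next
    fix y and n :: nat assume "y \<in> S \<and> (n = 0 \<longrightarrow> y = x)"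
    then have ne: "?f ` below y \<noteq> {}" using refl by auto
    have "Inf (?f ` below y) < Inf (?f ` below y) + 1 / real (Suc n)" by simp
    from cInf_lessD[OF ne this] obtain z where "z \<in> below y" "?f z < Inf (?f ` below y) + 1 / real (Suc n)"
      by auto
    then show "\<exists>z. (z \<in> S \<and> (Suc n = 0 \<longrightarrow> z = x)) \<and> (z \<in> below y \<and> ?f z \<le> Inf (?f ` below y) + 1 / real (Suc n))"
      by (intro exI[of _ z]) (auto simp: below_def)
  qed
  then obtain u where u: "\<forall>n. (u n \<in> S \<and> (n = 0 \<longrightarrow> u n = x)) \<and>
     (u (Suc n) \<in> below (u n) \<and> ?f (u (Suc n)) \<le> Inf (?f ` below (u n)) + 1 / real (Suc n))" ..
  have u0: "u 0 = x" and uS: "u n \<in> S" and ub: "u (Suc n) \<in> below (u n)"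
    and ui: "?f (u (Suc n)) \<le> Inf (?f ` below (u n)) + 1 / real (Suc n)" for n
    using u[rule_format, of n] u[rule_format, of 0] by auto
  have umon: "u k \<in> below (u n)" if "n \<le> k" for n k
    using that
  proof (induction k rule: dec_induct)
    case base show ?case by (rule refl[OF uS])
  next
    case (step k) show ?case by (rule below_trans[OF ub step.IH])
  qed
  have "Cauchy u"
  proof -
    have "decseq (\<lambda>n. ?f (u n))"
      using ub by (intro decseq_SucI below_le)
    moreover have "bdd_below (range (\<lambda>n. ?f (u n)))" using m uS by (intro bdd_belowI2[of _ m]) auto
    ultimately have "Cauchy (\<lambda>n. ?f (u n))"
      by (intro LIMSEQ_imp_Cauchy[OF LIMSEQ_decseq_INF])
    show ?thesis
    proof (rule CauchyI')
      fix e :: real assume e: "0 < e"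
      then obtain N where N: "\<And>i k. N \<le> i \<Longrightarrow> N \<le> k \<Longrightarrow> norm (?f (u i) - ?f (u k)) < K * e"
        using CauchyD[OF \<open>Cauchy (\<lambda>n. ?f (u n))\<close>, of "K * e"] K by auto
      show "\<exists>N. \<forall>i\<ge>N. \<forall>k>i. dist (u i) (u k) < e"
      proof (intro exI[of _ N] allI impI)
        fix i k assume ik: "N \<le> i" "i < k"
        have "K * norm (u k - u i) \<le> ?f (u i) - ?f (u k)" using umon[of i k] ik by (auto simp: below_def)
        also have "\<dots> < K * e" using N[of i k] ik by auto
        finally show "dist (u i) (u k) < e" using K by (simp add: dist_norm norm_minus_commute)
      qed
    qed
  qed
  then obtain y where y: "u \<longlonglongrightarrow> y" using Cauchy_convergent_iff convergent_def by blast
  have Fy: "F y \<le> ereal (?f (u n) - K * norm (y - u n))" for n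
  proof (rule Gamma0_lsc_sequentially[OF F, of "\<lambda>k. u (k + n)"])
    show "(\<lambda>k. u (k + n)) \<longlonglongrightarrow> y" using y by (rule LIMSEQ_ignore_initial_segment)
    then show "(\<lambda>k. ?f (u n) - K * norm (u (k + n) - u n)) \<longlonglongrightarrow> ?f (u n) - K * norm (y - u n)"
      by (intro tendsto_intros)
    fix k
    have "?f (u (k + n)) \<le> ?f (u n) - K * norm (u (k + n) - u n)" "u (k + n) \<in> eff_dom F"
      using umon[of n "k + n"] by (auto simp: below_def S_def)
    then show "F (u (k + n)) \<le> ereal (?f (u n) - K * norm (u (k + n) - u n))"
      using fin by (metis ereal_less_eq(3))
  qed
  have "y \<in> cball x r" by (rule closed_sequentially[OF closed_cball _ y]) (use uS in \<open>simp add: S_def\<close>)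
  moreover have "y \<in> eff_dom F" by (rule eff_domI[of F y, OF Fy[of 0]])
  ultimately have yS: "y \<in> S" by (simp add: S_def)
  have yb: "y \<in> below (u n)" for n
  proof -
    have "?f y \<le> ?f (u n) - K * norm (y - u n)"
      using Fy[of n] fin[of y] yS by (metis IntD2 S_def ereal_less_eq(3))
    then show ?thesis using yS by (simp add: below_def)
  qed
  have min: "z = y" if z: "z \<in> below y" for z
  proof -
    have "K * norm (z - y) \<le> 1 / real (Suc n)" for n
    proof -
      have "Inf (?f ` below (u n)) \<le> ?f z" using below_trans[OF z yb] by (intro cINF_lower bddS)
      then have "?f (u (Suc n)) \<le> ?f z + 1 / real (Suc n)" using ui[of n] by linarith
      moreover have "?f y \<le> ?f (u (Suc n))" using yb by (rule below_le)
      ultimately show ?thesis using z by (auto simp: below_def)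
    qed
    then have "K * norm (z - y) \<le> 0"
      using LIMSEQ_inverse_real_of_nat by (intro LIMSEQ_le_const[of "\<lambda>n. inverse (real (Suc n))"]) (auto simp: inverse_eq_divide)
    then show ?thesis using K by (simp add: mult_le_0_iff)
  qed
  have cone: "?f y - K * norm (z - y) \<le> ?f z" if "z \<in> S" for z
  proof (rule ccontr)
    assume neg: "\<not> ?thesis"
    then have "z = y" using that by (intro min) (simp add: below_def)
    with neg show False by simp
  qed
  have yx: "norm (y - x) < r"
  proof -
    have "K * norm (y - x) \<le> ?f x - ?f y" using yb[of 0] u0 by (simp add: below_def)
    also have "\<dots> < K * r" using m[OF yS] r by (simp add: K_def)
    finally show ?thesis using K by simp
  qed
  have y_dom: "y \<in> eff_dom F" using yS by (simp add: S_def)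
  have global: "?f y - K * norm (z - y) \<le> ?f z" if z: "z \<in> eff_dom F" for z
  proof (cases "z = y")
    case False
    define t where "t = min 1 ((r - norm (y - x)) / norm (z - y))"
    have t: "0 < t" "t \<le> 1" "t * norm (z - y) \<le> r - norm (y - x)"
      using False yx by (auto simp: t_def min_def field_simps)
    let ?w = "(1 - t) *\<^sub>R y + t *\<^sub>R z"
    have w: "?w - y = t *\<^sub>R (z - y)" by (simp add: algebra_simps)
    have "norm (?w - x) \<le> norm (?w - y) + norm (y - x)" using norm_triangle_ineq[of "?w - y" "y - x"] by simp
    then have "?w \<in> cball x r" using t w by (simp add: dist_norm norm_minus_commute)
    moreover have "?w \<in> eff_dom F" using Gamma0_convex_dom[OF F] y_dom z t by (auto simp: convex_alt)
    ultimately have "?f y - K * norm (?w - y) \<le> ?f ?w" by (intro cone) (simp add: S_def)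
    also have "\<dots> \<le> (1 - t) * ?f y + t * ?f z" using convex_onD[OF Gamma0_convex_on[OF F], of t y z] t y_dom z by auto
    finally have "?f y - K * norm (?w - y) \<le> (1 - t) * ?f y + t * ?f z" .
    moreover have "norm (?w - y) = t * norm (z - y)" using t(1) unfolding w by simp
    ultimately have "t * (?f y - K * norm (z - y)) \<le> t * ?f z" by (simp add: algebra_simps)
    then show ?thesis using t(1) by simp
  qed simp
  obtain p where p: "\<And>z. z \<in> eff_dom F \<Longrightarrow> ?f y + blinfun_apply p (z - y) \<le> ?f z"
    using convex_on_cone_sandwich[OF Gamma0_convex_on[OF F] less_imp_le[OF K] global] by blast
  have "p \<in> subdiff F y"
    unfolding subdiff_def
  proof (intro CollectI allI)
    fix z show "F y + ereal (blinfun_apply p (z - y)) \<le> F z"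
    proof (cases "z \<in> eff_dom F")
      case True
      then show ?thesis using p[OF True] fin[OF True] fin[OF y_dom] by (metis ereal_less_eq(3) plus_ereal.simps(1))
    qed (simp add: not_eff_dom)
  qed
  moreover have "F y \<le> F x" using below_le[OF yb[of 0]] fin[OF x] fin[OF y_dom] u0 by (metis ereal_less_eq(3))
  ultimately show thesis using yx that by (auto simp: dom_subdiff_def)
qed


section \<open>Gateaux derivatives and Bregman distances\<close>

lemma deriv_le_of_right_chord:
  fixes \<psi> :: "real \<Rightarrow> real"
  assumes d: "(\<psi> has_real_derivative d) (at 0)" and e: "0 < e"
    and le: "\<And>t. 0 < t \<Longrightarrow> t < e \<Longrightarrow> \<psi> t \<le> \<psi> 0 + t * c"
  shows "d \<le> c"
proof -
  have "((\<lambda>t. (\<psi> t - \<psi> 0) / t) \<longlongrightarrow> d) (at 0)"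
    using d by (simp add: has_field_derivative_iff)
  then have lim: "((\<lambda>t. (\<psi> t - \<psi> 0) / t) \<longlongrightarrow> d) (at_right 0)"
    by (rule filterlim_mono) (auto simp: at_le)
  have "\<forall>\<^sub>F t in at_right 0. (\<psi> t - \<psi> 0) / t \<le> c"
    using eventually_at_right_less[of "0::real"] eventually_at_right_field[of "\<lambda>t. t < e" 0] e
    by (auto elim!: eventually_mono simp: eventually_at_right_field field_simps intro!: exI[of _ e]) (metis add.commute le mult.commute)
  with lim show ?thesis by (rule tendsto_upperbound) simp
qed

lemma interior_line:
  fixes x v :: "'a::real_normed_vector"
  assumes "x \<in> interior S"
  obtains e where "0 < e" "\<And>t. \<bar>t\<bar> < e \<Longrightarrow> x + t *\<^sub>R v \<in> interior S"
proof -
  obtain r where r: "0 < r" "ball x r \<subseteq> interior S"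
    using assms open_interior[of S] by (meson openE)
  have "x + t *\<^sub>R v \<in> interior S" if "\<bar>t\<bar> < r / (norm v + 1)" for t
  proof -
    have "\<bar>t\<bar> * norm v \<le> \<bar>t\<bar> * (norm v + 1)" by (intro mult_left_mono) auto
    also have "\<dots> < r" using that by (simp add: pos_less_divide_eq add_nonneg_pos)
    finally have "x + t *\<^sub>R v \<in> ball x r" by (simp add: dist_norm)
    with r show ?thesis by blast
  qed
  then show thesis using r(1) by (intro that[of "r / (norm v + 1)"]) (auto intro!: divide_pos_pos add_nonneg_pos)
qed

lemma convex_interior_segment:
  fixes S :: "'a::real_normed_vector set"
  assumes S: "convex S" and z: "z \<in> interior S" and y: "y \<in> S" and t: "0 < t" "t \<le> 1"
  shows "(1 - t) *\<^sub>R y + t *\<^sub>R z \<in> interior S"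
proof -
  obtain e where e: "0 < e" "ball z e \<subseteq> S" using z by (auto simp: mem_interior)
  have "ball ((1 - t) *\<^sub>R y + t *\<^sub>R z) (t * e) \<subseteq> S"
  proof
    fix w assume w: "w \<in> ball ((1 - t) *\<^sub>R y + t *\<^sub>R z) (t * e)"
    let ?c = "(1 - t) *\<^sub>R y + t *\<^sub>R z"
    have "norm (w - ?c) / t < e" using w t by (simp add: dist_norm norm_minus_commute field_simps)
    then have "z + (1 / t) *\<^sub>R (w - ?c) \<in> ball z e" using t by (simp add: dist_norm)
    then have "z + (1 / t) *\<^sub>R (w - ?c) \<in> S" using e by blast
    then have "(1 - t) *\<^sub>R y + t *\<^sub>R (z + (1 / t) *\<^sub>R (w - ?c)) \<in> S"
      using S y t unfolding convex_alt by (metis less_imp_le)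
    moreover have "(1 - t) *\<^sub>R y + t *\<^sub>R (z + (1 / t) *\<^sub>R (w - ?c)) = w"
      using t by (simp add: scaleR_add_right)
    ultimately show "w \<in> S" by simp
  qed
  then show ?thesis using t e by (auto simp: mem_interior intro!: exI[of _ "t * e"])
qed

lemma has_gateaux_gradient_unique:
  assumes "has_gateaux_gradient F p x" "has_gateaux_gradient F q x"
  shows "p = q"
  using assms by (intro blinfun_eqI) (auto simp: has_gateaux_gradient_def intro: DERIV_unique)

lemma has_gateaux_gradient_grad:
  "gateaux_differentiable F x \<Longrightarrow> has_gateaux_gradient F (grad F x) x"
  unfolding gateaux_differentiable_def grad_def
  by (metis has_gateaux_gradient_unique theI)

lemma gateaux_differentiable_interior: "gateaux_differentiable F x \<Longrightarrow> x \<in> interior (eff_dom F)"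
  by (auto simp: gateaux_differentiable_def has_gateaux_gradient_def)

lemma grad_derivative:
  "gateaux_differentiable F x \<Longrightarrow>
    ((\<lambda>t. realval F (x + t *\<^sub>R v)) has_real_derivative blinfun_apply (grad F x) v) (at 0)"
  using has_gateaux_gradient_grad by (auto simp: has_gateaux_gradient_def)

lemma convex_on_above_derivative:
  fixes \<psi> :: "'a::real_normed_vector \<Rightarrow> real"
  assumes \<psi>: "convex_on S \<psi>" and xy: "x \<in> S" "y \<in> S"
    and d: "((\<lambda>t. \<psi> (x + t *\<^sub>R (y - x))) has_real_derivative d) (at 0)"
  shows "\<psi> x + d \<le> \<psi> y"
proof -
  have "d \<le> \<psi> y - \<psi> x"
  proof (rule deriv_le_of_right_chord[OF d zero_less_one])
    fix t :: real assume t: "0 < t" "t < 1"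
    have "\<psi> ((1 - t) *\<^sub>R x + t *\<^sub>R y) \<le> (1 - t) * \<psi> x + t * \<psi> y" using t xy by (intro convex_onD[OF \<psi>]) auto
    then show "\<psi> (x + t *\<^sub>R (y - x)) \<le> \<psi> (x + 0 *\<^sub>R (y - x)) + t * (\<psi> y - \<psi> x)" by (simp add: algebra_simps)
  qed
  then show ?thesis by simp
qed

lemma gradient_inequality:
  assumes F: "F \<in> Gamma0" and d: "gateaux_differentiable F x" and y: "y \<in> eff_dom F"
  shows "realval F x + blinfun_apply (grad F x) (y - x) \<le> realval F y"
  using gateaux_differentiable_interior[OF d] interior_subset
  by (intro convex_on_above_derivative[OF Gamma0_convex_on[OF F] _ y grad_derivative[OF d]]) auto

text \<open>The sum rule in the only case needed: at an interior point where the other summand is Gateaux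
  differentiable, minimality gives a subgradient of \<open>G\<close> by comparing one-sided directional
  derivatives; no continuity of \<open>\<phi>\<close> is involved.\<close>

lemma subgradient_of_interior_minimizer:
  assumes G: "G \<in> Gamma0" and m: "m \<in> eff_dom G" and \<phi>: "gateaux_differentiable \<phi> m"
    and min: "\<And>y. y \<in> eff_dom \<phi> \<Longrightarrow> y \<in> eff_dom G \<Longrightarrow>
      realval G m + c * realval \<phi> m + blinfun_apply a m \<le> realval G y + c * realval \<phi> y + blinfun_apply a y"
  shows "- (c *\<^sub>R grad \<phi> m + a) \<in> subdiff G m"
  unfolding subdiff_def
proof (intro CollectI allI)
  fix y
  show "G m + ereal (blinfun_apply (- (c *\<^sub>R grad \<phi> m + a)) (y - m)) \<le> G y"
  proof (cases "y \<in> eff_dom G")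
    case True
    let ?v = "y - m"
    obtain e where e: "0 < e" "\<And>t. \<bar>t\<bar> < e \<Longrightarrow> m + t *\<^sub>R ?v \<in> interior (eff_dom \<phi>)"
      using interior_line[OF gateaux_differentiable_interior[OF \<phi>]] by blast
    have "((\<lambda>t. - (c * realval \<phi> (m + t *\<^sub>R ?v) + t * blinfun_apply a ?v)) has_real_derivative
        - (c * blinfun_apply (grad \<phi> m) ?v + blinfun_apply a ?v)) (at 0)"
      using grad_derivative[OF \<phi>, of ?v] by (auto intro!: derivative_eq_intros)
    then have "- (c * blinfun_apply (grad \<phi> m) ?v + blinfun_apply a ?v) \<le> realval G y - realval G m"
    proof (rule deriv_le_of_right_chord[of _ _ "min 1 e"])
      show "0 < min 1 e" using e by simp
      fix t :: real assume t: "0 < t" "t < min 1 e"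
      let ?w = "m + t *\<^sub>R ?v"
      have w: "?w = (1 - t) *\<^sub>R m + t *\<^sub>R y" by (simp add: algebra_simps)
      have "?w \<in> eff_dom \<phi>" using e(2)[of t] t interior_subset by auto
      moreover have "?w \<in> eff_dom G" unfolding w using Gamma0_convex_dom[OF G] m True t by (auto simp: convex_alt)
      ultimately have "realval G m + c * realval \<phi> m + blinfun_apply a m \<le> realval G ?w + c * realval \<phi> ?w + blinfun_apply a ?w"
        by (rule min)
      moreover have "realval G ?w \<le> (1 - t) * realval G m + t * realval G y"
        unfolding w using t m True by (intro convex_onD[OF Gamma0_convex_on[OF G]]) auto
      moreover have "blinfun_apply a ?w = blinfun_apply a m + t * blinfun_apply a ?v"
        unfolding blinfun.add_right blinfun.scaleR_right by simp
      ultimately show "- (c * realval \<phi> ?w + t * blinfun_apply a ?v)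
          \<le> - (c * realval \<phi> (m + 0 *\<^sub>R ?v) + 0 * blinfun_apply a ?v) + t * (realval G y - realval G m)"
        by (simp add: algebra_simps)
    qed
    then have "realval G m + blinfun_apply (- (c *\<^sub>R grad \<phi> m + a)) ?v \<le> realval G y"
      unfolding blinfun.minus_left blinfun.add_left blinfun.scaleR_left by simp
    then show ?thesis using Gamma0_finite[OF G m] Gamma0_finite[OF G True] by (metis ereal_less_eq(3) plus_ereal.simps(1))
  qed (simp add: not_eff_dom)
qed

text \<open>The real value of the Bregman distance where it is finite.\<close>

definition breg :: "('a::real_normed_vector \<Rightarrow> ereal) \<Rightarrow> 'a \<Rightarrow> 'a \<Rightarrow> real" where
  "breg \<phi> x y = realval \<phi> x - realval \<phi> y - blinfun_apply (grad \<phi> y) (x - y)"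

lemma bregman_eq_breg:
  assumes "\<phi> \<in> Gamma0" "x \<in> eff_dom \<phi>" "y \<in> interior (eff_dom \<phi>)"
  shows "bregman \<phi> x y = ereal (breg \<phi> x y)"
proof -
  have "y \<in> eff_dom \<phi>" using assms(3) interior_subset by blast
  then obtain a b where "\<phi> x = ereal a" "\<phi> y = ereal b" using Gamma0_finite assms by metis
  then show ?thesis using assms by (simp add: bregman_def breg_def)
qed

lemma breg_nonneg:
  assumes "\<phi> \<in> Gamma0" "x \<in> eff_dom \<phi>" "gateaux_differentiable \<phi> y"
  shows "0 \<le> breg \<phi> x y"
  using gradient_inequality[OF assms(1,3,2)] by (simp add: breg_def)

lemma breg_three_point:
  "blinfun_apply (grad \<phi> u - grad \<phi> u') (v - u') = breg \<phi> v u' + breg \<phi> u' u - breg \<phi> v u"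
  by (simp add: breg_def blinfun.diff_left blinfun.diff_right)

lemma breg_self [simp]: "breg \<phi> x x = 0"
  by (simp add: breg_def)

lemma breg_add_swap:
  "breg \<phi> x y + breg \<phi> y x = blinfun_apply (grad \<phi> x - grad \<phi> y) (x - y)"
  by (simp add: breg_def blinfun.diff_left blinfun.diff_right)

text \<open>The gradient inequality of the convex function \<open>L \<phi> - F\<close>, rearranged.\<close>

lemma rel_smooth_descent:
  assumes \<phi>: "\<And>x. x \<in> interior (eff_dom \<phi>) \<Longrightarrow> gateaux_differentiable \<phi> x"
    and s: "rel_smooth L F \<phi>" and xy: "x \<in> interior (eff_dom \<phi>)" "y \<in> interior (eff_dom \<phi>)"
  shows "realval F y - realval F x - blinfun_apply (grad F x) (y - x) \<le> L * breg \<phi> y x"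
proof -
  have F: "gateaux_differentiable F x"
    and cvx: "convex_on (interior (eff_dom \<phi>)) (\<lambda>x. L * realval \<phi> x - realval F x)"
    using s xy by (auto simp: rel_smooth_def)
  have "((\<lambda>t. L * realval \<phi> (x + t *\<^sub>R (y - x)) - realval F (x + t *\<^sub>R (y - x))) has_real_derivative
      L * blinfun_apply (grad \<phi> x) (y - x) - blinfun_apply (grad F x) (y - x)) (at 0)"
    using grad_derivative[OF F, of "y - x"] grad_derivative[OF \<phi>[OF xy(1)], of "y - x"]
    by (auto intro!: derivative_eq_intros)
  from convex_on_above_derivative[OF cvx xy this] show ?thesis by (simp add: breg_def algebra_simps)
qed

lemma realval_add:
  assumes "F \<in> Gamma0" "G \<in> Gamma0" "x \<in> eff_dom F" "x \<in> eff_dom G"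
  shows "realval (\<lambda>x. F x + G x) x = realval F x + realval G x"
  by (subst Gamma0_finite[OF assms(1,3)], subst Gamma0_finite[OF assms(2,4)]) simp

text \<open>Points of \<open>dom \<phi> \<inter> dom G\<close> are approximated within \<open>int dom \<phi> \<inter> dom \<partial>G\<close>, with convergence of
  \<open>\<phi>\<close>: move slightly towards an interior point and apply \<open>subdiff_near_point\<close> to \<open>G + \<phi>\<close>, whose
  subgradients are subgradients of \<open>G\<close> up to \<open>\<nabla>\<phi>\<close>. The values of the sum are asymptotically at most the
  value at the limit, and each summand is lower semicontinuous, so both summands converge.\<close>

lemma U_set_approximation:
  fixes \<phi> G :: "'a::banach \<Rightarrow> ereal"
  assumes \<phi>: "\<phi> \<in> Gamma0" and d\<phi>: "\<And>x. x \<in> interior (eff_dom \<phi>) \<Longrightarrow> gateaux_differentiable \<phi> x"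
    and G: "G \<in> Gamma0" and z: "z \<in> interior (eff_dom \<phi>)" "z \<in> eff_dom G"
    and x: "x \<in> eff_dom \<phi>" "x \<in> eff_dom G"
  obtains y :: "nat \<Rightarrow> 'a" where "\<And>n. y n \<in> U_set \<phi> G" "y \<longlonglongrightarrow> x"
    "(\<lambda>n. realval \<phi> (y n)) \<longlonglongrightarrow> realval \<phi> x"
proof -
  define H where "H = (\<lambda>x. G x + \<phi> x)"
  have edH: "eff_dom H = eff_dom G \<inter> eff_dom \<phi>"
    unfolding H_def using G \<phi> by (intro eff_dom_add) (auto simp: Gamma0_not_MInf)
  have H: "H \<in> Gamma0" unfolding H_def using x by (intro Gamma0_add G \<phi>) auto
  have Hval: "realval H w = realval G w + realval \<phi> w" if "w \<in> eff_dom H" for w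
    using that edH unfolding H_def by (intro realval_add G \<phi>) auto
  have zH: "z \<in> eff_dom H" and xH: "x \<in> eff_dom H" using z x edH interior_subset by auto
  define t where "t n = 1 / (real n + 1)" for n
  have t: "0 < t n" "t n \<le> 1" for n by (auto simp: t_def)
  have t0: "t \<longlonglongrightarrow> 0" unfolding t_def using LIMSEQ_inverse_real_of_nat by (simp add: inverse_eq_divide add.commute)
  define w where "w n = (1 - t n) *\<^sub>R x + t n *\<^sub>R z" for n
  have "\<exists>y. norm (y - w n) < t n \<and> y \<in> U_set \<phi> G \<and> y \<in> eff_dom H
      \<and> realval H y \<le> (1 - t n) * realval H x + t n * realval H z" for n
  proof -
    have wi: "w n \<in> interior (eff_dom \<phi>)"
      unfolding w_def using t x z by (intro convex_interior_segment Gamma0_convex_dom[OF \<phi>]) auto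
    then obtain r where r: "0 < r" "ball (w n) r \<subseteq> interior (eff_dom \<phi>)" by (meson open_interior openE)
    have wH: "w n \<in> eff_dom H"
      unfolding w_def using Gamma0_convex_dom[OF H] xH zH t[of n] by (auto simp: convex_alt)
    have "0 < min r (t n)" using r t by simp
    then obtain y where y: "norm (y - w n) < min r (t n)" "H y \<le> H (w n)" "y \<in> dom_subdiff H"
      by (rule subdiff_near_point[OF H wH])
    have yH: "y \<in> eff_dom H" using y(3) by (rule dom_subdiff_eff_dom[OF H])
    have yi: "y \<in> interior (eff_dom \<phi>)" using y(1) r(2) by (auto simp: dist_norm norm_minus_commute)
    obtain s where s: "s \<in> subdiff H y" using y(3) by (auto simp: dom_subdiff_def)
    have "- (1 *\<^sub>R grad \<phi> y + (- s)) \<in> subdiff G y"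
    proof (rule subgradient_of_interior_minimizer[OF G _ d\<phi>[OF yi]])
      show "y \<in> eff_dom G" using yH edH by simp
      fix v assume "v \<in> eff_dom \<phi>" "v \<in> eff_dom G"
      then have vH: "v \<in> eff_dom H" using edH by simp
      have "H y + ereal (blinfun_apply s (v - y)) \<le> H v" using s by (simp add: subdiff_def)
      then have "realval H y + blinfun_apply s (v - y) \<le> realval H v"
        using Gamma0_finite[OF H yH] Gamma0_finite[OF H vH] by (metis ereal_less_eq(3) plus_ereal.simps(1))
      then show "realval G y + 1 * realval \<phi> y + blinfun_apply (- s) y \<le> realval G v + 1 * realval \<phi> v + blinfun_apply (- s) v"
        using Hval[OF yH] Hval[OF vH] by (simp add: blinfun.diff_right blinfun.minus_left)
    qed
    then have "y \<in> U_set \<phi> G" using yi by (auto simp: U_set_def dom_subdiff_def)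
    moreover have "realval H y \<le> realval H (w n)"
      using y(2) Gamma0_finite[OF H yH] Gamma0_finite[OF H wH] by (metis ereal_less_eq(3))
    moreover have "realval H (w n) \<le> (1 - t n) * realval H x + t n * realval H z"
      unfolding w_def using t[of n] xH zH by (intro convex_onD[OF Gamma0_convex_on[OF H]]) auto
    ultimately show ?thesis using y(1) yH by (intro exI[of _ y]) auto
  qed
  then obtain y where y: "\<And>n. norm (y n - w n) < t n" "\<And>n. y n \<in> U_set \<phi> G" "\<And>n. y n \<in> eff_dom H"
    "\<And>n. realval H (y n) \<le> (1 - t n) * realval H x + t n * realval H z"
    by metis
  have "w \<longlonglongrightarrow> (1 - 0) *\<^sub>R x + 0 *\<^sub>R z" unfolding w_def by (intro tendsto_intros t0)
  moreover have "(\<lambda>n. y n - w n) \<longlonglongrightarrow> 0"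
    by (rule Lim_null_comparison[OF always_eventually t0]) (use y(1) in \<open>auto intro: less_imp_le\<close>)
  ultimately have yx: "y \<longlonglongrightarrow> x" using tendsto_add[of w x sequentially "\<lambda>n. y n - w n" 0] by simp
  have up: "(\<lambda>n. (1 - t n) * realval H x + t n * realval H z) \<longlonglongrightarrow> (1 - 0) * realval H x + 0 * realval H z"
    by (intro tendsto_intros t0)
  have low: "\<forall>\<^sub>F n in sequentially. c < realval Q (y n)"
    if Q: "Q \<in> Gamma0" "x \<in> eff_dom Q" "\<And>n. y n \<in> eff_dom Q" and c: "c < realval Q x" for Q c
  proof -
    have "ereal c < Q x" using Gamma0_finite[OF Q(1,2)] c by (metis less_ereal.simps(1))
    from Gamma0_lsc[OF Q(1) this] yx have "\<forall>\<^sub>F n in sequentially. ereal c < Q (y n)" by (auto simp: filterlim_iff)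
    then show ?thesis
    proof eventually_elim
      case (elim n)
      then show ?case using Gamma0_finite[OF Q(1) Q(3)[of n]] by (metis less_ereal.simps(1))
    qed
  qed
  have "(\<lambda>n. realval \<phi> (y n)) \<longlonglongrightarrow> realval \<phi> x"
  proof (rule order_tendstoI)
    fix c assume "c < realval \<phi> x"
    then show "\<forall>\<^sub>F n in sequentially. c < realval \<phi> (y n)" using y(3) x edH by (intro low \<phi>) auto
  next
    fix c assume c: "realval \<phi> x < c"
    define e where "e = (c - realval \<phi> x) / 2"
    have e: "0 < e" "realval \<phi> x + 2 * e = c" using c by (simp_all add: e_def field_simps)
    have "\<forall>\<^sub>F n in sequentially. realval G x - e < realval G (y n)" using y(3) x edH e by (intro low G) auto
    moreover have "\<forall>\<^sub>F n in sequentially. (1 - t n) * realval H x + t n * realval H z < realval H x + e"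
      using up e by (intro order_tendstoD(2)) auto
    ultimately show "\<forall>\<^sub>F n in sequentially. realval \<phi> (y n) < c"
    proof eventually_elim
      case (elim n)
      then have "realval H (y n) < realval H x + e" using y(4)[of n] by linarith
      then have "realval \<phi> (y n) < realval \<phi> x + 2 * e" using elim(1) Hval[OF y(3)[of n]] Hval[OF xH] by linarith
      then show ?case using e(2) by simp
    qed
  qed
  then show thesis using that y(2) yx by blast
qed

lemma tendsto_breg:
  assumes "y \<longlonglongrightarrow> x" "(\<lambda>n. realval \<phi> (y n)) \<longlonglongrightarrow> realval \<phi> x"
  shows "(\<lambda>n. breg \<phi> (y n) z) \<longlonglongrightarrow> breg \<phi> x z"
  unfolding breg_def by (intro tendsto_intros assms)

text \<open>A relative smoothness constant may be negative, but then the distance vanishes: in any case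
  \<open>L * breg \<phi>\<close> dominates the nonnegative Bregman distance of \<open>F\<close>.\<close>

lemma rel_smooth_breg_nonneg:
  fixes \<phi> F :: "'a::banach \<Rightarrow> ereal"
  assumes \<phi>: "\<phi> \<in> Gamma0" and d\<phi>: "\<And>x. x \<in> interior (eff_dom \<phi>) \<Longrightarrow> gateaux_differentiable \<phi> x"
    and s: "rel_smooth L F \<phi>" and F: "F \<in> Gamma0" and dom: "eff_dom \<phi> \<subseteq> eff_dom F"
    and x: "x \<in> eff_dom \<phi>" and y: "y \<in> interior (eff_dom \<phi>)"
  shows "0 \<le> L * breg \<phi> x y"
proof -
  have y': "y \<in> eff_dom \<phi>" using y interior_subset by blast
  obtain u where u: "\<And>n. u n \<in> U_set \<phi> \<phi>" "u \<longlonglongrightarrow> x" "(\<lambda>n. realval \<phi> (u n)) \<longlonglongrightarrow> realval \<phi> x"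
    using U_set_approximation[OF \<phi> d\<phi> \<phi> y y' x x] by metis
  have "0 \<le> L * breg \<phi> (u n) y" for n
  proof -
    have un: "u n \<in> interior (eff_dom \<phi>)" using u(1) by (auto simp: U_set_def)
    have "gateaux_differentiable F y" using s y by (auto simp: rel_smooth_def)
    moreover have "u n \<in> eff_dom F" using un dom interior_subset by blast
    ultimately have "realval F y + blinfun_apply (grad F y) (u n - y) \<le> realval F (u n)"
      by (rule gradient_inequality[OF F])
    then show ?thesis using rel_smooth_descent[OF d\<phi> s y un] by simp
  qed
  moreover have "(\<lambda>n. L * breg \<phi> (u n) y) \<longlonglongrightarrow> L * breg \<phi> x y"
    by (intro tendsto_intros tendsto_breg u)
  ultimately show ?thesis by (intro LIMSEQ_le_const) auto
qed

section \<open>One block of the algorithm\<close>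

text \<open>The primal and the dual update have the same structure, with the entropy \<open>\<phi>\<close>, the smooth part \<open>F\<close>
  and the nonsmooth part \<open>G\<close>; the two blocks of the method are two interpretations of this locale.\<close>

locale bregman_block =
  fixes \<phi> F G :: "'a::banach \<Rightarrow> ereal" and L :: real
  assumes entropy: "\<phi> \<in> Gamma0"
    and entropy_diff: "\<And>x. x \<in> interior (eff_dom \<phi>) \<Longrightarrow> gateaux_differentiable \<phi> x"
    and smooth_part: "F \<in> Gamma0" and dom_smooth: "eff_dom \<phi> \<subseteq> eff_dom F"
    and smooth: "rel_smooth L F \<phi>"
    and nonsmooth_part: "G \<in> Gamma0"
begin

definition feasible :: "'a set" where "feasible = eff_dom \<phi> \<inter> eff_dom G"

definition cost :: "'a \<Rightarrow> real" where "cost x = realval F x + realval G x"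

lemma U_set_feasible: "x \<in> U_set \<phi> G \<Longrightarrow> x \<in> feasible"
  using interior_subset dom_subdiff_eff_dom[OF nonsmooth_part] by (auto simp: U_set_def feasible_def)

lemma U_set_interior: "x \<in> U_set \<phi> G \<Longrightarrow> x \<in> interior (eff_dom \<phi>)"
  by (simp add: U_set_def)

lemma U_tilde_set_feasible: "x \<in> U_tilde_set \<phi> G \<Longrightarrow> x \<in> feasible"
  using dom_subdiff_eff_dom[OF nonsmooth_part] by (auto simp: U_tilde_set_def feasible_def)

lemma U_set_subset_tilde: "U_set \<phi> G \<subseteq> U_tilde_set \<phi> G"
  using interior_subset by (auto simp: U_set_def U_tilde_set_def)

lemma convex_feasible: "convex feasible"
  unfolding feasible_def by (intro convex_Int Gamma0_convex_dom entropy nonsmooth_part)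

lemma convex_on_cost: "convex_on feasible cost"
  unfolding cost_def using dom_smooth
  by (intro convex_on_add convex_on_subset[OF Gamma0_convex_on[OF smooth_part]]
      convex_on_subset[OF Gamma0_convex_on[OF nonsmooth_part]] convex_feasible) (auto simp: feasible_def)

lemma bregman_feasible: "x \<in> feasible \<Longrightarrow> y \<in> U_set \<phi> G \<Longrightarrow> bregman \<phi> x y = ereal (breg \<phi> x y)"
  by (intro bregman_eq_breg entropy U_set_interior) (simp_all add: feasible_def)

lemma breg_feasible_nonneg: "x \<in> feasible \<Longrightarrow> y \<in> U_set \<phi> G \<Longrightarrow> 0 \<le> breg \<phi> x y"
  by (intro breg_nonneg entropy entropy_diff U_set_interior) (simp_all add: feasible_def)

lemma smooth_breg_feasible_nonneg: "x \<in> feasible \<Longrightarrow> y \<in> U_set \<phi> G \<Longrightarrow> 0 \<le> L * breg \<phi> x y"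
  by (rule rel_smooth_breg_nonneg[OF entropy entropy_diff smooth smooth_part dom_smooth])
    (auto simp: feasible_def intro: U_set_interior)

lemma resolvent_U_set: "u \<in> bregman_resolvent \<phi> \<gamma> G \<zeta> \<Longrightarrow> u \<in> U_set \<phi> G"
  by (auto simp: bregman_resolvent_def U_set_def dom_subdiff_def intro: gateaux_differentiable_interior)

lemma subdiff_real:
  assumes "p \<in> subdiff G x" "y \<in> eff_dom G"
  shows "realval G x + blinfun_apply p (y - x) \<le> realval G y"
proof -
  have "x \<in> eff_dom G" using assms(1) by (intro dom_subdiff_eff_dom nonsmooth_part) (auto simp: dom_subdiff_def)
  note x = Gamma0_finite[OF nonsmooth_part this] and y = Gamma0_finite[OF nonsmooth_part assms(2)]
  have "G x + ereal (blinfun_apply p (y - x)) \<le> G y" using assms(1) by (simp add: subdiff_def)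
  then show ?thesis using x y by (metis ereal_less_eq(3) plus_ereal.simps(1))
qed

text \<open>A minimizer of the subproblem might lie on the boundary, where \<open>\<phi>\<close> has no gradient. But the
  resolvent point \<open>z\<close> is a minimizer as well, hence so is the midpoint; being interior, the midpoint
  satisfies the optimality condition, and single-valuedness identifies it with \<open>z\<close>.\<close>

lemma arg_min_in_resolvent:
  assumes u: "u \<in> interior (eff_dom \<phi>)" and \<gamma>: "0 < \<gamma>"
    and single: "resolvent_single \<phi> \<gamma> G (grad \<phi> u - \<gamma> *\<^sub>R b)"
    and min: "is_arg_min (\<lambda>y. G y + ereal (blinfun_apply b y) + ereal (1 / \<gamma>) * bregman \<phi> y u) (\<lambda>y. y \<in> eff_dom \<phi>) u'"
  shows "u' \<in> bregman_resolvent \<phi> \<gamma> G (grad \<phi> u - \<gamma> *\<^sub>R b)"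
proof -
  let ?obj = "\<lambda>y. G y + ereal (blinfun_apply b y) + ereal (1 / \<gamma>) * bregman \<phi> y u"
  let ?\<zeta> = "grad \<phi> u - \<gamma> *\<^sub>R b"
  obtain z where zi: "z \<in> interior (eff_dom \<phi>)" and res: "bregman_resolvent \<phi> \<gamma> G ?\<zeta> = {z}"
    using single by (auto simp: resolvent_single_def)
  have zr: "z \<in> bregman_resolvent \<phi> \<gamma> G ?\<zeta>" using res by simp
  then obtain p where p: "p \<in> subdiff G z" "?\<zeta> = grad \<phi> z + \<gamma> *\<^sub>R p" by (auto simp: bregman_resolvent_def)
  define J where "J y = realval G y + blinfun_apply b y + (1 / \<gamma>) * breg \<phi> y u" for y
  have obj: "?obj y = ereal (J y)" if "y \<in> feasible" for y
  proof -
    have "bregman \<phi> y u = ereal (breg \<phi> y u)" using that by (intro bregman_eq_breg entropy u) (simp add: feasible_def)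
    moreover have "G y = ereal (realval G y)" using that by (intro Gamma0_finite nonsmooth_part) (simp add: feasible_def)
    ultimately show ?thesis unfolding J_def by (metis plus_ereal.simps(1) times_ereal.simps(1))
  qed
  have z: "z \<in> feasible" using resolvent_U_set[OF zr] by (rule U_set_feasible)
  have le: "?obj u' \<le> ?obj y" if "y \<in> eff_dom \<phi>" for y
    using min that by (auto simp: is_arg_min_def not_less)
  have u'\<phi>: "u' \<in> eff_dom \<phi>" using min by (simp add: is_arg_min_def)
  have "u' \<in> eff_dom G"
  proof (rule ccontr)
    assume "u' \<notin> eff_dom G"
    then have "?obj u' = \<infinity>"
      using bregman_eq_breg[OF entropy u'\<phi> u] by (simp add: not_eff_dom)
    moreover have "?obj u' \<le> ereal (J z)" using le[of z] obj[OF z] z by (simp add: feasible_def)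
    ultimately have "\<infinity> \<le> ereal (J z)" by (simp only:)
    then show False by simp
  qed
  then have u': "u' \<in> feasible" using u'\<phi> by (simp add: feasible_def)
  have Jmin: "J u' \<le> J y" if "y \<in> feasible" for y
  proof -
    have "?obj u' \<le> ?obj y" using that by (intro le) (simp add: feasible_def)
    then show ?thesis using obj[OF that] obj[OF u'] by (metis ereal_less_eq(3))
  qed
  have gp: "\<gamma> * blinfun_apply p v = blinfun_apply (grad \<phi> u - grad \<phi> z) v - \<gamma> * blinfun_apply b v" for v
  proof -
    have "\<gamma> *\<^sub>R p = (grad \<phi> u - grad \<phi> z) - \<gamma> *\<^sub>R b" using p(2) by (simp add: algebra_simps)
    then have "blinfun_apply (\<gamma> *\<^sub>R p) v = blinfun_apply ((grad \<phi> u - grad \<phi> z) - \<gamma> *\<^sub>R b) v" by simp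
    then show ?thesis unfolding blinfun.diff_left blinfun.scaleR_left by simp
  qed
  have "J z \<le> J u'"
  proof -
    have "\<gamma> * (realval G z + blinfun_apply p (u' - z)) \<le> \<gamma> * realval G u'"
      using subdiff_real[OF p(1), of u'] u' \<gamma> by (intro mult_left_mono) (auto simp: feasible_def)
    moreover have "0 \<le> breg \<phi> u' z" using u' zi by (intro breg_nonneg entropy entropy_diff) (auto simp: feasible_def)
    ultimately have "\<gamma> * J z \<le> \<gamma> * J u'"
      using gp[of "u' - z"] breg_three_point[of \<phi> u z u'] \<gamma>
      by (simp add: J_def algebra_simps blinfun.diff_right)
    then show ?thesis using \<gamma> by simp
  qed
  define m where "m = (1 - 1/2) *\<^sub>R u' + (1/2) *\<^sub>R z"
  have mi: "m \<in> interior (eff_dom \<phi>)"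
    unfolding m_def using zi u' by (intro convex_interior_segment Gamma0_convex_dom entropy) (auto simp: feasible_def)
  have m: "m \<in> feasible" unfolding m_def using convex_feasible[unfolded convex_alt, rule_format, OF u' z, of "1/2"] by simp
  have "J m \<le> (1 - 1/2) * J u' + (1/2) * J z"
  proof -
    have "realval G m \<le> (1 - 1/2) * realval G u' + (1/2) * realval G z"
      "realval \<phi> m \<le> (1 - 1/2) * realval \<phi> u' + (1/2) * realval \<phi> z"
      unfolding m_def using u' z
      by (intro convex_onD[OF Gamma0_convex_on[OF nonsmooth_part]] convex_onD[OF Gamma0_convex_on[OF entropy]]; simp add: feasible_def)+
    moreover have "blinfun_apply q m = (1 - 1/2) * blinfun_apply q u' + (1/2) * blinfun_apply q z" for q :: "'a \<Rightarrow>\<^sub>L real"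
      unfolding m_def blinfun.add_right blinfun.scaleR_right by simp
    ultimately have "\<gamma> * J m \<le> \<gamma> * ((1 - 1/2) * J u' + (1/2) * J z)"
    proof -
      assume a: "realval G m \<le> (1 - 1/2) * realval G u' + (1/2) * realval G z"
        and b: "realval \<phi> m \<le> (1 - 1/2) * realval \<phi> u' + (1/2) * realval \<phi> z"
        and c: "\<And>q :: 'a \<Rightarrow>\<^sub>L real. blinfun_apply q m = (1 - 1/2) * blinfun_apply q u' + (1/2) * blinfun_apply q z"
      have "\<gamma> * realval G m \<le> \<gamma> * ((1 - 1/2) * realval G u' + (1/2) * realval G z)" using a \<gamma> by (intro mult_left_mono) auto
      then show ?thesis using b c[of b] c[of "grad \<phi> u"] \<gamma>
        by (simp add: J_def breg_def blinfun.diff_right algebra_simps)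
    qed
    then show ?thesis using \<gamma> by simp
  qed
  then have "J m \<le> J u' / 2 + J z / 2" by simp
  with \<open>J z \<le> J u'\<close> have "J m \<le> J u'" by (simp add: field_simps)
  then have Jm: "J m \<le> J y" if "y \<in> feasible" for y using Jmin[OF that] by (rule order_trans)
  have "- ((1 / \<gamma>) *\<^sub>R grad \<phi> m + (b - (1 / \<gamma>) *\<^sub>R grad \<phi> u)) \<in> subdiff G m"
  proof (rule subgradient_of_interior_minimizer[OF nonsmooth_part _ entropy_diff[OF mi]])
    show "m \<in> eff_dom G" using m by (simp add: feasible_def)
    fix y assume "y \<in> eff_dom \<phi>" "y \<in> eff_dom G"
    then have "J m \<le> J y" by (intro Jm) (simp add: feasible_def)
    then show "realval G m + 1 / \<gamma> * realval \<phi> m + blinfun_apply (b - (1 / \<gamma>) *\<^sub>R grad \<phi> u) m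
        \<le> realval G y + 1 / \<gamma> * realval \<phi> y + blinfun_apply (b - (1 / \<gamma>) *\<^sub>R grad \<phi> u) y"
      by (simp add: J_def breg_def blinfun.diff_left blinfun.diff_right blinfun.scaleR_left algebra_simps diff_divide_distrib)
  qed
  then have "m \<in> bregman_resolvent \<phi> \<gamma> G ?\<zeta>"
    unfolding bregman_resolvent_def using entropy_diff[OF mi] \<gamma>
    by (auto intro!: bexI simp: scaleR_diff_right scaleR_add_right)
  then have "m = z" using res by simp
  moreover have "2 *\<^sub>R m = u' + z" unfolding m_def by (simp add: scaleR_add_right)
  ultimately have "u' = z" by (simp add: scaleR_2)
  then show ?thesis using zr by simp
qed

text \<open>The optimality condition gives a subgradient of \<open>G\<close> at \<open>u'\<close>, and the three-point identity turns it
  into Bregman distances. The smooth part contributes the descent inequality between \<open>u\<close> and \<open>u'\<close> and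
  the gradient inequality between \<open>u\<close> and \<open>v\<close>.\<close>

lemma step_inequality:
  assumes u: "u \<in> interior (eff_dom \<phi>)" and \<gamma>: "0 < \<gamma>"
    and u': "u' \<in> bregman_resolvent \<phi> \<gamma> G (grad \<phi> u - \<gamma> *\<^sub>R (grad F u + a))"
    and v: "v \<in> feasible"
  shows "cost u' + blinfun_apply a (u' - v)
    \<le> cost v + (1 / \<gamma>) * (breg \<phi> v u - breg \<phi> v u') - (1 / \<gamma> - L) * breg \<phi> u' u"
proof -
  obtain p where p: "p \<in> subdiff G u'" "grad \<phi> u - \<gamma> *\<^sub>R (grad F u + a) = grad \<phi> u' + \<gamma> *\<^sub>R p"
    using u' by (auto simp: bregman_resolvent_def)
  have u'i: "u' \<in> interior (eff_dom \<phi>)" using resolvent_U_set[OF u'] by (rule U_set_interior)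
  have "\<gamma> *\<^sub>R p = (grad \<phi> u - grad \<phi> u') - \<gamma> *\<^sub>R (grad F u + a)" using p(2) by (simp add: algebra_simps)
  then have "blinfun_apply (\<gamma> *\<^sub>R p) (v - u') = blinfun_apply ((grad \<phi> u - grad \<phi> u') - \<gamma> *\<^sub>R (grad F u + a)) (v - u')" by simp
  then have "\<gamma> * blinfun_apply p (v - u') = (breg \<phi> v u' + breg \<phi> u' u - breg \<phi> v u)
      - \<gamma> * (blinfun_apply (grad F u) (v - u') + blinfun_apply a (v - u'))"
    unfolding blinfun.diff_left[of _ "\<gamma> *\<^sub>R _"] breg_three_point blinfun.scaleR_left blinfun.add_left by simp
  then have "blinfun_apply p (v - u') = (1 / \<gamma>) * (breg \<phi> v u' + breg \<phi> u' u - breg \<phi> v u)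
      - (blinfun_apply (grad F u) (v - u') + blinfun_apply a (v - u'))"
    using \<gamma> by (simp add: field_simps)
  moreover have "realval G u' + blinfun_apply p (v - u') \<le> realval G v"
    using v by (intro subdiff_real p) (simp add: feasible_def)
  moreover have "realval F u' - realval F u - blinfun_apply (grad F u) (u' - u) \<le> L * breg \<phi> u' u"
    by (rule rel_smooth_descent[OF entropy_diff smooth u u'i])
  moreover have "realval F u + blinfun_apply (grad F u) (v - u) \<le> realval F v"
    using smooth u v dom_smooth
    by (intro gradient_inequality smooth_part) (auto simp: rel_smooth_def feasible_def)
  ultimately show ?thesis by (simp add: cost_def blinfun.diff_right algebra_simps)
qed

text \<open>Convergence in the distance to \<open>u\<close> for all \<open>u\<close> at once, since the distance depends on its first
  argument only through \<open>\<phi>\<close> and a continuous affine function.\<close>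

lemma feasible_approximation:
  assumes "x \<in> feasible" "z \<in> U_set \<phi> G"
  obtains y :: "nat \<Rightarrow> 'a" where "\<And>n. y n \<in> U_set \<phi> G" "y \<longlonglongrightarrow> x"
    "\<And>u. (\<lambda>n. breg \<phi> (y n) u) \<longlonglongrightarrow> breg \<phi> x u"
proof -
  have x: "x \<in> eff_dom \<phi>" "x \<in> eff_dom G" and z: "z \<in> interior (eff_dom \<phi>)" "z \<in> eff_dom G"
    using assms U_set_feasible[OF assms(2)] U_set_interior[OF assms(2)] by (auto simp: feasible_def)
  obtain y :: "nat \<Rightarrow> 'a" where y: "\<And>n. y n \<in> U_set \<phi> G" "y \<longlonglongrightarrow> x" "(\<lambda>n. realval \<phi> (y n)) \<longlonglongrightarrow> realval \<phi> x"
    using U_set_approximation[OF entropy entropy_diff nonsmooth_part z x] by metis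
  then show thesis using that tendsto_breg by metis
qed

text \<open>Subgradients of \<open>G\<close> are monotone, and by strong convexity of \<open>\<phi>\<close> the symmetrized Bregman distance
  dominates \<open>\<sigma> \<parallel>u - v\<parallel>\<^sup>2\<close>.\<close>

lemma resolvent_lipschitz:
  assumes \<sigma>: "0 < \<sigma>" "\<And>x y. ereal (\<sigma> / 2 * (norm (x - y))\<^sup>2) \<le> bregman \<phi> x y" and \<gamma>: "0 \<le> \<gamma>"
    and u: "u \<in> bregman_resolvent \<phi> \<gamma> G \<zeta>" and v: "v \<in> bregman_resolvent \<phi> \<gamma> G \<eta>"
  shows "norm (u - v) \<le> norm (\<zeta> - \<eta>) / \<sigma>"
proof -
  obtain p q where p: "p \<in> subdiff G u" "\<zeta> = grad \<phi> u + \<gamma> *\<^sub>R p" and q: "q \<in> subdiff G v" "\<eta> = grad \<phi> v + \<gamma> *\<^sub>R q"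
    using u v by (auto simp: bregman_resolvent_def)
  note U = resolvent_U_set[OF u] resolvent_U_set[OF v]
  have D: "u \<in> eff_dom G" "v \<in> eff_dom G" using U[THEN U_set_feasible] by (auto simp: feasible_def)
  have "0 \<le> blinfun_apply (p - q) (u - v)"
    using subdiff_real[OF p(1) D(2)] subdiff_real[OF q(1) D(1)] by (simp add: blinfun.diff_left blinfun.diff_right)
  then have "0 \<le> \<gamma> * blinfun_apply (p - q) (u - v)" using \<gamma> by simp
  moreover have "\<sigma> / 2 * (norm (u - v))\<^sup>2 \<le> breg \<phi> u v" "\<sigma> / 2 * (norm (v - u))\<^sup>2 \<le> breg \<phi> v u"
    using \<sigma>(2)[of u v] \<sigma>(2)[of v u] bregman_feasible[OF U_set_feasible[OF U(1)] U(2)] bregman_feasible[OF U_set_feasible[OF U(2)] U(1)]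
    by simp_all
  moreover have "blinfun_apply (\<zeta> - \<eta>) (u - v) = (breg \<phi> u v + breg \<phi> v u) + \<gamma> * blinfun_apply (p - q) (u - v)"
    unfolding p(2) q(2) breg_add_swap by (simp add: blinfun.diff_left blinfun.add_left blinfun.scaleR_left algebra_simps)
  ultimately have "\<sigma> * (norm (u - v))\<^sup>2 \<le> blinfun_apply (\<zeta> - \<eta>) (u - v)" by (simp add: norm_minus_commute)
  also have "\<dots> \<le> norm (\<zeta> - \<eta>) * norm (u - v)" using norm_blinfun[of "\<zeta> - \<eta>" "u - v"] by simp
  finally have "(\<sigma> * norm (u - v)) * norm (u - v) \<le> norm (\<zeta> - \<eta>) * norm (u - v)" by (simp add: power2_eq_square)
  then have "\<sigma> * norm (u - v) \<le> norm (\<zeta> - \<eta>)" by (cases "u = v") (auto dest: mult_right_le_imp_le)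
  then show ?thesis using \<sigma>(1) by (simp add: field_simps)
qed

end

section \<open>The primal-dual iteration along one path\<close>

locale primal_dual =
  P: bregman_block \<phi>p f g Lp + D: bregman_block \<phi>d hs ls Ld
  for \<phi>p f g :: "'p::banach \<Rightarrow> ereal" and Lp :: real and \<phi>d hs ls :: "'d::banach \<Rightarrow> ereal" and Ld :: real +
  fixes T :: "'p \<Rightarrow>\<^sub>L 'd \<Rightarrow>\<^sub>L real" and lam nu :: "nat \<Rightarrow> real" and lam_inf nu_inf :: real
  assumes lam: "assumption_A2 lam lam_inf" and nu: "assumption_A2 nu nu_inf"
    and compat: "assumption_A3 g ls T \<phi>p \<phi>d Lp Ld lam_inf nu_inf"
begin

abbreviation feasible :: "('p \<times> 'd) set" where "feasible \<equiv> P.feasible \<times> D.feasible"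

abbreviation admissible :: "('p \<times> 'd) set" where "admissible \<equiv> U_set \<phi>p g \<times> U_set \<phi>d ls"

text \<open>With \<open>\<L>\<close> the Lagrangian, this is \<open>\<L> (fst w) (snd v) - \<L> (fst v) (snd w)\<close> at feasible points.\<close>

definition gap :: "'p \<times> 'd \<Rightarrow> 'p \<times> 'd \<Rightarrow> real" where
  "gap w v = P.cost (fst w) + blinfun_apply (blinfun_apply T (fst w)) (snd v) + D.cost (snd w)
     - P.cost (fst v) - blinfun_apply (blinfun_apply T (fst v)) (snd w) - D.cost (snd v)"

text \<open>The Bregman distance with weights \<open>a\<close>, \<open>b\<close>, corrected by the coupling: the correction absorbs the
  cross terms that the extrapolation of the primal iterate leaves behind.\<close>

definition form :: "real \<Rightarrow> real \<Rightarrow> 'p \<times> 'd \<Rightarrow> 'p \<times> 'd \<Rightarrow> real" where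
  "form a b v w = a * breg \<phi>p (fst v) (fst w) + b * breg \<phi>d (snd v) (snd w) - coupling T v w"

abbreviation energy :: "nat \<Rightarrow> 'p \<times> 'd \<Rightarrow> 'p \<times> 'd \<Rightarrow> real" where
  "energy k \<equiv> form (1 / lam k) (1 / nu k)"

lemma lam_pos: "0 < lam k" and nu_pos: "0 < nu k"
  using lam nu by (auto simp: assumption_A2_def)

lemma lam_le: "lam k \<le> lam_inf" and nu_le: "nu k \<le> nu_inf"
  using lam nu by (auto simp: assumption_A2_def intro: incseq_le)

lemma lam_mono: "lam k \<le> lam (Suc k)" and nu_mono: "nu k \<le> nu (Suc k)"
  using lam nu by (auto simp: assumption_A2_def incseq_Suc_iff)

lemma lam_inf_pos: "0 < lam_inf" and nu_inf_pos: "0 < nu_inf"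
  using lam_pos[of 0] lam_le[of 0] nu_pos[of 0] nu_le[of 0] by simp_all

lemma admissible_feasible: "w \<in> admissible \<Longrightarrow> w \<in> feasible"
  by (auto intro: P.U_set_feasible D.U_set_feasible)

lemma weighted_bregman_eq:
  assumes "v \<in> feasible" "w \<in> admissible"
  shows "weighted_bregman a b \<phi>p \<phi>d v w - ereal (coupling T v w) = ereal (form a b v w)"
  using assms by (auto simp: weighted_bregman_def form_def P.bregman_feasible D.bregman_feasible)

lemma form_self: "form a b w w = 0"
  by (simp add: form_def coupling_def)

text \<open>The compatibility assumption only speaks about points where \<open>\<partial>g\<close> and \<open>\<partial>l\<^sup>*\<close> are nonempty; it
  extends to all feasible points by approximation.\<close>

lemma form_limit_nonneg:
  assumes v: "v \<in> feasible" and w: "w \<in> admissible"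
  shows "0 \<le> form (1 / lam_inf - Lp) (1 / nu_inf - Ld) v w"
proof -
  let ?S = "form (1 / lam_inf - Lp) (1 / nu_inf - Ld)"
  have tilde: "0 \<le> ?S u w" if u: "u \<in> U_tilde_set \<phi>p g \<times> U_tilde_set \<phi>d ls" for u
  proof (cases "u = w")
    case True
    then show ?thesis by (simp add: form_self)
  next
    case False
    obtain d :: "'p \<times> 'd \<Rightarrow> 'p \<times> 'd \<Rightarrow> real" and \<epsilon> where d: "\<And>w w'. 0 \<le> d w w'" and \<epsilon>: "0 \<le> \<epsilon>" and
      inf: "ereal \<epsilon> \<le> (INF (w1, w2) \<in> {(w1, w2).
             w1 \<in> U_tilde_set \<phi>p g \<times> U_tilde_set \<phi>d ls \<and> w2 \<in> U_set \<phi>p g \<times> U_set \<phi>d ls \<and> w1 \<noteq> w2}.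
           (weighted_bregman (1 / lam_inf - Lp) (1 / nu_inf - Ld) \<phi>p \<phi>d w1 w2 - ereal (coupling T w1 w2))
             / ereal (d w1 w2))"
      using compat unfolding assumption_A3_def by blast
    have "ereal \<epsilon> \<le> (weighted_bregman (1 / lam_inf - Lp) (1 / nu_inf - Ld) \<phi>p \<phi>d u w - ereal (coupling T u w)) / ereal (d u w)"
      by (rule order_trans[OF inf]) (use u w False in \<open>auto intro!: INF_lower2[of "(u, w)"]\<close>)
    moreover have "u \<in> feasible" using u by (auto intro: P.U_tilde_set_feasible D.U_tilde_set_feasible)
    ultimately have le: "ereal \<epsilon> \<le> ereal (?S u w) / ereal (d u w)" by (simp add: weighted_bregman_eq w)
    show ?thesis
    (* A negative numerator over d u w = 0 would make the quotient minus infinity. *)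
    proof (cases "d u w = 0")
      case True
      show ?thesis
      proof (rule ccontr)
        assume "\<not> 0 \<le> ?S u w"
        then have "ereal (?S u w) / ereal (d u w) = - \<infinity>" using True by (simp add: divide_ereal_def)
        then show False using le by simp
      qed
    next
      case False
      then have "0 < d u w" using d[of u w] by simp
      moreover have "0 \<le> ?S u w / d u w" using le \<epsilon> False by simp
      ultimately show ?thesis by (simp add: zero_le_divide_iff)
    qed
  qed
  obtain y where y: "\<And>n. y n \<in> U_set \<phi>p g" "y \<longlonglongrightarrow> fst v" "\<And>u. (\<lambda>n. breg \<phi>p (y n) u) \<longlonglongrightarrow> breg \<phi>p (fst v) u"
    using P.feasible_approximation[of "fst v" "fst w"] v w by (metis mem_Times_iff)
  obtain z where z: "\<And>n. z n \<in> U_set \<phi>d ls" "z \<longlonglongrightarrow> snd v" "\<And>u. (\<lambda>n. breg \<phi>d (z n) u) \<longlonglongrightarrow> breg \<phi>d (snd v) u"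
    using D.feasible_approximation[of "snd v" "snd w"] v w by (metis mem_Times_iff)
  have "(\<lambda>n. ?S (y n, z n) w) \<longlonglongrightarrow> ?S v w"
    unfolding form_def coupling_def fst_conv snd_conv by (intro tendsto_intros y z)
  moreover have "0 \<le> ?S (y n, z n) w" for n
    using y(1) z(1) P.U_set_subset_tilde D.U_set_subset_tilde by (intro tilde) auto
  ultimately show ?thesis by (intro LIMSEQ_le_const) auto
qed

lemma form_mono:
  assumes "v \<in> feasible" "w \<in> admissible" "a \<le> a'" "b \<le> b'"
  shows "form a b v w \<le> form a' b' v w"
proof -
  have "a * breg \<phi>p (fst v) (fst w) \<le> a' * breg \<phi>p (fst v) (fst w)" "b * breg \<phi>d (snd v) (snd w) \<le> b' * breg \<phi>d (snd v) (snd w)"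
    using assms by (auto intro!: mult_right_mono P.breg_feasible_nonneg D.breg_feasible_nonneg)
  then show ?thesis by (simp add: form_def)
qed

lemma form_step_nonneg:
  assumes "v \<in> feasible" "w \<in> admissible"
  shows "0 \<le> form (1 / lam k - Lp) (1 / nu k - Ld) v w"
proof -
  have "1 / lam_inf \<le> 1 / lam k" "1 / nu_inf \<le> 1 / nu k"
    using lam_pos nu_pos lam_le nu_le by (auto intro!: divide_left_mono mult_pos_pos lam_inf_pos nu_inf_pos)
  then have "form (1 / lam_inf - Lp) (1 / nu_inf - Ld) v w \<le> form (1 / lam k - Lp) (1 / nu k - Ld) v w"
    by (intro form_mono assms) auto
  with form_limit_nonneg[OF assms] show ?thesis by linarith
qed

text \<open>The compatibility assumption subtracts \<open>Lp\<close> and \<open>Ld\<close> times the distances, and these products are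
  nonnegative whatever the sign of the constants.\<close>

lemma energy_nonneg:
  assumes "v \<in> feasible" "w \<in> admissible"
  shows "0 \<le> energy k v w"
proof -
  have "0 \<le> Lp * breg \<phi>p (fst v) (fst w)" "0 \<le> Ld * breg \<phi>d (snd v) (snd w)"
    using assms by (auto intro: P.smooth_breg_feasible_nonneg D.smooth_breg_feasible_nonneg)
  then show ?thesis using form_step_nonneg[OF assms, of k] by (simp add: form_def algebra_simps)
qed

text \<open>Here the step sizes have to be nondecreasing.\<close>

lemma energy_Suc_le:
  assumes "v \<in> feasible" "w \<in> admissible"
  shows "energy (Suc k) v w \<le> energy k v w"
  using lam_pos nu_pos lam_mono nu_mono by (intro form_mono assms) (auto intro!: divide_left_mono mult_pos_pos)

text \<open>Adding the two block inequalities, the bilinear terms combine to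
  \<open>M(v, w) - M(v, w') - M(w', w)\<close> up to sign, where \<open>M\<close> is the coupling, \<open>w\<close> the current and \<open>w'\<close> the new
  iterate; this identity is where \<open>T (2 x' - x)\<close> in the dual step is used. What remains between \<open>w'\<close> and
  \<open>w\<close> is a nonnegative form.\<close>

lemma step_estimate:
  assumes w: "(x, \<mu>) \<in> admissible" and v: "v \<in> feasible"
    and x': "x' \<in> bregman_resolvent \<phi>p (lam k) g (primal_point f T \<phi>p (lam k) \<delta>p x \<mu>)"
    and \<mu>': "\<mu>' \<in> bregman_resolvent \<phi>d (nu k) ls (dual_point hs T \<phi>d (nu k) \<delta>d x x' \<mu>)"
  shows "gap (x', \<mu>') v + energy (Suc k) v (x', \<mu>') \<le> energy k v (x, \<mu>) + noise_pairing \<delta>p \<delta>d (v - (x', \<mu>'))"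
proof -
  have w': "(x', \<mu>') \<in> admissible" using x' \<mu>' by (auto intro: P.resolvent_U_set D.resolvent_U_set)
  have "P.cost x' + blinfun_apply (\<delta>p + adjoint_op T \<mu>) (x' - fst v)
      \<le> P.cost (fst v) + (1 / lam k) * (breg \<phi>p (fst v) x - breg \<phi>p (fst v) x') - (1 / lam k - Lp) * breg \<phi>p x' x"
    using w v x'[unfolded primal_point_def add.assoc] lam_pos[of k]
    by (intro P.step_inequality) (auto intro: P.U_set_interior)
  moreover have "D.cost \<mu>' + blinfun_apply (\<delta>d - blinfun_apply T (2 *\<^sub>R x' - x)) (\<mu>' - snd v)
      \<le> D.cost (snd v) + (1 / nu k) * (breg \<phi>d (snd v) \<mu> - breg \<phi>d (snd v) \<mu>') - (1 / nu k - Ld) * breg \<phi>d \<mu>' \<mu>"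
    using w v \<mu>'[unfolded dual_point_def add_diff_eq[symmetric]] nu_pos[of k]
    by (intro D.step_inequality) (auto intro: D.U_set_interior)
  moreover have "0 \<le> form (1 / lam k - Lp) (1 / nu k - Ld) (x', \<mu>') (x, \<mu>)"
    by (rule form_step_nonneg[OF admissible_feasible[OF w'] w])
  moreover have "energy (Suc k) v (x', \<mu>') \<le> energy k v (x', \<mu>')" by (rule energy_Suc_le[OF v w'])
  moreover have "noise_pairing \<delta>p \<delta>d (v - (x', \<mu>')) = blinfun_apply \<delta>p (fst v - x') + blinfun_apply \<delta>d (snd v - \<mu>')"
    by (simp add: noise_pairing_def)
  ultimately show ?thesis
    by (simp add: gap_def form_def coupling_def blinfun_apply_adjoint_op blinfun.add_left blinfun.diff_left blinfun.diff_right
        blinfun.scaleR_left blinfun.scaleR_right algebra_simps)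
qed

text \<open>Jensen's inequality: the gap is convex in its first argument.\<close>

lemma gap_average:
  assumes w: "\<And>i. i < k \<Longrightarrow> w i \<in> feasible" and k: "1 \<le> k"
  defines "m \<equiv> (1 / real k) *\<^sub>R (\<Sum>i<k. w i)"
  shows "m \<in> feasible" "real k * gap m v \<le> (\<Sum>i<k. gap (w i) v)"
proof -
  have ne: "{..<k} \<noteq> {}" using k by (auto simp: lessThan_empty_iff)
  have sum1: "(\<Sum>i<k. 1 / real k) = 1" using k by simp
  have fm: "fst m = (\<Sum>i<k. (1 / real k) *\<^sub>R fst (w i))" and sm: "snd m = (\<Sum>i<k. (1 / real k) *\<^sub>R snd (w i))"
    by (simp_all add: m_def fst_sum snd_sum scaleR_sum_right)
  have wf: "fst (w i) \<in> P.feasible" "snd (w i) \<in> D.feasible" if "i < k" for i using w[OF that] by auto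
  have "fst m \<in> P.feasible" unfolding fm using wf sum1 by (intro convex_sum P.convex_feasible) auto
  moreover have "snd m \<in> D.feasible" unfolding sm using wf sum1 by (intro convex_sum D.convex_feasible) auto
  ultimately show "m \<in> feasible" by (simp add: mem_Times_iff)
  have "P.cost (fst m) \<le> (\<Sum>i<k. 1 / real k * P.cost (fst (w i)))"
    unfolding fm using wf sum1 ne by (intro convex_on_sum[OF _ _ P.convex_on_cost]) auto
  then have 1: "real k * P.cost (fst m) \<le> (\<Sum>i<k. P.cost (fst (w i)))"
    using k by (simp add: sum_divide_distrib[symmetric] field_simps)
  have "D.cost (snd m) \<le> (\<Sum>i<k. 1 / real k * D.cost (snd (w i)))"
    unfolding sm using wf sum1 ne by (intro convex_on_sum[OF _ _ D.convex_on_cost]) auto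
  then have 2: "real k * D.cost (snd m) \<le> (\<Sum>i<k. D.cost (snd (w i)))"
    using k by (simp add: sum_divide_distrib[symmetric] field_simps)
  have 3: "real k * blinfun_apply (blinfun_apply T (fst m)) (snd v) = (\<Sum>i<k. blinfun_apply (blinfun_apply T (fst (w i))) (snd v))"
    using k by (simp add: m_def fst_sum blinfun.scaleR_right blinfun.sum_right blinfun.scaleR_left blinfun.sum_left)
  have 4: "real k * blinfun_apply (blinfun_apply T (fst v)) (snd m) = (\<Sum>i<k. blinfun_apply (blinfun_apply T (fst v)) (snd (w i)))"
    using k by (simp add: m_def snd_sum blinfun.scaleR_right blinfun.sum_right)
  show "real k * gap m v \<le> (\<Sum>i<k. gap (w i) v)"
    using 1 2 3 4 by (simp add: gap_def sum.distrib sum_subtractf algebra_simps)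
qed

end

locale primal_dual_path = primal_dual +
  fixes x :: "nat \<Rightarrow> 'a" and \<mu> :: "nat \<Rightarrow> 'b"
    and \<delta>p :: "nat \<Rightarrow> 'a \<Rightarrow>\<^sub>L real" and \<delta>d :: "nat \<Rightarrow> 'b \<Rightarrow>\<^sub>L real"
  assumes init: "(x 0, \<mu> 0) \<in> admissible"
    and primal_min: "\<And>k. is_arg_min (primal_objective f g T \<phi>p (lam k) (\<delta>p k) (x k) (\<mu> k)) (\<lambda>y. y \<in> eff_dom \<phi>p) (x (Suc k))"
    and dual_min: "\<And>k. is_arg_min (dual_objective hs ls T \<phi>d (nu k) (\<delta>d k) (x k) (x (Suc k)) (\<mu> k)) (\<lambda>y. y \<in> eff_dom \<phi>d) (\<mu> (Suc k))"
    and resolvents: "\<And>k. assumption_A1_step f g hs ls T \<phi>p \<phi>d (lam k) (nu k) (\<delta>p k) (\<delta>d k) (x k) (\<mu> k) (x (Suc k))"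
begin

lemma resolvent_step:
  assumes adm: "(x k, \<mu> k) \<in> admissible"
  shows "x (Suc k) \<in> bregman_resolvent \<phi>p (lam k) g (primal_point f T \<phi>p (lam k) (\<delta>p k) (x k) (\<mu> k))"
    "\<mu> (Suc k) \<in> bregman_resolvent \<phi>d (nu k) ls (dual_point hs T \<phi>d (nu k) (\<delta>d k) (x k) (x (Suc k)) (\<mu> k))"
proof -
  have xi: "x k \<in> interior (eff_dom \<phi>p)" and \<mu>i: "\<mu> k \<in> interior (eff_dom \<phi>d)"
    using adm by (auto intro: P.U_set_interior D.U_set_interior)
  have "primal_objective f g T \<phi>p (lam k) (\<delta>p k) (x k) (\<mu> k) = (\<lambda>y. g y + ereal (blinfun_apply (grad f (x k) + \<delta>p k + adjoint_op T (\<mu> k)) y)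
      + ereal (1 / lam k) * bregman \<phi>p y (x k))"
  proof
    fix y
    have "g y + ereal a + ereal b = g y + ereal (a + b)" for a b by (simp add: add.assoc)
    then show "primal_objective f g T \<phi>p (lam k) (\<delta>p k) (x k) (\<mu> k) y
      = g y + ereal (blinfun_apply (grad f (x k) + \<delta>p k + adjoint_op T (\<mu> k)) y) + ereal (1 / lam k) * bregman \<phi>p y (x k)"
      unfolding primal_objective_def blinfun.add_left[of _ "adjoint_op T (\<mu> k)"] blinfun_apply_adjoint_op by simp
  qed
  then show "x (Suc k) \<in> bregman_resolvent \<phi>p (lam k) g (primal_point f T \<phi>p (lam k) (\<delta>p k) (x k) (\<mu> k))"
    unfolding primal_point_def
    using primal_min[of k] resolvents[of k] lam_pos[of k] xi
    by (intro P.arg_min_in_resolvent) (auto simp: assumption_A1_step_def primal_point_def)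
  have "dual_objective hs ls T \<phi>d (nu k) (\<delta>d k) (x k) (x (Suc k)) (\<mu> k) = (\<lambda>y. ls y
      + ereal (blinfun_apply (grad hs (\<mu> k) + \<delta>d k - blinfun_apply T (2 *\<^sub>R x (Suc k) - x k)) y) + ereal (1 / nu k) * bregman \<phi>d y (\<mu> k))"
  proof
    fix y
    have "ls y + ereal a - ereal b = ls y + ereal (a - b)" for a b by (cases "ls y") auto
    then show "dual_objective hs ls T \<phi>d (nu k) (\<delta>d k) (x k) (x (Suc k)) (\<mu> k) y = ls y
      + ereal (blinfun_apply (grad hs (\<mu> k) + \<delta>d k - blinfun_apply T (2 *\<^sub>R x (Suc k) - x k)) y) + ereal (1 / nu k) * bregman \<phi>d y (\<mu> k)"
      unfolding dual_objective_def blinfun.diff_left[of _ "blinfun_apply T _"] by simp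
  qed
  then show "\<mu> (Suc k) \<in> bregman_resolvent \<phi>d (nu k) ls (dual_point hs T \<phi>d (nu k) (\<delta>d k) (x k) (x (Suc k)) (\<mu> k))"
    unfolding dual_point_def
    using dual_min[of k] resolvents[of k] nu_pos[of k] \<mu>i
    by (intro D.arg_min_in_resolvent) (auto simp: assumption_A1_step_def dual_point_def)
qed

lemma iterate_admissible: "(x k, \<mu> k) \<in> admissible"
proof (induction k)
  case 0 show ?case by (rule init)
next
  case (Suc k)
  then show ?case using resolvent_step[OF Suc] by (auto intro: P.resolvent_U_set D.resolvent_U_set)
qed

lemmas iterate_resolvent = resolvent_step[OF iterate_admissible]

lemma energy_telescope:
  assumes v: "v \<in> feasible"
  shows "(\<Sum>i<k. gap (x (Suc i), \<mu> (Suc i)) v) + energy k v (x k, \<mu> k)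
    \<le> energy 0 v (x 0, \<mu> 0) + (\<Sum>i<k. noise_pairing (\<delta>p i) (\<delta>d i) (v - (x (Suc i), \<mu> (Suc i))))"
proof (induction k)
  case (Suc k)
  then show ?case using step_estimate[OF iterate_admissible v iterate_resolvent, of k] by simp
qed simp

definition mean :: "nat \<Rightarrow> 'a \<times> 'b" where
  "mean k = ((1 / real k) *\<^sub>R (\<Sum>i=1..k. x i), (1 / real k) *\<^sub>R (\<Sum>i=1..k. \<mu> i))"

lemma mean_eq: "mean k = (1 / real k) *\<^sub>R (\<Sum>i<k. (x (Suc i), \<mu> (Suc i)))"
  by (simp add: mean_def prod_eq_iff fst_sum snd_sum sum.atLeast1_atMost_eq)

lemma mean_feasible: "1 \<le> k \<Longrightarrow> mean k \<in> feasible"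
  unfolding mean_eq by (intro gap_average(1) admissible_feasible iterate_admissible)

theorem mean_gap_bound:
  assumes v: "v \<in> feasible" and k: "1 \<le> k"
  shows "real k * gap (mean k) v
    \<le> energy 0 v (x 0, \<mu> 0) + (\<Sum>i<k. noise_pairing (\<delta>p i) (\<delta>d i) (v - (x (Suc i), \<mu> (Suc i))))"
proof -
  have "real k * gap (mean k) v \<le> (\<Sum>i<k. gap (x (Suc i), \<mu> (Suc i)) v)"
    unfolding mean_eq by (intro gap_average(2) admissible_feasible iterate_admissible k)
  then show ?thesis
    using energy_telescope[OF v, of k] energy_nonneg[OF v iterate_admissible, of k k] by linarith
qed

end

section \<open>Saddle points and the duality gap\<close>

context bregman_block
begin

text \<open>For infeasible \<open>x\<close> the level \<open>a\<close> is arbitrary: the cost extended by \<open>\<infinity>\<close> is in \<open>Gamma0\<close>, which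
  is where closedness of the constraint set enters.\<close>

lemma cost_affine_minorant:
  assumes cl: "closed (eff_dom \<phi>)" and ne: "feasible \<noteq> {}" and a: "x \<in> feasible \<Longrightarrow> a < cost x"
  obtains p where "\<And>z. z \<in> feasible \<Longrightarrow> a + blinfun_apply p (z - x) \<le> cost z"
proof -
  define H where "H = (\<lambda>x. F x + (G x + set_indicator (eff_dom \<phi>) x))"
  have conv: "convex (eff_dom \<phi>)" by (rule Gamma0_convex_dom[OF entropy])
  have ind: "set_indicator (eff_dom \<phi>) \<in> Gamma0"
    using ne by (intro Gamma0_indicator cl conv) (auto simp: feasible_def)
  have GI: "(\<lambda>x. G x + set_indicator (eff_dom \<phi>) x) \<in> Gamma0"
    using ne by (intro Gamma0_add nonsmooth_part ind) (auto simp: feasible_def)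
  have edGI: "eff_dom (\<lambda>x. G x + set_indicator (eff_dom \<phi>) x) = feasible"
    by (auto simp: eff_dom_add[OF Gamma0_not_MInf[OF nonsmooth_part] Gamma0_not_MInf[OF ind]] feasible_def)
  have sub: "feasible \<subseteq> eff_dom F" using dom_smooth by (auto simp: feasible_def)
  have H: "H \<in> Gamma0"
    unfolding H_def using ne sub by (intro Gamma0_add smooth_part GI) (auto simp: edGI)
  have edH: "eff_dom H = feasible"
    unfolding H_def using sub
    by (auto simp: eff_dom_add[OF Gamma0_not_MInf[OF smooth_part] Gamma0_not_MInf[OF GI]] edGI)
  have val: "H z = ereal (cost z)" if z: "z \<in> feasible" for z
  proof -
    have "F z = ereal (realval F z)" "G z = ereal (realval G z)" "set_indicator (eff_dom \<phi>) z = 0"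
      using z sub by (auto intro!: Gamma0_finite smooth_part nonsmooth_part simp: feasible_def set_indicator_def)
    then show ?thesis unfolding H_def cost_def by (metis add.right_neutral plus_ereal.simps(1))
  qed
  have "ereal a < H x" using a val[of x] edH not_eff_dom[of x H] by (cases "x \<in> feasible") auto
  then obtain p where p: "\<And>z. ereal (a + blinfun_apply p (z - x)) \<le> H z" using Gamma0_affine_minorant[OF H] by metis
  show thesis
  proof (rule that)
    fix z assume "z \<in> feasible"
    then show "a + blinfun_apply p (z - x) \<le> cost z" using p[of z] val by simp
  qed
qed

end

context primal_dual
begin

text \<open>A point at which no affine minorant of any \<open>gap (\<cdot>) v\<close> is positive has nonpositive gaps, because
  the gap, extended by \<open>\<infinity>\<close> off the feasible set, is the supremum of its affine minorants. This form of
  lower semicontinuity passes directly to weak limits and to expectations.\<close>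

lemma gap_nonpos_of_minorants:
  assumes cl: "closed (eff_dom \<phi>p)" "closed (eff_dom \<phi>d)" and ne: "feasible \<noteq> {}"
    and le: "\<And>v c (Q :: ('p \<times> 'd) \<Rightarrow>\<^sub>L real). v \<in> feasible \<Longrightarrow>
      (\<And>w. w \<in> feasible \<Longrightarrow> c + blinfun_apply Q (w - e) \<le> gap w v) \<Longrightarrow> c \<le> 0"
  shows "e \<in> feasible" "\<And>v. v \<in> feasible \<Longrightarrow> gap e v \<le> 0"
proof -
  have neP: "P.feasible \<noteq> {}" and neD: "D.feasible \<noteq> {}" using ne by auto
  have key: "a + b \<le> P.cost (fst v) + D.cost (snd v) + blinfun_apply (blinfun_apply T (fst v)) (snd e)
      - blinfun_apply (blinfun_apply T (fst e)) (snd v)"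
    if a: "fst e \<in> P.feasible \<Longrightarrow> a < P.cost (fst e)" and b: "snd e \<in> D.feasible \<Longrightarrow> b < D.cost (snd e)"
      and v: "v \<in> feasible" for a b v
  proof -
    obtain p where p: "\<And>z. z \<in> P.feasible \<Longrightarrow> a + blinfun_apply p (z - fst e) \<le> P.cost z"
      using P.cost_affine_minorant[OF cl(1) neP a] by metis
    obtain q where q: "\<And>z. z \<in> D.feasible \<Longrightarrow> b + blinfun_apply q (z - snd e) \<le> D.cost z"
      using D.cost_affine_minorant[OF cl(2) neD b] by metis
    let ?Q = "\<lambda>u. blinfun_apply p (fst u) + blinfun_apply q (snd u)
      + blinfun_apply (blinfun_apply T (fst u)) (snd v) - blinfun_apply (blinfun_apply T (fst v)) (snd u)"
    have Q: "blinfun_apply (Blinfun ?Q) = ?Q"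
      by (intro bounded_linear_Blinfun_apply bounded_linear_intros bounded_linear_fst bounded_linear_snd)
    let ?c = "a + b + blinfun_apply (blinfun_apply T (fst e)) (snd v) - blinfun_apply (blinfun_apply T (fst v)) (snd e)
      - P.cost (fst v) - D.cost (snd v)"
    have "?c \<le> 0"
    proof (rule le[OF v, of _ "Blinfun ?Q"])
      fix w assume "w \<in> feasible"
      then have "a + blinfun_apply p (fst w - fst e) \<le> P.cost (fst w)" "b + blinfun_apply q (snd w - snd e) \<le> D.cost (snd w)"
        using p q by auto
      then show "?c + blinfun_apply (Blinfun ?Q) (w - e) \<le> gap w v"
        unfolding Q by (simp add: gap_def blinfun.diff_right blinfun.diff_left)
    qed
    then show ?thesis by simp
  qed
  obtain v0 where v0: "v0 \<in> feasible" using ne by blast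
  (* For an infeasible component the level in key is arbitrary, so it can be chosen to violate the bound. *)
  have 1: "fst e \<in> P.feasible"
  proof (rule ccontr)
    assume n: "fst e \<notin> P.feasible"
    let ?r = "P.cost (fst v0) + D.cost (snd v0) + blinfun_apply (blinfun_apply T (fst v0)) (snd e)
      - blinfun_apply (blinfun_apply T (fst e)) (snd v0)"
    let ?b = "D.cost (snd e) - 1"
    have "(?r - ?b + 1) + ?b \<le> ?r" using n by (intro key v0) auto
    then show False by simp
  qed
  have 2: "snd e \<in> D.feasible"
  proof (rule ccontr)
    assume n: "snd e \<notin> D.feasible"
    let ?r = "P.cost (fst v0) + D.cost (snd v0) + blinfun_apply (blinfun_apply T (fst v0)) (snd e)
      - blinfun_apply (blinfun_apply T (fst e)) (snd v0)"
    let ?b = "P.cost (fst e) - 1"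
    have "?b + (?r - ?b + 1) \<le> ?r" using n by (intro key v0) auto
    then show False by simp
  qed
  show "e \<in> feasible" using 1 2 by (simp add: mem_Times_iff)
  fix v assume v: "v \<in> feasible"
  show "gap e v \<le> 0"
  proof (rule field_le_epsilon)
    fix \<epsilon> :: real assume "0 < \<epsilon>"
    then have "(P.cost (fst e) - \<epsilon> / 2) + (D.cost (snd e) - \<epsilon> / 2) \<le> P.cost (fst v) + D.cost (snd v)
      + blinfun_apply (blinfun_apply T (fst v)) (snd e) - blinfun_apply (blinfun_apply T (fst e)) (snd v)"
      by (intro key v) auto
    then show "gap e v \<le> 0 + \<epsilon>" by (simp add: gap_def)
  qed
qed

end

text \<open>The dual functions are now conjugates, and the entropy domains are the constraint sets.\<close>

locale saddle_problem =
  primal_dual \<phi>p f g Lp \<phi>d "conjugate h" "conjugate l" Ld T lam nu lam_inf nu_inf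
  for \<phi>p f g :: "'p::banach \<Rightarrow> ereal" and Lp :: real and \<phi>d :: "'d::banach \<Rightarrow> ereal"
    and h l :: "('d \<Rightarrow>\<^sub>L real) \<Rightarrow> ereal" and Ld T lam nu lam_inf nu_inf +
  fixes Cp :: "'p set" and Cd :: "'d set"
  assumes dom_p: "eff_dom \<phi>p = Cp" and dom_d: "eff_dom \<phi>d = Cd"
    and closed: "closed Cp" "closed Cd"
begin

abbreviation "Lag \<equiv> lagrangian Cp Cd f g h l T"

lemma lagrangian_feasible:
  assumes x: "x \<in> P.feasible" and \<mu>: "\<mu> \<in> D.feasible"
  shows "Lag x \<mu> = ereal (P.cost x + blinfun_apply (blinfun_apply T x) \<mu> - D.cost \<mu>)"
proof -
  obtain a b where ab: "f x = ereal a" "g x = ereal b"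
    using x P.dom_smooth Gamma0_finite[OF P.smooth_part, of x] Gamma0_finite[OF P.nonsmooth_part, of x]
    by (auto simp: P.feasible_def)
  obtain c d where cd: "conjugate h \<mu> = ereal c" "conjugate l \<mu> = ereal d"
    using \<mu> D.dom_smooth Gamma0_finite[OF D.smooth_part, of \<mu>] Gamma0_finite[OF D.nonsmooth_part, of \<mu>]
    by (auto simp: D.feasible_def)
  have "set_indicator Cp x = 0" "set_indicator Cd \<mu> = 0"
    using x \<mu> dom_p dom_d by (auto simp: P.feasible_def D.feasible_def set_indicator_def)
  then show ?thesis by (simp add: lagrangian_def P.cost_def D.cost_def ab cd)
qed

lemma lagrangian_infeasible_primal:
  assumes "x \<notin> P.feasible"
  shows "Lag x \<mu> = \<infinity>"
proof -
  have "f x + g x + set_indicator Cp x = \<infinity>"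
    using assms dom_p not_eff_dom[of x g] Gamma0_not_MInf[OF P.smooth_part, of x] Gamma0_not_MInf[OF P.nonsmooth_part, of x]
    by (cases "x \<in> Cp") (auto simp: P.feasible_def set_indicator_def)
  then show ?thesis unfolding lagrangian_def by (simp only:) simp
qed

lemma lagrangian_infeasible_dual:
  assumes x: "x \<in> P.feasible" and \<mu>: "\<mu> \<notin> D.feasible"
  shows "Lag x \<mu> = - \<infinity>"
proof -
  obtain a b where ab: "f x = ereal a" "g x = ereal b"
    using x P.dom_smooth Gamma0_finite[OF P.smooth_part, of x] Gamma0_finite[OF P.nonsmooth_part, of x]
    by (auto simp: P.feasible_def)
  have "set_indicator Cp x = 0" using x dom_p by (auto simp: P.feasible_def set_indicator_def)
  then obtain a where a: "f x + g x + set_indicator Cp x + ereal (blinfun_apply (blinfun_apply T x) \<mu>) = ereal a"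
    by (simp add: ab)
  have "conjugate h \<mu> \<noteq> - \<infinity>" "conjugate l \<mu> \<noteq> - \<infinity>" using Gamma0_not_MInf D.smooth_part D.nonsmooth_part by blast+
  moreover have "conjugate l \<mu> = \<infinity> \<or> set_indicator Cd \<mu> = \<infinity>"
    using \<mu> dom_d not_eff_dom[of \<mu> "conjugate l"] by (auto simp: D.feasible_def set_indicator_def)
  ultimately show ?thesis unfolding lagrangian_def a
    by (cases "conjugate h \<mu>"; cases "conjugate l \<mu>") (auto simp: set_indicator_def)
qed

text \<open>Infeasible competitors are harmless by the sign conventions: the Lagrangian is \<open>\<infinity>\<close> off the primal
  and \<open>- \<infinity>\<close> off the dual feasible set.\<close>

lemma saddle_pointI:
  assumes e: "e \<in> feasible" and gap: "\<And>v. v \<in> feasible \<Longrightarrow> gap e v \<le> 0"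
  shows "saddle_point Lag e"
  unfolding saddle_point_def
proof (intro allI conjI)
  have e1: "fst e \<in> P.feasible" and e2: "snd e \<in> D.feasible" using e by auto
  fix x \<mu>
  show "Lag (fst e) \<mu> \<le> Lag (fst e) (snd e)"
  proof (cases "\<mu> \<in> D.feasible")
    case True
    then show ?thesis using gap[of "(fst e, \<mu>)"] e1 e2 by (simp add: lagrangian_feasible gap_def)
  qed (simp add: lagrangian_infeasible_dual e1)
  show "Lag (fst e) (snd e) \<le> Lag x (snd e)"
  proof (cases "x \<in> P.feasible")
    case True
    then show ?thesis using gap[of "(x, snd e)"] e1 e2 by (simp add: lagrangian_feasible gap_def)
  qed (simp add: lagrangian_infeasible_primal)
qed

lemma saddle_pointD:
  assumes s: "saddle_point Lag e" and ne: "feasible \<noteq> {}"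
  shows "e \<in> feasible" "\<And>v. v \<in> feasible \<Longrightarrow> 0 \<le> gap v e"
proof -
  obtain v0 where v0: "fst v0 \<in> P.feasible" "snd v0 \<in> D.feasible" using ne by auto
  have l: "Lag (fst e) \<mu> \<le> Lag (fst e) (snd e)" and r: "Lag (fst e) (snd e) \<le> Lag x (snd e)" for x \<mu>
    using s by (auto simp: saddle_point_def)
  have e1: "fst e \<in> P.feasible"
  proof (rule ccontr)
    assume "fst e \<notin> P.feasible"
    then have "\<infinity> \<le> Lag (fst v0) (snd e)" using r[of "fst v0"] by (simp add: lagrangian_infeasible_primal)
    then show False using v0(1)
      by (cases "snd e \<in> D.feasible") (simp_all add: lagrangian_feasible lagrangian_infeasible_dual)
  qed
  have e2: "snd e \<in> D.feasible"
  proof (rule ccontr)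
    assume "snd e \<notin> D.feasible"
    then have "Lag (fst e) (snd v0) \<le> - \<infinity>" using l[of "snd v0"] e1 by (simp add: lagrangian_infeasible_dual)
    then show False using v0(2) e1 by (simp add: lagrangian_feasible)
  qed
  show "e \<in> feasible" using e1 e2 by (simp add: mem_Times_iff)
  fix v assume "v \<in> feasible"
  then have "ereal (P.cost (fst e) + blinfun_apply (blinfun_apply T (fst e)) (snd v) - D.cost (snd v))
      \<le> ereal (P.cost (fst v) + blinfun_apply (blinfun_apply T (fst v)) (snd e) - D.cost (snd e))"
    using order_trans[OF l[of "snd v"] r[of "fst v"]] e1 e2 by (auto simp: lagrangian_feasible)
  then show "0 \<le> gap v e" by (simp add: gap_def)
qed

end

section \<open>Extended expectations\<close>

lemma ext_expectation_mono_AE: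
  assumes "AE \<omega> in M. X \<omega> \<le> Z \<omega>"
  shows "ext_expectation M X \<le> ext_expectation M Z"
  unfolding ext_expectation_def
proof (rule ereal_minus_mono)
  show "enn2ereal (\<integral>\<^sup>+ \<omega>. e2ennreal (X \<omega>) \<partial>M) \<le> enn2ereal (\<integral>\<^sup>+ \<omega>. e2ennreal (Z \<omega>) \<partial>M)"
    using assms unfolding less_eq_ennreal.rep_eq[symmetric] by (intro nn_integral_mono_AE) (auto intro: e2ennreal_mono elim!: eventually_mono)
  show "enn2ereal (\<integral>\<^sup>+ \<omega>. e2ennreal (- Z \<omega>) \<partial>M) \<le> enn2ereal (\<integral>\<^sup>+ \<omega>. e2ennreal (- X \<omega>) \<partial>M)"
    using assms unfolding less_eq_ennreal.rep_eq[symmetric] by (intro nn_integral_mono_AE) (auto intro: e2ennreal_mono elim!: eventually_mono)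
qed

lemma ext_expectation_real:
  "ext_expectation M (\<lambda>\<omega>. ereal (Y \<omega>))
    = enn2ereal (\<integral>\<^sup>+\<omega>. ennreal (Y \<omega>) \<partial>M) - enn2ereal (\<integral>\<^sup>+\<omega>. ennreal (- Y \<omega>) \<partial>M)"
  by (simp add: ext_expectation_def ennreal_def e2ennreal_def)

lemma (in prob_space) ext_expectation_const: "ext_expectation M (\<lambda>_. ereal c) = ereal c"
  unfolding ext_expectation_real using emeasure_space_1
  by (cases "0 \<le> c") (auto simp: ennreal_neg enn2ereal_ennreal zero_ennreal.rep_eq)

text \<open>Integrate \<open>(Y + Z)\<^sup>+ + Y\<^sup>- + Z\<^sup>- = (Y + Z)\<^sup>- + Y\<^sup>+ + Z\<^sup>+\<close>. Only an inequality holds: when a positive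
  part has infinite mean, the right-hand side is \<open>\<infinity>\<close> by the convention \<open>\<infinity> - \<infinity> = \<infinity>\<close>.\<close>

lemma ext_expectation_add_le:
  assumes [measurable]: "Y \<in> borel_measurable M" "Z \<in> borel_measurable M"
  shows "ext_expectation M (\<lambda>\<omega>. ereal (Y \<omega> + Z \<omega>)) \<le> ext_expectation M (\<lambda>\<omega>. ereal (Y \<omega>)) + ext_expectation M (\<lambda>\<omega>. ereal (Z \<omega>))"
proof -
  define A B where "A = (\<integral>\<^sup>+\<omega>. ennreal (Y \<omega> + Z \<omega>) \<partial>M)" and "B = (\<integral>\<^sup>+\<omega>. ennreal (- (Y \<omega> + Z \<omega>)) \<partial>M)"
  define a1 b1 where "a1 = (\<integral>\<^sup>+\<omega>. ennreal (Y \<omega>) \<partial>M)" and "b1 = (\<integral>\<^sup>+\<omega>. ennreal (- Y \<omega>) \<partial>M)"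
  define a2 b2 where "a2 = (\<integral>\<^sup>+\<omega>. ennreal (Z \<omega>) \<partial>M)" and "b2 = (\<integral>\<^sup>+\<omega>. ennreal (- Z \<omega>) \<partial>M)"
  have pw: "ennreal (y + z) + (ennreal (- y) + ennreal (- z)) = ennreal (- (y + z)) + (ennreal y + ennreal z)" for y z :: real
    by (cases "0 \<le> y"; cases "0 \<le> z"; cases "0 \<le> y + z") (auto simp: ennreal_neg simp flip: ennreal_plus)
  have eq: "A + (b1 + b2) = B + (a1 + a2)"
    unfolding A_def B_def a1_def b1_def a2_def b2_def by (simp add: pw flip: nn_integral_add)
  have "ennreal (y + z) \<le> ennreal y + ennreal z" for y z :: real
    by (cases "0 \<le> y"; cases "0 \<le> z") (auto simp: ennreal_neg intro!: ennreal_leI simp flip: ennreal_plus)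
  then have le: "A \<le> a1 + a2"
    unfolding A_def a1_def a2_def by (subst nn_integral_add[symmetric]) (auto intro!: nn_integral_mono)
  show ?thesis
    unfolding ext_expectation_real A_def[symmetric] B_def[symmetric] a1_def[symmetric] b1_def[symmetric] a2_def[symmetric] b2_def[symmetric]
  proof (cases "a1 = \<infinity> \<or> a2 = \<infinity>")
    case True
    then have "enn2ereal a1 - enn2ereal b1 + (enn2ereal a2 - enn2ereal b2) = \<infinity>"
      by (auto simp: infinity_ennreal_def)
    then show "enn2ereal A - enn2ereal B \<le> enn2ereal a1 - enn2ereal b1 + (enn2ereal a2 - enn2ereal b2)"
      by (simp only: ereal_less_eq(1))
  next
    case False
    then obtain r1 r2 where r: "0 \<le> r1" "a1 = ennreal r1" "0 \<le> r2" "a2 = ennreal r2"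
      by (metis ennreal_cases infinity_ennreal_def)
    have "A \<noteq> \<infinity>" using le r by (auto simp: top_unique simp flip: ennreal_plus)
    then obtain s where s: "0 \<le> s" "A = ennreal s" by (metis ennreal_cases infinity_ennreal_def)
    show "enn2ereal A - enn2ereal B \<le> enn2ereal a1 - enn2ereal b1 + (enn2ereal a2 - enn2ereal b2)"
    proof (cases "B = \<infinity>")
      case True
      then show ?thesis using s by (simp add: infinity_ennreal_def enn2ereal_ennreal)
    next
      case False
      then obtain t where t: "0 \<le> t" "B = ennreal t" by (metis ennreal_cases infinity_ennreal_def)
      have "A + (b1 + b2) \<noteq> \<infinity>" unfolding eq using r t by (simp flip: ennreal_plus)
      then have "b1 \<noteq> \<infinity>" "b2 \<noteq> \<infinity>" by auto
      then obtain u1 u2 where u: "0 \<le> u1" "b1 = ennreal u1" "0 \<le> u2" "b2 = ennreal u2"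
        by (metis ennreal_cases infinity_ennreal_def)
      have "s + (u1 + u2) = t + (r1 + r2)" using eq r s t u by (simp flip: ennreal_plus)
      then show ?thesis using r s t u by (simp add: enn2ereal_ennreal)
    qed
  qed
qed

lemma ext_expectation_scale:
  assumes [measurable]: "Y \<in> borel_measurable M" and a: "0 < a"
  shows "ext_expectation M (\<lambda>\<omega>. ereal (Y \<omega> / a)) = ext_expectation M (\<lambda>\<omega>. ereal (Y \<omega>)) / ereal a"
proof -
  have div: "ennreal (y / a) = ennreal (1 / a) * ennreal y" for y
    using a by (cases "0 \<le> y") (auto simp: ennreal_neg divide_le_0_iff simp flip: ennreal_mult)
  have sc: "enn2ereal (\<integral>\<^sup>+\<omega>. ennreal (W \<omega> / a) \<partial>M) = ereal (1 / a) * enn2ereal (\<integral>\<^sup>+\<omega>. ennreal (W \<omega>) \<partial>M)"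
    if "W \<in> borel_measurable M" for W :: "'a \<Rightarrow> real"
  proof -
    have "(\<integral>\<^sup>+\<omega>. ennreal (W \<omega> / a) \<partial>M) = (\<integral>\<^sup>+\<omega>. ennreal (1 / a) * ennreal (W \<omega>) \<partial>M)"
      by (intro nn_integral_cong div)
    also have "\<dots> = ennreal (1 / a) * (\<integral>\<^sup>+\<omega>. ennreal (W \<omega>) \<partial>M)" using that by (intro nn_integral_cmult) simp
    finally show ?thesis using a by (simp add: times_ennreal.rep_eq)
  qed
  have "ereal (1 / a) * p - ereal (1 / a) * q = (p - q) / ereal a" for p q :: ereal
    using a by (cases p; cases q) (auto simp: field_simps divide_ereal_def)
  then show ?thesis using sc[of Y] sc[of "\<lambda>\<omega>. - Y \<omega>"] by (simp add: ext_expectation_real)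
qed

lemma (in prob_space) ext_expectation_affine_sum_le:
  fixes Y :: "nat \<Rightarrow> 'a \<Rightarrow> real"
  assumes [measurable]: "\<And>i. Y i \<in> borel_measurable M"
  shows "ext_expectation M (\<lambda>\<omega>. ereal (c + (\<Sum>i<k. Y i \<omega>))) \<le> ereal c + (\<Sum>i<k. ext_expectation M (\<lambda>\<omega>. ereal (Y i \<omega>)))"
proof (induction k)
  case 0 show ?case by (simp add: ext_expectation_const)
next
  case (Suc k)
  have "ext_expectation M (\<lambda>\<omega>. ereal ((c + (\<Sum>i<k. Y i \<omega>)) + Y k \<omega>))
      \<le> ext_expectation M (\<lambda>\<omega>. ereal (c + (\<Sum>i<k. Y i \<omega>))) + ext_expectation M (\<lambda>\<omega>. ereal (Y k \<omega>))"
    by (rule ext_expectation_add_le) measurable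
  also have "\<dots> \<le> (ereal c + (\<Sum>i<k. ext_expectation M (\<lambda>\<omega>. ereal (Y i \<omega>)))) + ext_expectation M (\<lambda>\<omega>. ereal (Y k \<omega>))"
    by (intro add_right_mono Suc)
  finally show ?case by (simp add: add.assoc)
qed

section \<open>Strongly measurable functions\<close>

text \<open>Convergence is required only on \<open>G\<close>, which need not be measurable: the method is well behaved on a
  set of full measure, and constructions from the iterates make sense only there.\<close>

definition strongly_measurable_on :: "'w measure \<Rightarrow> 'w set \<Rightarrow> ('w \<Rightarrow> 'a::topological_space) \<Rightarrow> bool" where
  "strongly_measurable_on M G X \<longleftrightarrow>
     (\<exists>s. (\<forall>n. simple_function M (s n)) \<and> (\<forall>\<omega>\<in>G. (\<lambda>n. s n \<omega>) \<longlonglongrightarrow> X \<omega>))"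

lemma strongly_measurable_iff_on: "strongly_measurable M X \<longleftrightarrow> strongly_measurable_on M (space M) X"
  by (simp add: strongly_measurable_def strongly_measurable_on_def)

lemma strongly_measurable_on_subset:
  "strongly_measurable_on M G X \<Longrightarrow> G' \<subseteq> G \<Longrightarrow> strongly_measurable_on M G' X"
  unfolding strongly_measurable_on_def by blast

lemma strongly_measurable_borel:
  fixes X :: "'w \<Rightarrow> 'a::metric_space"
  assumes "strongly_measurable M X" shows "X \<in> borel_measurable M"
proof -
  obtain s where s: "\<And>n. simple_function M (s n)" "\<And>\<omega>. \<omega> \<in> space M \<Longrightarrow> (\<lambda>n. s n \<omega>) \<longlonglongrightarrow> X \<omega>"
    using assms by (auto simp: strongly_measurable_def)
  show ?thesis by (rule borel_measurable_LIMSEQ_metric[OF borel_measurable_simple_function[OF s(1)] s(2)])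
qed

lemma strongly_measurable_range_separable:
  assumes "strongly_measurable M X"
  obtains Q :: "nat \<Rightarrow> 'a::metric_space" where "\<And>\<omega>. \<omega> \<in> space M \<Longrightarrow> X \<omega> \<in> closure (range Q)"
proof -
  obtain s where s: "\<And>n. simple_function M (s n)" "\<And>\<omega>. \<omega> \<in> space M \<Longrightarrow> (\<lambda>n. s n \<omega>) \<longlonglongrightarrow> X \<omega>"
    using assms by (auto simp: strongly_measurable_def)
  let ?A = "\<Union>n. s n ` space M"
  have "countable (insert undefined ?A)"
    using s(1) by (intro countable_insert countable_UN) (auto intro: countable_finite simple_functionD(1))
  then obtain Q :: "nat \<Rightarrow> 'a" where Q: "insert undefined ?A = range Q"
    using uncountable_def by (metis insert_not_empty)
  have "X \<omega> \<in> closure (range Q)" if "\<omega> \<in> space M" for \<omega>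
    unfolding closure_sequential using s(2)[OF that] that Q by (intro exI[of _ "\<lambda>n. s n \<omega>"]) blast
  then show thesis by (rule that)
qed

text \<open>A function with separable range is strongly measurable as soon as its distances to a dense
  sequence are measurable: take the first among the nearest of \<open>Q 0, \<dots>, Q n\<close>.\<close>

lemma strongly_measurable_onI_dist:
  fixes X :: "'w \<Rightarrow> 'a::metric_space" and D :: "nat \<Rightarrow> 'w \<Rightarrow> ereal"
  assumes [measurable]: "\<And>j. D j \<in> borel_measurable M"
    and D: "\<And>\<omega> j. \<omega> \<in> G \<Longrightarrow> D j \<omega> = ereal (dist (X \<omega>) (Q j))"
    and X: "\<And>\<omega>. \<omega> \<in> G \<Longrightarrow> X \<omega> \<in> closure (range Q)"
  shows "strongly_measurable_on M G X"
proof -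
  define N where "N n \<omega> = (LEAST j. j \<le> n \<and> (\<forall>i\<in>{..n}. D j \<omega> \<le> D i \<omega>))" for n \<omega>
  have N: "N n \<omega> \<le> n \<and> (\<forall>i\<in>{..n}. D (N n \<omega>) \<omega> \<le> D i \<omega>)" for n \<omega>
  proof -
    have "\<exists>j\<in>{..n}. \<forall>i\<in>{..n}. D j \<omega> \<le> D i \<omega>"
      using Min_in[of "(\<lambda>j. D j \<omega>) ` {..n}"] Min_le[of "(\<lambda>j. D j \<omega>) ` {..n}"] by fastforce
    then obtain j where "j \<le> n \<and> (\<forall>i\<in>{..n}. D j \<omega> \<le> D i \<omega>)" by auto
    then show ?thesis unfolding N_def by (rule LeastI)
  qed
  have "simple_function M (\<lambda>\<omega>. Q (N n \<omega>))" for n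
  proof (rule simple_function_compose1[where g = Q])
    have m: "N n \<in> measurable M (count_space UNIV)" unfolding N_def by measurable
    show "simple_function M (N n)"
      unfolding simple_function_def
    proof (intro conjI ballI)
      show "finite (N n ` space M)" by (rule finite_subset[of _ "{..n}"]) (use N in blast)+
      fix j show "N n -` {j} \<inter> space M \<in> sets M" by (rule measurable_sets[OF m]) simp
    qed
  qed
  moreover have "(\<lambda>n. Q (N n \<omega>)) \<longlonglongrightarrow> X \<omega>" if \<omega>: "\<omega> \<in> G" for \<omega>
  proof (rule metric_LIMSEQ_I)
    fix e :: real assume e: "0 < e"
    then obtain j where j: "dist (Q j) (X \<omega>) < e" using X[OF \<omega>] by (auto simp: closure_approachable)
    have "dist (Q (N n \<omega>)) (X \<omega>) < e" if "j \<le> n" for n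
    proof -
      have "D (N n \<omega>) \<omega> \<le> D j \<omega>" using N[of n \<omega>] that by blast
      then show ?thesis using j by (simp add: D[OF \<omega>] dist_commute)
    qed
    then show "\<exists>n0. \<forall>n\<ge>n0. dist (Q (N n \<omega>)) (X \<omega>) < e" by blast
  qed
  ultimately show ?thesis unfolding strongly_measurable_on_def by (intro exI[of _ "\<lambda>n \<omega>. Q (N n \<omega>)"]) blast
qed

lemma strongly_measurable_subalgebra:
  fixes X :: "'w \<Rightarrow> 'a::metric_space"
  assumes X: "strongly_measurable M X" and F: "X \<in> borel_measurable F" "space F = space M"
  shows "strongly_measurable F X"
proof -
  obtain Q :: "nat \<Rightarrow> 'a" where Q: "\<And>\<omega>. \<omega> \<in> space M \<Longrightarrow> X \<omega> \<in> closure (range Q)"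
    using strongly_measurable_range_separable[OF X] by blast
  have "(\<lambda>\<omega>. ereal (dist (X \<omega>) (Q j))) \<in> borel_measurable F" for j
  proof (rule borel_measurable_ereal, rule measurable_compose[OF F(1)])
    show "(\<lambda>x. dist x (Q j)) \<in> borel_measurable borel"
      by (intro borel_measurable_continuous_onI continuous_intros)
  qed
  then show ?thesis unfolding strongly_measurable_iff_on using Q F(2) by (intro strongly_measurable_onI_dist) auto
qed

text \<open>Replacing each value of a simple function by a nearly closest point of \<open>X ` G\<close> preserves convergence.
  Maps defined only on the range of \<open>X\<close> can then be applied to the approximations.\<close>

lemma strongly_measurable_on_range_approx:
  fixes X :: "'w \<Rightarrow> 'a::metric_space"
  assumes X: "strongly_measurable_on M G X" and ne: "G \<noteq> {}"
  obtains s where "\<And>n. simple_function M (s n)" "\<And>n \<omega>. s n \<omega> \<in> X ` G" "\<And>\<omega>. \<omega> \<in> G \<Longrightarrow> (\<lambda>n. s n \<omega>) \<longlonglongrightarrow> X \<omega>"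
proof -
  obtain s where s: "\<And>n. simple_function M (s n)" "\<And>\<omega>. \<omega> \<in> G \<Longrightarrow> (\<lambda>n. s n \<omega>) \<longlonglongrightarrow> X \<omega>"
    using X by (auto simp: strongly_measurable_on_def)
  have "\<exists>y\<in>X ` G. dist v y < infdist v (X ` G) + 1 / real (Suc n)" for v n
  proof (rule ccontr)
    assume n: "\<not> ?thesis"
    have "infdist v (X ` G) + 1 / real (Suc n) \<le> infdist v (X ` G)"
      using ne n by (subst (2) infdist_notempty) (auto intro!: cINF_greatest simp: not_less)
    then show False by simp
  qed
  then have "\<forall>n v. \<exists>y. y \<in> X ` G \<and> dist v y < infdist v (X ` G) + 1 / real (Suc n)" by blast
  then obtain c where c': "\<forall>n v. c n v \<in> X ` G \<and> dist v (c n v) < infdist v (X ` G) + 1 / real (Suc n)"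
    unfolding choice_iff by blast
  then have c: "c n v \<in> X ` G" "dist v (c n v) < infdist v (X ` G) + 1 / real (Suc n)" for n v by blast+
  have "(\<lambda>n. c n (s n \<omega>)) \<longlonglongrightarrow> X \<omega>" if \<omega>: "\<omega> \<in> G" for \<omega>
  proof -
    have "(\<lambda>n. dist (s n \<omega>) (X \<omega>)) \<longlonglongrightarrow> 0" using s(2)[OF \<omega>] by (simp flip: tendsto_dist_iff)
    from tendsto_add[OF tendsto_add[OF this this] LIMSEQ_inverse_real_of_nat]
    have lim: "(\<lambda>n. dist (s n \<omega>) (X \<omega>) + dist (s n \<omega>) (X \<omega>) + inverse (real (Suc n))) \<longlonglongrightarrow> 0" by simp
    have "dist (c n (s n \<omega>)) (X \<omega>) \<le> dist (s n \<omega>) (X \<omega>) + dist (s n \<omega>) (X \<omega>) + inverse (real (Suc n))" for n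
    proof -
      have "infdist (s n \<omega>) (X ` G) \<le> dist (s n \<omega>) (X \<omega>)" using \<omega> by (intro infdist_le) auto
      moreover have "dist (c n (s n \<omega>)) (X \<omega>) \<le> dist (s n \<omega>) (c n (s n \<omega>)) + dist (s n \<omega>) (X \<omega>)"
        by (metis dist_commute dist_triangle)
      ultimately show ?thesis using c(2)[of "s n \<omega>" n] by (simp add: inverse_eq_divide)
    qed
    then have "(\<lambda>n. dist (c n (s n \<omega>)) (X \<omega>)) \<longlonglongrightarrow> 0"
      by (intro real_tendsto_sandwich[OF _ _ tendsto_const lim] always_eventually) auto
    then show ?thesis by (simp flip: tendsto_dist_iff)
  qed
  moreover have "simple_function M (\<lambda>\<omega>. c n (s n \<omega>))" for n using s(1) by (rule simple_function_compose1)
  ultimately show thesis using c(1) by (intro that[of "\<lambda>n \<omega>. c n (s n \<omega>)"])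
qed

lemma strongly_measurable_on_empty: "strongly_measurable_on M {} X"
  unfolding strongly_measurable_on_def by (intro exI[of _ "\<lambda>_ _. undefined"]) simp

lemma strongly_measurable_on_compose:
  fixes X :: "'w \<Rightarrow> 'a::metric_space" and R :: "'a \<Rightarrow> 'b::topological_space"
  assumes X: "strongly_measurable_on M G X" and R: "continuous_on (X ` G) R"
  shows "strongly_measurable_on M G (\<lambda>\<omega>. R (X \<omega>))"
proof (cases "G = {}")
  case False
  obtain s where s: "\<And>n. simple_function M (s n)" "\<And>n \<omega>. s n \<omega> \<in> X ` G" "\<And>\<omega>. \<omega> \<in> G \<Longrightarrow> (\<lambda>n. s n \<omega>) \<longlonglongrightarrow> X \<omega>"
    using strongly_measurable_on_range_approx[OF X False] by blast
  have "(\<lambda>n. R (s n \<omega>)) \<longlonglongrightarrow> R (X \<omega>)" if "\<omega> \<in> G" for \<omega>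
    using that s by (intro continuous_on_tendsto_compose[OF R]) auto
  moreover have "simple_function M (\<lambda>\<omega>. R (s n \<omega>))" for n using s(1) by (rule simple_function_compose1)
  ultimately show ?thesis unfolding strongly_measurable_on_def by (intro exI[of _ "\<lambda>n \<omega>. R (s n \<omega>)"]) blast
qed (simp add: strongly_measurable_on_empty)

lemma strongly_measurable_on_Pair:
  assumes "strongly_measurable_on M G X" "strongly_measurable_on M G Y"
  shows "strongly_measurable_on M G (\<lambda>\<omega>. (X \<omega>, Y \<omega>))"
proof -
  obtain s where s: "\<And>n. simple_function M (s n)" "\<And>\<omega>. \<omega> \<in> G \<Longrightarrow> (\<lambda>n. s n \<omega>) \<longlonglongrightarrow> X \<omega>"
    using assms(1) by (auto simp: strongly_measurable_on_def)
  obtain t where t: "\<And>n. simple_function M (t n)" "\<And>\<omega>. \<omega> \<in> G \<Longrightarrow> (\<lambda>n. t n \<omega>) \<longlonglongrightarrow> Y \<omega>"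
    using assms(2) by (auto simp: strongly_measurable_on_def)
  from s t show ?thesis unfolding strongly_measurable_on_def
    by (intro exI[of _ "\<lambda>n \<omega>. (s n \<omega>, t n \<omega>)"]) (auto intro!: simple_function_Pair tendsto_Pair)
qed

lemma strongly_measurable_on_compose2:
  fixes X :: "'w \<Rightarrow> 'a::metric_space" and Y :: "'w \<Rightarrow> 'b::metric_space"
  assumes "strongly_measurable_on M G X" "strongly_measurable_on M G Y" and R: "continuous_on UNIV (\<lambda>z. R (fst z) (snd z))"
  shows "strongly_measurable_on M G (\<lambda>\<omega>. R (X \<omega>) (Y \<omega>))"
  using strongly_measurable_on_compose[OF strongly_measurable_on_Pair[OF assms(1,2)] continuous_on_subset[OF R]] by simp

lemmas strongly_measurable_Pair = strongly_measurable_on_Pair[of M "space M" for M, folded strongly_measurable_iff_on]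
lemmas strongly_measurable_compose = strongly_measurable_on_compose[of M "space M" for M, folded strongly_measurable_iff_on]
lemmas strongly_measurable_compose2 = strongly_measurable_on_compose2[of M "space M" for M, folded strongly_measurable_iff_on]

lemma strongly_measurable_const: "strongly_measurable M (\<lambda>_. c)"
  unfolding strongly_measurable_def by (intro exI[of _ "\<lambda>_ _. c"]) simp

text \<open>The set on which the simple functions converge is measurable by completeness.\<close>

lemma strongly_measurable_on_extend:
  fixes X :: "'w \<Rightarrow> 'a::banach"
  assumes X: "strongly_measurable_on M G X" and G: "G \<subseteq> space M"
  obtains Y where "strongly_measurable M Y" "\<And>\<omega>. \<omega> \<in> G \<Longrightarrow> Y \<omega> = X \<omega>"
proof -
  obtain s where s: "\<And>n. simple_function M (s n)" "\<And>\<omega>. \<omega> \<in> G \<Longrightarrow> (\<lambda>n. s n \<omega>) \<longlonglongrightarrow> X \<omega>"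
    using X by (auto simp: strongly_measurable_on_def)
  define C where "C = {\<omega> \<in> space M. \<forall>k::nat. \<exists>N::nat. \<forall>i\<ge>N. \<forall>j\<ge>N. dist (s i \<omega>) (s j \<omega>) < 1 / real (Suc k)}"
  have [measurable]: "(\<lambda>\<omega>. dist (s i \<omega>) (s j \<omega>)) \<in> borel_measurable M" for i j
    using borel_measurable_simple_function[OF simple_function_compose1[OF simple_function_Pair[OF s(1)[of i] s(1)[of j]],
        where g = "\<lambda>z. dist (fst z) (snd z)"]] by simp
  have C[measurable]: "C \<in> sets M" unfolding C_def by measurable
  have conv: "convergent (\<lambda>n. s n \<omega>)" if "\<omega> \<in> C" for \<omega>
    unfolding Cauchy_convergent_iff[symmetric] metric_Cauchy_iff2 using that by (auto simp: C_def inverse_eq_divide)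
  have GC: "G \<subseteq> C"
  proof
    fix \<omega> assume "\<omega> \<in> G"
    then have "Cauchy (\<lambda>n. s n \<omega>)" using s(2) by (intro LIMSEQ_imp_Cauchy)
    then show "\<omega> \<in> C" using \<open>\<omega> \<in> G\<close> G by (auto simp: C_def metric_Cauchy_iff2 inverse_eq_divide)
  qed
  define t where "t n \<omega> = (if \<omega> \<in> C then s n \<omega> else 0)" for n \<omega>
  define Y where "Y \<omega> = lim (\<lambda>n. t n \<omega>)" for \<omega>
  have "(\<lambda>n. t n \<omega>) \<longlonglongrightarrow> Y \<omega>" for \<omega>
    unfolding Y_def using conv[of \<omega>] by (cases "\<omega> \<in> C") (auto simp: t_def convergent_LIMSEQ_iff)
  moreover have "simple_function M (t n)" for n
    unfolding t_def using s(1) C by (intro simple_function_If_set) auto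
  ultimately have "strongly_measurable M Y" unfolding strongly_measurable_def by blast
  moreover have "Y \<omega> = X \<omega>" if "\<omega> \<in> G" for \<omega>
    using s(2)[OF that] GC that by (auto simp: Y_def t_def limI)
  ultimately show thesis by (rule that)
qed

text \<open>The bound provides an integrable majorant for dominated convergence.\<close>

lemma strongly_measurable_bounded_approx:
  fixes X :: "'w \<Rightarrow> 'a::real_normed_vector"
  assumes X: "strongly_measurable M X"
  obtains s where "\<And>n. simple_function M (s n)" "\<And>\<omega>. \<omega> \<in> space M \<Longrightarrow> (\<lambda>n. s n \<omega>) \<longlonglongrightarrow> X \<omega>"
    "\<And>n \<omega>. norm (s n \<omega>) \<le> norm (X \<omega>) + 1"
proof -
  obtain s where s: "\<And>n. simple_function M (s n)" "\<And>\<omega>. \<omega> \<in> space M \<Longrightarrow> (\<lambda>n. s n \<omega>) \<longlonglongrightarrow> X \<omega>"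
    using X by (auto simp: strongly_measurable_def)
  have [measurable]: "(\<lambda>\<omega>. norm (X \<omega>)) \<in> borel_measurable M" "(\<lambda>\<omega>. norm (s n \<omega>)) \<in> borel_measurable M" for n
    using strongly_measurable_borel[OF X] borel_measurable_simple_function[OF simple_function_compose1[OF s(1), where g = norm]] by auto
  define t where "t n \<omega> = (if \<omega> \<in> {\<omega> \<in> space M. norm (s n \<omega>) \<le> norm (X \<omega>) + 1} then s n \<omega> else 0)" for n \<omega>
  have "simple_function M (t n)" for n unfolding t_def using s(1) by (intro simple_function_If_set) auto
  moreover have "(\<lambda>n. t n \<omega>) \<longlonglongrightarrow> X \<omega>" if \<omega>: "\<omega> \<in> space M" for \<omega>
  proof (rule Lim_transform_eventually[OF s(2)[OF \<omega>]])
    have "\<forall>\<^sub>F n in sequentially. norm (s n \<omega>) < norm (X \<omega>) + 1"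
      using tendsto_norm[OF s(2)[OF \<omega>]] by (intro order_tendstoD(2)) auto
    then show "\<forall>\<^sub>F n in sequentially. s n \<omega> = t n \<omega>" by eventually_elim (use \<omega> in \<open>auto simp: t_def\<close>)
  qed
  moreover have "norm (t n \<omega>) \<le> norm (X \<omega>) + 1" for n \<omega> by (auto simp: t_def)
  ultimately show thesis by (rule that)
qed

section \<open>Weak limits of simple functions\<close>

lemma dual_norm_almost_attained:
  fixes p :: "'a::real_normed_vector \<Rightarrow>\<^sub>L real"
  assumes e: "0 < e"
  obtains v where "norm v \<le> 1" "norm p - e < blinfun_apply p v"
proof -
  have "\<exists>v. norm v \<le> 1 \<and> norm p - e < blinfun_apply p v"
  proof (rule ccontr)
    assume n: "\<not> ?thesis"
    have le: "blinfun_apply p v \<le> norm p - e" if "norm v \<le> 1" for v using n that by (meson not_less)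
    have 0: "0 \<le> norm p - e" using le[of 0] by simp
    have "norm (blinfun_apply p v) \<le> (norm p - e) * norm v" for v
    proof (cases "v = 0")
      case False
      have "\<bar>blinfun_apply p ((1 / norm v) *\<^sub>R v)\<bar> \<le> norm p - e"
        using le[of "(1 / norm v) *\<^sub>R v"] le[of "- ((1 / norm v) *\<^sub>R v)"] by (simp add: blinfun.minus_right abs_le_iff)
      then show ?thesis using False by (simp add: blinfun.scaleR_right abs_mult field_simps)
    qed simp
    then have "norm p \<le> norm p - e" using 0 by (rule norm_blinfun_bound[rotated])
    then show False using e by simp
  qed
  then show thesis using that by blast
qed

text \<open>The span of a sequence is separable: finite combinations with rational coefficients are countable and
  dense in it.\<close>

lemma countable_rational_span:
  fixes a :: "nat \<Rightarrow> 'a::real_normed_vector"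
  obtains q :: "nat \<Rightarrow> 'a" where "\<And>i. a i \<in> range q" "subspace (closure (range q))"
proof -
  define c where "c xs = (\<Sum>(r, i)\<leftarrow>xs. of_rat r *\<^sub>R a i)" for xs :: "(rat \<times> nat) list"
  have c_app: "c (xs @ ys) = c xs + c ys" for xs ys by (simp add: c_def)
  have c_sc: "of_rat r *\<^sub>R c xs = c (map (\<lambda>(s, i). (r * s, i)) xs)" for r xs
    by (induction xs) (auto simp: c_def scaleR_add_right of_rat_mult)
  define q where "q n = c (from_nat n)" for n
  have rq: "range q = range c" using surj_from_nat unfolding q_def by (metis image_image)
  have 1: "a i \<in> range q" for i unfolding rq by (rule range_eqI[of _ _ "[(1, i)]"]) (simp add: c_def)
  have "subspace (closure (range q))"
    unfolding subspace_def rq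
  proof (intro conjI ballI allI)
    show "0 \<in> closure (range c)" by (rule subsetD[OF closure_subset], rule range_eqI[of _ _ "[]"]) (simp add: c_def)
  next
    fix u v assume u: "u \<in> closure (range c)" and v: "v \<in> closure (range c)"
    obtain s where s: "\<forall>n. s n \<in> range c" "s \<longlonglongrightarrow> u" using u unfolding closure_sequential by blast
    obtain t where t: "\<forall>n. t n \<in> range c" "t \<longlonglongrightarrow> v" using v unfolding closure_sequential by blast
    have "s n + t n \<in> range c" for n
    proof -
      obtain xs ys where "s n = c xs" "t n = c ys" using s(1) t(1) by blast
      then have "s n + t n = c (xs @ ys)" by (simp only: c_app)
      then show ?thesis by (simp only: rangeI)
    qed
    then show "u + v \<in> closure (range c)" unfolding closure_sequential
      using tendsto_add[OF s(2) t(2)] by (intro exI[of _ "\<lambda>n. s n + t n"]) simp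
  next
    fix r :: real and u assume u: "u \<in> closure (range c)"
    obtain s where s: "\<forall>n. s n \<in> range c" "s \<longlonglongrightarrow> u" using u unfolding closure_sequential by blast
    have "\<forall>n. \<exists>z. r < of_rat z \<and> of_rat z < r + 1 / real (Suc n)"
      by (intro allI of_rat_dense) simp
    then obtain z where z: "\<forall>n. r < of_rat (z n) \<and> of_rat (z n) < r + 1 / real (Suc n)"
      unfolding choice_iff by blast
    have "(\<lambda>n. r + inverse (real (Suc n))) \<longlonglongrightarrow> r + 0"
      by (intro tendsto_add tendsto_const LIMSEQ_inverse_real_of_nat)
    then have "(\<lambda>n. r + inverse (real (Suc n))) \<longlonglongrightarrow> r" by simp
    then have "(\<lambda>n. of_rat (z n) :: real) \<longlonglongrightarrow> r"
      by (rule real_tendsto_sandwich[OF _ _ tendsto_const, rotated 2])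
        (use z in \<open>auto intro!: always_eventually less_imp_le simp: inverse_eq_divide\<close>)
    then have lim: "(\<lambda>n. of_rat (z n) *\<^sub>R s n) \<longlonglongrightarrow> r *\<^sub>R u" using s(2) by (rule tendsto_scaleR)
    have "of_rat (z n) *\<^sub>R s n \<in> range c" for n
    proof -
      obtain xs where "s n = c xs" using s(1) by blast
      then have "of_rat (z n) *\<^sub>R s n = c (map (\<lambda>(s, i). (z n * s, i)) xs)" by (simp only: c_sc)
      then show ?thesis by (simp only: rangeI)
    qed
    then show "r *\<^sub>R u \<in> closure (range c)" unfolding closure_sequential
      using lim by (intro exI[of _ "\<lambda>n. of_rat (z n) *\<^sub>R s n"]) simp
  qed
  with 1 show thesis by (rule that)
qed

text \<open>A case of Pettis' theorem. By Hahn-Banach and reflexivity the limit takes its values in the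
  norm-closed span of the countably many values of the simple functions; in this separable space the
  norm is a supremum of countably many evaluations, so distances are measurable.\<close>

theorem weak_limit_strongly_measurable:
  fixes \<zeta> :: "'w \<Rightarrow> ('a::real_normed_vector \<Rightarrow>\<^sub>L real)"
  assumes refl: "reflexive_space TYPE('a)"
    and z: "\<And>n. simple_function M (z n)" and G: "G \<subseteq> space M"
    and lim: "\<And>\<omega> v. \<omega> \<in> G \<Longrightarrow> (\<lambda>n. blinfun_apply (z n \<omega>) v) \<longlonglongrightarrow> blinfun_apply (\<zeta> \<omega>) v"
  shows "strongly_measurable_on M G \<zeta>"
proof -
  have "countable (insert 0 (\<Union>n. z n ` space M))"
    using z by (intro countable_insert countable_UN) (auto intro: countable_finite simple_functionD(1))
  then obtain a :: "nat \<Rightarrow> ('a \<Rightarrow>\<^sub>L real)" where a: "insert 0 (\<Union>n. z n ` space M) = range a"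
    using uncountable_def by (metis insert_not_empty)
  obtain q :: "nat \<Rightarrow> ('a \<Rightarrow>\<^sub>L real)" where q: "\<And>i. a i \<in> range q" "subspace (closure (range q))"
    using countable_rational_span[of a] by metis
  have zq: "z n \<omega> \<in> range q" if "\<omega> \<in> G" for n \<omega>
  proof -
    have "z n \<omega> \<in> range a" unfolding a[symmetric] using that G by blast
    then show ?thesis using q(1) by auto
  qed
  have \<zeta>q: "\<zeta> \<omega> \<in> closure (range q)" if \<omega>: "\<omega> \<in> G" for \<omega>
  proof (rule ccontr)
    assume "\<zeta> \<omega> \<notin> closure (range q)"
    then obtain \<Phi> :: "('a \<Rightarrow>\<^sub>L real) \<Rightarrow>\<^sub>L real" where \<Phi>: "\<And>y. y \<in> closure (range q) \<Longrightarrow> blinfun_apply \<Phi> y = 0" "blinfun_apply \<Phi> (\<zeta> \<omega>) \<noteq> 0"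
      using annihilator_of_subspace[OF q(2), of "\<zeta> \<omega>"] by (metis closure_closure)
    obtain v where v: "\<And>p. blinfun_apply \<Phi> p = blinfun_apply p v" using refl by (auto simp: reflexive_space_def)
    have "blinfun_apply (z n \<omega>) v = 0" for n
      using \<Phi>(1)[OF subsetD[OF closure_subset zq[OF \<omega>]]] by (simp add: v)
    then have "blinfun_apply (\<zeta> \<omega>) v = 0" using LIMSEQ_unique[OF lim[OF \<omega>, of v]] by simp
    then show False using \<Phi>(2) v by simp
  qed
  (* Countably many almost norming vectors for a sequence dense in the closed span. *)
  have "\<exists>v. norm v \<le> 1 \<and> norm (q m) - 1 / real (Suc k) < blinfun_apply (q m) v" for m k
  proof -
    have "0 < 1 / real (Suc k)" by simp
    from dual_norm_almost_attained[OF this, of "q m"] show ?thesis by metis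
  qed
  then obtain v where v: "\<And>m k. norm (v m k) \<le> 1" "\<And>m k. norm (q m) - 1 / real (Suc k) < blinfun_apply (q m) (v m k)"
    by metis
  have norming: "ereal (norm y) = (SUP i. ereal (blinfun_apply y (v (fst i) (snd i))))" if y: "y \<in> closure (range q)" for y
  proof (rule antisym)
    show "(SUP i. ereal (blinfun_apply y (v (fst i) (snd i)))) \<le> ereal (norm y)"
    proof (rule SUP_least)
      fix i :: "nat \<times> nat"
      have "\<bar>blinfun_apply y (v (fst i) (snd i))\<bar> \<le> norm y * norm (v (fst i) (snd i))" using norm_blinfun[of y] by simp
      also have "\<dots> \<le> norm y * 1" using v(1) by (intro mult_left_mono) auto
      finally show "ereal (blinfun_apply y (v (fst i) (snd i))) \<le> ereal (norm y)" by simp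
    qed
    show "ereal (norm y) \<le> (SUP i. ereal (blinfun_apply y (v (fst i) (snd i))))"
    proof (rule ereal_le_epsilon2)
      show "\<And>e. 0 < e \<Longrightarrow> ereal (norm y) \<le> (SUP i. ereal (blinfun_apply y (v (fst i) (snd i)))) + ereal e"
      proof -
        fix e :: real assume e: "0 < e"
        then obtain m where m: "dist (q m) y < e / 3" using y by (auto simp: closure_approachable dest!: spec[of _ "e / 3"])
        obtain k where k: "1 / real (Suc k) < e / 3" using e nat_approx_posE[of "e / 3"] by auto
        have "\<bar>blinfun_apply (q m - y) (v m k)\<bar> \<le> norm (q m - y) * norm (v m k)" using norm_blinfun[of "q m - y"] by simp
        also have "\<dots> \<le> norm (q m - y) * 1" using v(1) by (intro mult_left_mono) auto
        finally have "blinfun_apply (q m) (v m k) - blinfun_apply y (v m k) \<le> e / 3"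
          using m by (simp add: blinfun.diff_left dist_norm)
        moreover have "norm y \<le> norm (q m) + e / 3" using m norm_triangle_ineq2[of y "q m"] by (simp add: dist_norm norm_minus_commute)
        ultimately have "norm y \<le> blinfun_apply y (v m k) + e" using v(2)[of m k] k by linarith
        then have "ereal (norm y) \<le> ereal (blinfun_apply y (v (fst (m, k)) (snd (m, k)))) + ereal e" by simp
        also have "\<dots> \<le> (SUP i. ereal (blinfun_apply y (v (fst i) (snd i)))) + ereal e"
          by (intro add_right_mono SUP_upper) simp
        finally show "ereal (norm y) \<le> (SUP i. ereal (blinfun_apply y (v (fst i) (snd i)))) + ereal e" .
      qed
    qed
  qed
  define D where "D j \<omega> = (SUP i. ereal (lim (\<lambda>n. blinfun_apply (z n \<omega> - q j) (v (fst i) (snd i)))))" for j \<omega>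
  show ?thesis
  proof (rule strongly_measurable_onI_dist[where Q = q and D = D])
    fix j
    have [measurable]: "(\<lambda>\<omega>. blinfun_apply (z n \<omega> - q j) w) \<in> borel_measurable M" for n w
      using borel_measurable_simple_function[OF simple_function_compose1[OF z[of n], where g = "\<lambda>p. blinfun_apply (p - q j) w"]] .
    show "D j \<in> borel_measurable M" unfolding D_def by measurable
  next
    fix \<omega> j assume \<omega>: "\<omega> \<in> G"
    have "lim (\<lambda>n. blinfun_apply (z n \<omega> - q j) w) = blinfun_apply (\<zeta> \<omega> - q j) w" for w
      unfolding blinfun.diff_left by (intro limI tendsto_intros lim \<omega>)
    moreover have "\<zeta> \<omega> - q j \<in> closure (range q)"
      using closure_subset[of "range q"] by (intro subspace_diff q \<zeta>q \<omega>) auto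
    ultimately show "D j \<omega> = ereal (dist (\<zeta> \<omega>) (q j))" unfolding D_def by (simp add: dist_norm norming)
  qed (rule \<zeta>q)
qed

corollary demicontinuous_compose_strongly_measurable:
  fixes X :: "'w \<Rightarrow> 'b::metric_space" and \<Psi> :: "'b \<Rightarrow> ('a::real_normed_vector \<Rightarrow>\<^sub>L real)"
  assumes refl: "reflexive_space TYPE('a)" and X: "strongly_measurable_on M G X" and G: "G \<subseteq> space M"
    and S: "X ` G \<subseteq> S"
    and \<Psi>: "\<And>u x v. (\<And>n. u n \<in> S) \<Longrightarrow> x \<in> S \<Longrightarrow> u \<longlonglongrightarrow> x \<Longrightarrow> (\<lambda>n. blinfun_apply (\<Psi> (u n)) v) \<longlonglongrightarrow> blinfun_apply (\<Psi> x) v"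
  shows "strongly_measurable_on M G (\<lambda>\<omega>. \<Psi> (X \<omega>))"
proof (cases "G = {}")
  case False
  obtain s where s: "\<And>n. simple_function M (s n)" "\<And>n \<omega>. s n \<omega> \<in> X ` G" "\<And>\<omega>. \<omega> \<in> G \<Longrightarrow> (\<lambda>n. s n \<omega>) \<longlonglongrightarrow> X \<omega>"
    using strongly_measurable_on_range_approx[OF X False] by blast
  show ?thesis
  proof (rule weak_limit_strongly_measurable[OF refl _ G])
    show "simple_function M (\<lambda>\<omega>. \<Psi> (s n \<omega>))" for n using s(1) by (rule simple_function_compose1)
    show "(\<lambda>n. blinfun_apply (\<Psi> (s n \<omega>)) v) \<longlonglongrightarrow> blinfun_apply (\<Psi> (X \<omega>)) v" if "\<omega> \<in> G" for \<omega> v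
      using that S s by (intro \<Psi>) blast+
  qed
qed (simp add: strongly_measurable_on_empty)

section \<open>Continuity of convex functions and of their gradients\<close>

text \<open>By Baire's theorem a lower semicontinuous convex function is bounded above near every interior
  point of its domain, hence continuous there.\<close>

theorem Gamma0_continuous_on_interior:
  fixes F :: "'a::banach \<Rightarrow> ereal"
  assumes F: "F \<in> Gamma0"
  shows "continuous_on (interior (eff_dom F)) (realval F)"
proof (rule continuous_at_imp_continuous_on, rule ballI)
  fix x assume "x \<in> interior (eff_dom F)"
  then obtain r where r: "0 < r" "cball x r \<subseteq> eff_dom F" by (auto simp: mem_interior_cball)
  note fin = Gamma0_finite[OF F]
  (* These sets are invariant under u \<mapsto> - u: by convexity, a ball inside one of them gives a bound near x. *)
  define K where "K n = {u. F (x + u) \<le> ereal (real n)} \<inter> {u. F (x - u) \<le> ereal (real n)} \<inter> cball 0 r" for n :: nat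
  have in_dom: "x + u \<in> eff_dom F" "x - u \<in> eff_dom F" if "u \<in> cball 0 r" for u
    using that r(2) by (auto simp: dist_norm)
  have closed1: "closed {u. F (h u) \<le> ereal c}" if h: "continuous_on UNIV h" for h :: "'a \<Rightarrow> 'a" and c
    unfolding closed_sequential_limits
  proof (intro allI impI)
    fix u l assume u: "(\<forall>n. u n \<in> {u. F (h u) \<le> ereal c}) \<and> u \<longlonglongrightarrow> l"
    have "F (h l) \<le> ereal c"
    proof (rule Gamma0_lsc_sequentially[OF F, of "\<lambda>n. h (u n)" "h l" "\<lambda>_. c"])
      show "(\<lambda>n. h (u n)) \<longlonglongrightarrow> h l" by (rule continuous_on_tendsto_compose[OF h]) (use u in simp_all)
      show "F (h (u n)) \<le> ereal c" for n using u by simp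
    qed simp
    then show "l \<in> {u. F (h u) \<le> ereal c}" by simp
  qed
  have clK: "closed (K n)" for n
    unfolding K_def by (intro closed_Int closed1 continuous_intros closed_cball)
  have cover: "cball 0 r \<subseteq> (\<Union>n. K n)"
  proof
    fix u :: 'a assume u: "u \<in> cball 0 r"
    obtain n :: nat where n: "max (realval F (x + u)) (realval F (x - u)) \<le> real n" using real_arch_simple by blast
    have "F (x + u) \<le> ereal (real n)" "F (x - u) \<le> ereal (real n)"
      using n fin[OF in_dom(1)[OF u]] fin[OF in_dom(2)[OF u]] by (metis ereal_less_eq(3) max.bounded_iff)+
    then show "u \<in> (\<Union>n. K n)" using u by (auto simp: K_def)
  qed
  have "\<exists>n. interior (K n) \<noteq> {}"
  proof (rule ccontr)
    assume "\<not> ?thesis"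
    then have "interior (\<Union> (range K)) = {}"
      using Met_TC.metric_Baire_category_alt[of "range K"] clK
      by (auto simp: complete_UNIV mcomplete_iff_complete)
    moreover have "ball 0 r \<subseteq> \<Union> (range K)" using cover ball_subset_cball by blast
    then have "0 \<in> interior (\<Union> (range K))" using r(1) unfolding mem_interior by blast
    ultimately show False by simp
  qed
  then obtain n u0 where "u0 \<in> interior (K n)" by blast
  then obtain s where s: "0 < s" "ball u0 s \<subseteq> K n" by (auto simp: mem_interior)
  have up: "F (x + w) \<le> ereal (real n)" if w: "norm w < s" for w
  proof -
    have "u0 + w \<in> ball u0 s" "u0 - w \<in> ball u0 s" using w by (auto simp: dist_norm)
    then have k: "u0 + w \<in> K n" "u0 - w \<in> K n" using s(2) by auto
    have 1: "F (x + (u0 + w)) \<le> ereal (real n)" and 2: "F (x - (u0 - w)) \<le> ereal (real n)" using k by (auto simp: K_def)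
    note d = eff_domI[of F, OF 1] eff_domI[of F, OF 2]
    have "realval F ((1 - 1/2) *\<^sub>R (x + (u0 + w)) + (1/2) *\<^sub>R (x - (u0 - w)))
        \<le> (1 - 1/2) * realval F (x + (u0 + w)) + 1/2 * realval F (x - (u0 - w))"
      by (intro convex_onD[OF Gamma0_convex_on[OF F]] d) auto
    moreover have "(1 - 1/2) *\<^sub>R (x + (u0 + w)) + (1/2) *\<^sub>R (x - (u0 - w)) = x + w"
      by (simp add: algebra_simps flip: scaleR_add_left)
    moreover have "realval F (x + (u0 + w)) \<le> real n" "realval F (x - (u0 - w)) \<le> real n"
      using 1 2 fin[OF d(1)] fin[OF d(2)] by (metis ereal_less_eq(3))+
    ultimately have le: "realval F (x + w) \<le> real n" by simp
    have "x + w \<in> eff_dom F"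
      using Gamma0_convex_dom[OF F, unfolded convex_alt, rule_format, OF d, of "1/2"]
        \<open>(1 - 1/2) *\<^sub>R (x + (u0 + w)) + (1/2) *\<^sub>R (x - (u0 - w)) = x + w\<close> by simp
    then show ?thesis using le fin by (metis ereal_less_eq(3))
  qed
  have bd: "\<bar>realval F y\<bar> \<le> real n + 2 * \<bar>realval F x\<bar>" "y \<in> eff_dom F" if y: "y \<in> ball x s" for y
  proof -
    have w: "norm (y - x) < s" "norm (x - y) < s" using y by (auto simp: dist_norm norm_minus_commute)
    note u1 = up[OF w(1)] and u2 = up[OF w(2)]
    note d = eff_domI[of F, OF u1] eff_domI[of F, OF u2]
    have v: "realval F (x + (y - x)) \<le> real n" "realval F (x + (x - y)) \<le> real n"
      using u1 u2 fin[OF d(1)] fin[OF d(2)] by (metis ereal_less_eq(3))+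
    have eq: "(1 - 1/2) *\<^sub>R (x + (y - x)) + (1/2) *\<^sub>R (x + (x - y)) = x"
      by (simp add: algebra_simps flip: scaleR_add_left)
    have "realval F ((1 - 1/2) *\<^sub>R (x + (y - x)) + (1/2) *\<^sub>R (x + (x - y)))
        \<le> (1 - 1/2) * realval F (x + (y - x)) + 1/2 * realval F (x + (x - y))"
      by (intro convex_onD[OF Gamma0_convex_on[OF F]] d) auto
    then have "realval F x \<le> (1 - 1/2) * realval F (x + (y - x)) + 1/2 * realval F (x + (x - y))"
      by (simp only: eq)
    then have "2 * realval F x \<le> realval F y + realval F (x + (x - y))" by simp
    moreover have "realval F y \<le> real n" using v(1) by simp
    moreover have "c \<le> real n + 2 * d \<and> - c \<le> real n + 2 * d" if "2 * a \<le> c + b" "b \<le> real n" "c \<le> real n" "- a \<le> d" "0 \<le> d" for a b c d :: real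
      using that by linarith
    ultimately show "\<bar>realval F y\<bar> \<le> real n + 2 * \<bar>realval F x\<bar>"
      using v(2) abs_ge_minus_self[of "realval F x"] abs_ge_zero[of "realval F x"] unfolding abs_le_iff by blast
    show "y \<in> eff_dom F" using d(1) by simp
  qed
  have "continuous_on (ball x s) (realval F)"
    using bd by (intro convex_on_bounded_continuous[OF open_ball convex_on_subset[OF Gamma0_convex_on[OF F]]]) auto
  then show "isCont (realval F) x" using s(1) by (simp add: continuous_on_eq_continuous_at)
qed

text \<open>A directional derivative at \<open>x\<close> is approached from above by difference quotients, which are
  continuous in the base point and dominate the derivatives at \<open>u n\<close>; the bound from below is the bound
  from above in the direction \<open>- v\<close>.\<close>

lemma grad_demicontinuous:
  fixes F :: "'a::banach \<Rightarrow> ereal"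
  assumes F: "F \<in> Gamma0" and xn: "\<And>n. gateaux_differentiable F (u n)" and x: "gateaux_differentiable F x"
    and lim: "u \<longlonglongrightarrow> x"
  shows "(\<lambda>n. blinfun_apply (grad F (u n)) v) \<longlonglongrightarrow> blinfun_apply (grad F x) v"
proof -
  have xi: "x \<in> interior (eff_dom F)" by (rule gateaux_differentiable_interior[OF x])
  have cont: "isCont (realval F) y" if "y \<in> interior (eff_dom F)" for y
    using Gamma0_continuous_on_interior[OF F] that by (simp add: continuous_on_eq_continuous_at)
  have upper: "\<forall>\<^sub>F n in sequentially. blinfun_apply (grad F (u n)) v < c" if c: "blinfun_apply (grad F x) v < c" for v c
  proof -
    obtain e where e: "0 < e" "\<And>t. \<bar>t\<bar> < e \<Longrightarrow> x + t *\<^sub>R v \<in> interior (eff_dom F)" using interior_line[OF xi] by blast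
    have "\<exists>t>0. t < e \<and> realval F (x + t *\<^sub>R v) - realval F x < t * c"
    proof (rule ccontr)
      assume n: "\<not> ?thesis"
      have "((\<lambda>t. - realval F (x + t *\<^sub>R v)) has_real_derivative - blinfun_apply (grad F x) v) (at 0)"
        by (intro DERIV_minus grad_derivative x)
      then have "- blinfun_apply (grad F x) v \<le> - c"
        by (rule deriv_le_of_right_chord[OF _ e(1)]) (use n in \<open>force simp: not_less algebra_simps\<close>)
      then show False using c by simp
    qed
    then obtain t where t: "0 < t" "t < e" "realval F (x + t *\<^sub>R v) - realval F x < t * c" by blast
    have y: "x + t *\<^sub>R v \<in> interior (eff_dom F)" using e(2)[of t] t by simp
    have lim': "(\<lambda>n. u n + t *\<^sub>R v) \<longlonglongrightarrow> x + t *\<^sub>R v" by (intro tendsto_intros lim)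
    have "(\<lambda>n. realval F (u n + t *\<^sub>R v) - realval F (u n)) \<longlonglongrightarrow> realval F (x + t *\<^sub>R v) - realval F x"
      by (intro tendsto_diff isCont_tendsto_compose[OF cont[OF y] lim'] isCont_tendsto_compose[OF cont[OF xi] lim])
    then have "\<forall>\<^sub>F n in sequentially. realval F (u n + t *\<^sub>R v) - realval F (u n) < t * c" using t(3) by (rule order_tendstoD(2))
    moreover have "\<forall>\<^sub>F n in sequentially. u n + t *\<^sub>R v \<in> interior (eff_dom F)"
      using lim' y by (intro topological_tendstoD) auto
    ultimately show ?thesis
    proof eventually_elim
      case (elim n)
      have "u n + t *\<^sub>R v \<in> eff_dom F" using elim(2) interior_subset by blast
      from gradient_inequality[OF F xn[of n] this] have "t * blinfun_apply (grad F (u n)) v < t * c"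
        using elim(1) by (simp add: blinfun.scaleR_right)
      then show ?case using t(1) by simp
    qed
  qed
  show ?thesis
  proof (rule order_tendstoI)
    fix c assume "c < blinfun_apply (grad F x) v"
    then have "blinfun_apply (grad F x) (- v) < - c" by (simp add: blinfun.minus_right)
    from upper[OF this] show "\<forall>\<^sub>F n in sequentially. c < blinfun_apply (grad F (u n)) v"
      by (simp add: blinfun.minus_right)
  qed (rule upper)
qed

section \<open>Expectations in Banach spaces\<close>

lemma strongly_measurable_simple: "simple_function M s \<Longrightarrow> strongly_measurable M s"
  unfolding strongly_measurable_def by (intro exI[of _ "\<lambda>_. s"]) simp

lemma borel_measurable_norm_diff:
  fixes X Y :: "'w \<Rightarrow> 'a::real_normed_vector"
  assumes X: "strongly_measurable M X" and Y: "strongly_measurable M Y"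
  shows "(\<lambda>\<omega>. norm (X \<omega> - Y \<omega>)) \<in> borel_measurable M"
  by (rule strongly_measurable_borel, rule strongly_measurable_compose2[OF X Y, where R = "\<lambda>x y. norm (x - y)"])
    (intro continuous_intros)

lemma borel_measurable_strong_norm:
  fixes X :: "'w \<Rightarrow> 'a::real_normed_vector"
  assumes X: "strongly_measurable M X"
  shows "(\<lambda>\<omega>. norm (X \<omega>)) \<in> borel_measurable M"
  using borel_measurable_norm_diff[OF X strongly_measurable_const[of M 0]] by simp

lemma has_bochner_expectation_functional:
  fixes q :: "'a::real_normed_vector \<Rightarrow>\<^sub>L real"
  assumes X: "has_bochner_expectation M X I"
  shows "has_bochner_integral M (\<lambda>\<omega>. blinfun_apply q (X \<omega>)) (blinfun_apply q I)"
proof -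
  obtain s where sm: "strongly_measurable M X" and s: "\<And>n. Bochner_Integration.simple_bochner_integrable M (s n)"
    and conv: "(\<lambda>n. \<integral>\<^sup>+\<omega>. ennreal (norm (X \<omega> - s n \<omega>)) \<partial>M) \<longlonglongrightarrow> 0"
    and I: "(\<lambda>n. Bochner_Integration.simple_bochner_integral M (s n)) \<longlonglongrightarrow> I"
    using X unfolding has_bochner_expectation_def by blast
  have borel_X: "X \<in> borel_measurable M" by (rule strongly_measurable_borel[OF sm])
  have norm_m: "(\<lambda>\<omega>. ennreal (norm (X \<omega> - s n \<omega>))) \<in> borel_measurable M" for n
  proof -
    have "simple_function M (s n)" using s[of n] by (simp add: simple_bochner_integrable.simps)
    then have "(\<lambda>\<omega>. norm (X \<omega> - s n \<omega>)) \<in> borel_measurable M"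
      by (intro borel_measurable_norm_diff[OF sm] strongly_measurable_simple)
    then show ?thesis by (rule measurable_compose[OF _ measurable_ennreal])
  qed
  show ?thesis
  proof (rule has_bochner_integral.intros)
    show "(\<lambda>\<omega>. blinfun_apply q (X \<omega>)) \<in> borel_measurable M"
      by (rule measurable_compose[OF borel_X]) (intro borel_measurable_continuous_onI continuous_intros)
    show sq: "Bochner_Integration.simple_bochner_integrable M (\<lambda>\<omega>. blinfun_apply q (s n \<omega>))" for n
      using simple_bochner_integrable_compose2[where p = "\<lambda>x y. blinfun_apply q x", OF _ s s] by simp
    have "(\<lambda>n. ennreal (norm q) * (\<integral>\<^sup>+\<omega>. ennreal (norm (X \<omega> - s n \<omega>)) \<partial>M)) \<longlonglongrightarrow> ennreal (norm q) * 0"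
      by (intro ennreal_tendsto_cmult conv) simp
    then have lim: "(\<lambda>n. ennreal (norm q) * (\<integral>\<^sup>+\<omega>. ennreal (norm (X \<omega> - s n \<omega>)) \<partial>M)) \<longlonglongrightarrow> 0" by simp
    have "(\<integral>\<^sup>+\<omega>. ennreal (norm (blinfun_apply q (X \<omega>) - blinfun_apply q (s n \<omega>))) \<partial>M)
        \<le> ennreal (norm q) * (\<integral>\<^sup>+\<omega>. ennreal (norm (X \<omega> - s n \<omega>)) \<partial>M)" for n
    proof -
      have "(\<integral>\<^sup>+\<omega>. ennreal (norm (blinfun_apply q (X \<omega>) - blinfun_apply q (s n \<omega>))) \<partial>M)
          \<le> (\<integral>\<^sup>+\<omega>. ennreal (norm q) * ennreal (norm (X \<omega> - s n \<omega>)) \<partial>M)"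
      proof (rule nn_integral_mono)
        fix \<omega>
        have "norm (blinfun_apply q (X \<omega>) - blinfun_apply q (s n \<omega>)) \<le> norm q * norm (X \<omega> - s n \<omega>)"
          using norm_blinfun[of q "X \<omega> - s n \<omega>"] by (simp add: blinfun.diff_right)
        then show "ennreal (norm (blinfun_apply q (X \<omega>) - blinfun_apply q (s n \<omega>))) \<le> ennreal (norm q) * ennreal (norm (X \<omega> - s n \<omega>))"
          by (simp add: ennreal_leI flip: ennreal_mult)
      qed
      also have "\<dots> = ennreal (norm q) * (\<integral>\<^sup>+\<omega>. ennreal (norm (X \<omega> - s n \<omega>)) \<partial>M)" by (rule nn_integral_cmult[OF norm_m])
      finally show ?thesis .
    qed
    then show "(\<lambda>n. \<integral>\<^sup>+\<omega>. ennreal (norm (blinfun_apply q (X \<omega>) - blinfun_apply q (s n \<omega>))) \<partial>M) \<longlonglongrightarrow> 0"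
      by (intro tendsto_sandwich[OF _ _ tendsto_const lim] always_eventually) auto
    have "Bochner_Integration.simple_bochner_integral M (\<lambda>\<omega>. blinfun_apply q (s n \<omega>)) = blinfun_apply q (Bochner_Integration.simple_bochner_integral M (s n))" for n
      by (rule simple_bochner_integral_linear[OF _ s]) (rule bounded_linear.linear[OF blinfun.bounded_linear_right])
    then show "(\<lambda>n. Bochner_Integration.simple_bochner_integral M (\<lambda>\<omega>. blinfun_apply q (s n \<omega>))) \<longlonglongrightarrow> blinfun_apply q I"
      using I by (simp add: tendsto_intros)
  qed
qed

lemma (in prob_space) simple_bochner_integrable_simple:
  "simple_function M s \<Longrightarrow> Bochner_Integration.simple_bochner_integrable M s"
  by (rule simple_bochner_integrable.intros) auto

text \<open>Dominated convergence shows that the integrals of approximating simple functions form a Cauchy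
  sequence.\<close>

lemma (in prob_space) has_bochner_expectation_exists:
  fixes X :: "'a \<Rightarrow> 'b::banach"
  assumes X: "strongly_measurable M X" and int: "integrable M (\<lambda>\<omega>. norm (X \<omega>))"
  shows "\<exists>I. has_bochner_expectation M X I"
proof -
  obtain s where s: "\<And>n. simple_function M (s n)" "\<And>\<omega>. \<omega> \<in> space M \<Longrightarrow> (\<lambda>n. s n \<omega>) \<longlonglongrightarrow> X \<omega>"
    and sb: "\<And>n \<omega>. norm (s n \<omega>) \<le> norm (X \<omega>) + 1"
    using strongly_measurable_bounded_approx[OF X] by metis
  note si = simple_bochner_integrable_simple[OF s(1)]
  note sm = strongly_measurable_simple[OF s(1)]
  have dm: "(\<lambda>\<omega>. norm (X \<omega> - s n \<omega>)) \<in> borel_measurable M" for n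
    by (rule borel_measurable_norm_diff[OF X sm])
  have bound: "norm (X \<omega> - s n \<omega>) \<le> 2 * norm (X \<omega>) + 1" for n \<omega>
    using norm_triangle_ineq4[of "X \<omega>" "s n \<omega>"] sb[of n \<omega>] by simp
  have di: "integrable M (\<lambda>\<omega>. 2 * norm (X \<omega>) + 1)" using int by simp
  have ni: "integrable M (\<lambda>\<omega>. norm (X \<omega> - s n \<omega>))" for n
    by (rule Bochner_Integration.integrable_bound[OF di dm]) (use bound in auto)
  have "(\<lambda>n. \<integral>\<omega>. norm (X \<omega> - s n \<omega>) \<partial>M) \<longlonglongrightarrow> (\<integral>\<omega>. 0 \<partial>M)"
  proof (rule integral_dominated_convergence[OF _ dm di])
    show "AE \<omega> in M. (\<lambda>n. norm (X \<omega> - s n \<omega>)) \<longlonglongrightarrow> 0"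
    proof (rule AE_I2)
      fix \<omega> assume "\<omega> \<in> space M"
      then have "(\<lambda>n. norm (X \<omega> - s n \<omega>)) \<longlonglongrightarrow> norm (X \<omega> - X \<omega>)" by (intro tendsto_intros s)
      then show "(\<lambda>n. norm (X \<omega> - s n \<omega>)) \<longlonglongrightarrow> 0" by simp
    qed
    show "AE \<omega> in M. norm (norm (X \<omega> - s n \<omega>)) \<le> 2 * norm (X \<omega>) + 1" for n using bound by auto
  qed simp
  then have lim: "(\<lambda>n. \<integral>\<omega>. norm (X \<omega> - s n \<omega>) \<partial>M) \<longlonglongrightarrow> 0" by simp
  have dist: "norm (Bochner_Integration.simple_bochner_integral M (s m) - Bochner_Integration.simple_bochner_integral M (s n))
      \<le> (\<integral>\<omega>. norm (X \<omega> - s m \<omega>) \<partial>M) + (\<integral>\<omega>. norm (X \<omega> - s n \<omega>) \<partial>M)" for m n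
  proof -
    have sd: "Bochner_Integration.simple_bochner_integrable M (\<lambda>\<omega>. norm (s m \<omega> - s n \<omega>))"
      using simple_bochner_integrable_compose2[where p = "\<lambda>x y. norm (x - y)", OF _ si si] by simp
    have "norm (Bochner_Integration.simple_bochner_integral M (s m) - Bochner_Integration.simple_bochner_integral M (s n))
        = norm (Bochner_Integration.simple_bochner_integral M (\<lambda>\<omega>. s m \<omega> - s n \<omega>))"
      by (subst simple_bochner_integral_diff[OF si si]) simp
    also have "\<dots> \<le> Bochner_Integration.simple_bochner_integral M (\<lambda>\<omega>. norm (s m \<omega> - s n \<omega>))"
      using simple_bochner_integrable_compose2[where p = "(-)", OF _ si si] by (intro simple_bochner_integral_norm_bound) simp
    also have "\<dots> = (\<integral>\<omega>. norm (s m \<omega> - s n \<omega>) \<partial>M)" by (rule simple_bochner_integrable_eq_integral[OF sd])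
    also have "\<dots> \<le> (\<integral>\<omega>. norm (X \<omega> - s m \<omega>) + norm (X \<omega> - s n \<omega>) \<partial>M)"
    proof (rule integral_mono)
      show "integrable M (\<lambda>\<omega>. norm (s m \<omega> - s n \<omega>))"
        using has_bochner_integral_simple_bochner_integrable[OF sd] by (rule integrable.intros)
      show "integrable M (\<lambda>\<omega>. norm (X \<omega> - s m \<omega>) + norm (X \<omega> - s n \<omega>))" using ni by simp
      fix \<omega> show "norm (s m \<omega> - s n \<omega>) \<le> norm (X \<omega> - s m \<omega>) + norm (X \<omega> - s n \<omega>)"
        using norm_triangle_ineq4[of "X \<omega> - s n \<omega>" "X \<omega> - s m \<omega>"] by simp
    qed
    also have "\<dots> = (\<integral>\<omega>. norm (X \<omega> - s m \<omega>) \<partial>M) + (\<integral>\<omega>. norm (X \<omega> - s n \<omega>) \<partial>M)" using ni by simp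
    finally show ?thesis .
  qed
  have "Cauchy (\<lambda>n. Bochner_Integration.simple_bochner_integral M (s n))"
  proof (rule CauchyI)
    fix e :: real assume "0 < e"
    then have "\<forall>\<^sub>F n in sequentially. (\<integral>\<omega>. norm (X \<omega> - s n \<omega>) \<partial>M) < e / 2" using lim by (intro order_tendstoD(2)) auto
    then obtain N where N: "\<And>n. N \<le> n \<Longrightarrow> (\<integral>\<omega>. norm (X \<omega> - s n \<omega>) \<partial>M) < e / 2" by (auto simp: eventually_sequentially)
    show "\<exists>N. \<forall>m\<ge>N. \<forall>n\<ge>N. norm (Bochner_Integration.simple_bochner_integral M (s m) - Bochner_Integration.simple_bochner_integral M (s n)) < e"
    proof (intro exI[of _ N] allI impI)
      fix m n assume "N \<le> m" "N \<le> n"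
      then show "norm (Bochner_Integration.simple_bochner_integral M (s m) - Bochner_Integration.simple_bochner_integral M (s n)) < e"
        using dist[of m n] N[of m] N[of n] by linarith
    qed
  qed
  then obtain I where I: "(\<lambda>n. Bochner_Integration.simple_bochner_integral M (s n)) \<longlonglongrightarrow> I"
    unfolding Cauchy_convergent_iff convergent_def by blast
  have "(\<lambda>n. ennreal (\<integral>\<omega>. norm (X \<omega> - s n \<omega>) \<partial>M)) \<longlonglongrightarrow> ennreal 0" by (intro tendsto_ennrealI lim)
  then have "(\<lambda>n. \<integral>\<^sup>+\<omega>. ennreal (norm (X \<omega> - s n \<omega>)) \<partial>M) \<longlonglongrightarrow> 0"
    using ni by (simp add: nn_integral_eq_integral)
  then show ?thesis unfolding has_bochner_expectation_def using X si I by blast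
qed

section \<open>Conditionally centered noise\<close>

lemma simple_function_subalgebra:
  assumes "simple_function F s" "sets F \<subseteq> sets M" "space F = space M"
  shows "simple_function M s"
  using assms unfolding simple_function_def by (metis subsetD)

lemma strongly_measurable_mono:
  assumes "strongly_measurable F X" "sets F \<subseteq> sets M" "space F = space M"
  shows "strongly_measurable M X"
  using assms simple_function_subalgebra unfolding strongly_measurable_def by metis

lemma borel_measurable_pairing:
  fixes \<delta> :: "'w \<Rightarrow> ('a::real_normed_vector \<Rightarrow>\<^sub>L real)"
  assumes "strongly_measurable M \<delta>" "strongly_measurable M X"
  shows "(\<lambda>\<omega>. blinfun_apply (\<delta> \<omega>) (X \<omega>)) \<in> borel_measurable M"
  by (rule strongly_measurable_borel, rule strongly_measurable_compose2[OF assms, where R = blinfun_apply])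
    (intro continuous_intros)

text \<open>Centered noise is orthogonal to every \<open>F\<close>-measurable variable: for a simple function this is the
  defining property of the conditional expectation, tested on evaluation functionals.\<close>

lemma (in prob_space) centered_noise_pairing:
  fixes \<delta> :: "'a \<Rightarrow> ('b::banach \<Rightarrow>\<^sub>L real)"
  assumes \<delta>: "is_cond_expectation M F \<delta> (\<lambda>_. 0)" and sub: "sets F \<subseteq> sets M" "space F = space M"
    and y: "strongly_measurable F y" and int: "integrable M (\<lambda>\<omega>. norm (\<delta> \<omega>) * (norm (y \<omega>) + 1))"
  shows "integrable M (\<lambda>\<omega>. blinfun_apply (\<delta> \<omega>) (y \<omega>))" "(\<integral>\<omega>. blinfun_apply (\<delta> \<omega>) (y \<omega>) \<partial>M) = 0"
proof -
  have \<delta>m: "strongly_measurable M \<delta>" using \<delta> by (auto simp: is_cond_expectation_def has_bochner_expectation_def)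
  note ym = strongly_measurable_mono[OF y sub]
  obtain s where s: "\<And>n. simple_function F (s n)" "\<And>\<omega>. \<omega> \<in> space F \<Longrightarrow> (\<lambda>n. s n \<omega>) \<longlonglongrightarrow> y \<omega>"
    and sb: "\<And>n \<omega>. norm (s n \<omega>) \<le> norm (y \<omega>) + 1"
    using strongly_measurable_bounded_approx[OF y] by metis
  note sm = strongly_measurable_simple[OF simple_function_subalgebra[OF s(1) sub]]
  have ev: "has_bochner_integral M (\<lambda>\<omega>. indicator A \<omega> * blinfun_apply (\<delta> \<omega>) v) 0" if A: "A \<in> sets F" for A v
  proof -
    let ?ev = "Blinfun (\<lambda>p :: 'b \<Rightarrow>\<^sub>L real. blinfun_apply p v)"
    have e: "blinfun_apply ?ev p = blinfun_apply p v" for p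
      by (subst bounded_linear_Blinfun_apply) (auto intro: blinfun.bounded_linear_left)
    obtain I where I: "has_bochner_expectation M (\<lambda>\<omega>. indicator A \<omega> *\<^sub>R \<delta> \<omega>) I"
      "has_bochner_expectation M (\<lambda>\<omega>. indicator A \<omega> *\<^sub>R (0 :: 'b \<Rightarrow>\<^sub>L real)) I"
      using \<delta> A unfolding is_cond_expectation_def by blast
    have "has_bochner_integral M (\<lambda>\<omega>. 0) (blinfun_apply ?ev I)"
      using has_bochner_expectation_functional[OF I(2), of ?ev] by simp
    then have "blinfun_apply ?ev I = 0" using has_bochner_integral_eq has_bochner_integral_zero by blast
    then show ?thesis using has_bochner_expectation_functional[OF I(1), of ?ev] by (simp add: e blinfun.scaleR_left)
  qed
  have zero: "(\<integral>\<omega>. blinfun_apply (\<delta> \<omega>) (s n \<omega>) \<partial>M) = 0" for n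
  proof -
    have fin: "finite (s n ` space F)" and meas: "\<And>v. v \<in> s n ` space F \<Longrightarrow> s n -` {v} \<inter> space F \<in> sets F"
      using s(1)[of n] by (auto simp: simple_function_def)
    have "has_bochner_integral M (\<lambda>\<omega>. \<Sum>v\<in>s n ` space F. indicator (s n -` {v} \<inter> space F) \<omega> * blinfun_apply (\<delta> \<omega>) v) (\<Sum>v\<in>s n ` space F. 0)"
      by (intro has_bochner_integral_sum ev meas)
    moreover have "(\<Sum>v\<in>s n ` space F. indicator (s n -` {v} \<inter> space F) \<omega> * blinfun_apply (\<delta> \<omega>) v) = blinfun_apply (\<delta> \<omega>) (s n \<omega>)"
      if "\<omega> \<in> space M" for \<omega>
    proof -
      have "(\<Sum>v\<in>s n ` space F. indicator (s n -` {v} \<inter> space F) \<omega> * blinfun_apply (\<delta> \<omega>) v)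
          = (\<Sum>v\<in>s n ` space F. if v = s n \<omega> then blinfun_apply (\<delta> \<omega>) v else 0)"
        using that sub by (intro sum.cong) (auto simp: indicator_def)
      also have "\<dots> = blinfun_apply (\<delta> \<omega>) (s n \<omega>)" using that sub fin by (simp add: sum.delta)
      finally show ?thesis .
    qed
    ultimately have "has_bochner_integral M (\<lambda>\<omega>. blinfun_apply (\<delta> \<omega>) (s n \<omega>)) 0"
      by (simp cong: has_bochner_integral_cong)
    then show ?thesis by (rule has_bochner_integral_integral_eq)
  qed
  have bound: "norm (blinfun_apply (\<delta> \<omega>) z) \<le> norm (\<delta> \<omega>) * (norm (y \<omega>) + 1)" if "norm z \<le> norm (y \<omega>) + 1" for z \<omega>
    using norm_blinfun[of "\<delta> \<omega>" z] mult_left_mono[OF that, of "norm (\<delta> \<omega>)"] by simp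
  have bm: "(\<lambda>\<omega>. blinfun_apply (\<delta> \<omega>) (y \<omega>)) \<in> borel_measurable M" "(\<lambda>\<omega>. blinfun_apply (\<delta> \<omega>) (s n \<omega>)) \<in> borel_measurable M" for n
    using \<delta>m ym sm by (auto intro: borel_measurable_pairing)
  show "integrable M (\<lambda>\<omega>. blinfun_apply (\<delta> \<omega>) (y \<omega>))"
    by (rule Bochner_Integration.integrable_bound[OF int bm(1)]) (intro AE_I2, use bound in fastforce)
  have "(\<lambda>n. \<integral>\<omega>. blinfun_apply (\<delta> \<omega>) (s n \<omega>) \<partial>M) \<longlonglongrightarrow> (\<integral>\<omega>. blinfun_apply (\<delta> \<omega>) (y \<omega>) \<partial>M)"
  proof (rule integral_dominated_convergence[OF bm int])
    show "AE \<omega> in M. (\<lambda>n. blinfun_apply (\<delta> \<omega>) (s n \<omega>)) \<longlonglongrightarrow> blinfun_apply (\<delta> \<omega>) (y \<omega>)"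
      using s(2) sub(2) by (intro AE_I2 tendsto_intros) auto
    show "AE \<omega> in M. norm (blinfun_apply (\<delta> \<omega>) (s n \<omega>)) \<le> norm (\<delta> \<omega>) * (norm (y \<omega>) + 1)" for n
      by (intro AE_I2 bound sb)
  qed
  then show "(\<integral>\<omega>. blinfun_apply (\<delta> \<omega>) (y \<omega>) \<partial>M) = 0" by (simp add: zero LIMSEQ_const_iff)
qed

lemma space_history: "space (history M w k) = space M"
  unfolding history_def by (rule space_measure_of) auto

lemma sets_history: "sets (history M w k) = sigma_sets (space M) {w i -` B \<inter> space M | i B. i \<le> k \<and> B \<in> sets borel}"
  unfolding history_def by (rule sets_measure_of) auto

lemma history_subalgebra:
  assumes "\<And>i. w i \<in> borel_measurable M" shows "sets (history M w k) \<subseteq> sets M"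
  unfolding sets_history by (rule sets.sigma_sets_subset) (use assms in \<open>auto intro: measurable_sets\<close>)

lemma measurable_history:
  assumes "i \<le> k" shows "w i \<in> borel_measurable (history M w k)"
proof (rule measurableI)
  fix B :: "'b set" assume "B \<in> sets borel"
  then have "w i -` B \<inter> space M \<in> {w i -` B \<inter> space M | i B. i \<le> k \<and> B \<in> sets borel}" using assms by blast
  then show "w i -` B \<inter> space (history M w k) \<in> sets (history M w k)"
    unfolding sets_history space_history by (rule sigma_sets.Basic)
qed simp

section \<open>Square-integrable convergence\<close>

text \<open>Boundedness in mean square gives uniform integrability: cut the difference \<open>D\<close> at level \<open>1 / \<eta>\<close>. The
  truncated part tends to zero in mean by bounded convergence, and the excess is at most \<open>\<eta> D\<^sup>2\<close>.\<close>

lemma (in prob_space) integral_tendsto_of_L2_bounded: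
  fixes X :: "nat \<Rightarrow> 'a \<Rightarrow> real"
  assumes Xm: "\<And>j. X j \<in> borel_measurable M" and Ym: "Y \<in> borel_measurable M"
    and lim: "AE \<omega> in M. (\<lambda>j. X j \<omega>) \<longlonglongrightarrow> Y \<omega>"
    and X2: "\<And>j. integrable M (\<lambda>\<omega>. (X j \<omega>)\<^sup>2)" "\<And>j. (\<integral>\<omega>. (X j \<omega>)\<^sup>2 \<partial>M) \<le> B"
  shows "(\<lambda>j. \<integral>\<omega>. X j \<omega> \<partial>M) \<longlonglongrightarrow> (\<integral>\<omega>. Y \<omega> \<partial>M)"
proof -
  note [measurable] = Xm Ym
  have B: "0 \<le> B" by (rule order_trans[OF _ X2(2)[of 0]]) simp
  have nn: "(\<integral>\<^sup>+\<omega>. ennreal ((X j \<omega>)\<^sup>2) \<partial>M) \<le> ennreal B" for j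
    using X2 by (subst nn_integral_eq_integral) (auto intro: ennreal_leI)
  have "(\<integral>\<^sup>+\<omega>. ennreal ((Y \<omega>)\<^sup>2) \<partial>M) = (\<integral>\<^sup>+\<omega>. liminf (\<lambda>j. ennreal ((X j \<omega>)\<^sup>2)) \<partial>M)"
  proof (rule nn_integral_cong_AE)
    show "AE \<omega> in M. ennreal ((Y \<omega>)\<^sup>2) = liminf (\<lambda>j. ennreal ((X j \<omega>)\<^sup>2))"
      using lim
    proof eventually_elim
      case (elim \<omega>)
      then have "(\<lambda>j. ennreal ((X j \<omega>)\<^sup>2)) \<longlonglongrightarrow> ennreal ((Y \<omega>)\<^sup>2)" by (intro tendsto_ennrealI tendsto_power)
      then show ?case by (intro lim_imp_Liminf[symmetric]) auto
    qed
  qed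
  also have "\<dots> \<le> liminf (\<lambda>j. \<integral>\<^sup>+\<omega>. ennreal ((X j \<omega>)\<^sup>2) \<partial>M)" by (rule nn_integral_liminf) measurable
  also have "\<dots> \<le> ennreal B"
    using Liminf_mono[of "\<lambda>j. \<integral>\<^sup>+\<omega>. ennreal ((X j \<omega>)\<^sup>2) \<partial>M" "\<lambda>_. ennreal B" sequentially] nn by (simp add: Liminf_const)
  finally have nY: "(\<integral>\<^sup>+\<omega>. ennreal ((Y \<omega>)\<^sup>2) \<partial>M) \<le> ennreal B" .
  have Y2: "integrable M (\<lambda>\<omega>. (Y \<omega>)\<^sup>2)"
    using nY by (intro integrableI_bounded) (auto simp: less_top[symmetric] top_unique)
  have Y2B: "(\<integral>\<omega>. (Y \<omega>)\<^sup>2 \<partial>M) \<le> B"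
    using nY B by (simp add: nn_integral_eq_integral[OF Y2])
  have sq: "\<bar>a\<bar> \<le> 1 + a\<^sup>2" for a :: real
  proof -
    have "0 \<le> (\<bar>a\<bar> - 1)\<^sup>2" by simp
    then show ?thesis by (simp add: power2_diff)
  qed
  have Yi: "integrable M Y" by (rule Bochner_Integration.integrable_bound[of _ "\<lambda>\<omega>. 1 + (Y \<omega>)\<^sup>2"]) (use Y2 sq in auto)
  have Xi: "integrable M (X j)" for j by (rule Bochner_Integration.integrable_bound[of _ "\<lambda>\<omega>. 1 + (X j \<omega>)\<^sup>2"]) (use X2 sq in auto)
  define D where "D j \<omega> = \<bar>X j \<omega> - Y \<omega>\<bar>" for j \<omega>
  have [measurable]: "D j \<in> borel_measurable M" for j unfolding D_def by measurable
  have D2: "(D j \<omega>)\<^sup>2 \<le> 2 * (X j \<omega>)\<^sup>2 + 2 * (Y \<omega>)\<^sup>2" for j \<omega>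
  proof -
    have "0 \<le> (X j \<omega> + Y \<omega>)\<^sup>2" by simp
    then show ?thesis by (simp add: D_def power2_sum power2_diff)
  qed
  have D2i: "integrable M (\<lambda>\<omega>. (D j \<omega>)\<^sup>2)" for j
    by (rule Bochner_Integration.integrable_bound[of _ "\<lambda>\<omega>. 2 * (X j \<omega>)\<^sup>2 + 2 * (Y \<omega>)\<^sup>2"]) (use X2 Y2 D2 in auto)
  have D2B: "(\<integral>\<omega>. (D j \<omega>)\<^sup>2 \<partial>M) \<le> 4 * B" for j
  proof -
    have "(\<integral>\<omega>. (D j \<omega>)\<^sup>2 \<partial>M) \<le> (\<integral>\<omega>. 2 * (X j \<omega>)\<^sup>2 + 2 * (Y \<omega>)\<^sup>2 \<partial>M)"
      using X2 Y2 D2 D2i by (intro integral_mono) auto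
    also have "\<dots> = 2 * (\<integral>\<omega>. (X j \<omega>)\<^sup>2 \<partial>M) + 2 * (\<integral>\<omega>. (Y \<omega>)\<^sup>2 \<partial>M)" using X2 Y2 by simp
    finally show ?thesis using X2(2)[of j] Y2B by linarith
  qed
  have "(\<lambda>j. (\<integral>\<omega>. X j \<omega> \<partial>M) - (\<integral>\<omega>. Y \<omega> \<partial>M)) \<longlonglongrightarrow> 0"
  proof (rule LIMSEQ_I)
    fix e :: real assume e: "0 < e"
    define \<eta> where "\<eta> = e / (2 * (4 * B + 1))"
    have \<eta>: "0 < \<eta>" "\<eta> * (4 * B) < e / 2" using e B by (auto simp: \<eta>_def field_simps)
    have "(\<lambda>j. \<integral>\<omega>. min (D j \<omega>) (1 / \<eta>) \<partial>M) \<longlonglongrightarrow> (\<integral>\<omega>. 0 \<partial>M)"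
    proof (rule integral_dominated_convergence[where w = "\<lambda>_. 1 / \<eta>"])
      show "AE \<omega> in M. (\<lambda>j. min (D j \<omega>) (1 / \<eta>)) \<longlonglongrightarrow> 0"
        using lim
      proof eventually_elim
        case (elim \<omega>)
        then have "(\<lambda>j. min (D j \<omega>) (1 / \<eta>)) \<longlonglongrightarrow> min \<bar>Y \<omega> - Y \<omega>\<bar> (1 / \<eta>)" unfolding D_def by (intro tendsto_intros)
        then show ?case using \<eta>(1) by (simp add: min_def)
      qed
    qed (use \<eta>(1) in \<open>auto simp: D_def\<close>)
    then have "(\<lambda>j. \<integral>\<omega>. min (D j \<omega>) (1 / \<eta>) \<partial>M) \<longlonglongrightarrow> 0" by simp
    then have "\<forall>\<^sub>F j in sequentially. (\<integral>\<omega>. min (D j \<omega>) (1 / \<eta>) \<partial>M) < e / 2" using e by (intro order_tendstoD(2)) auto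
    then obtain N where N: "\<And>j. N \<le> j \<Longrightarrow> (\<integral>\<omega>. min (D j \<omega>) (1 / \<eta>) \<partial>M) < e / 2" by (auto simp: eventually_sequentially)
    have "norm ((\<integral>\<omega>. X j \<omega> \<partial>M) - (\<integral>\<omega>. Y \<omega> \<partial>M) - 0) < e" if "N \<le> j" for j
    proof -
      have Di: "integrable M (D j)" unfolding D_def using Xi Yi by simp
      have mi: "integrable M (\<lambda>\<omega>. min (D j \<omega>) (1 / \<eta>))" using Di by (rule integrable_min) simp
      have pw: "D j \<omega> \<le> min (D j \<omega>) (1 / \<eta>) + \<eta> * (D j \<omega>)\<^sup>2" for \<omega>
      proof (cases "D j \<omega> \<le> 1 / \<eta>")
        case True
        then show ?thesis using \<eta>(1) by (simp add: min_def)
      next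
        case False
        then have "1 \<le> \<eta> * D j \<omega>" using \<eta>(1) by (simp add: field_simps)
        then have "1 * D j \<omega> \<le> (\<eta> * D j \<omega>) * D j \<omega>" by (rule mult_right_mono) (simp add: D_def)
        then have "D j \<omega> \<le> \<eta> * (D j \<omega>)\<^sup>2" by (simp only: power2_eq_square mult.assoc mult_1_left)
        moreover have "0 \<le> min (D j \<omega>) (1 / \<eta>)" using \<eta>(1) by (simp add: D_def)
        ultimately show ?thesis by linarith
      qed
      have "\<bar>(\<integral>\<omega>. X j \<omega> \<partial>M) - (\<integral>\<omega>. Y \<omega> \<partial>M)\<bar> = \<bar>\<integral>\<omega>. X j \<omega> - Y \<omega> \<partial>M\<bar>" using Xi Yi by simp
      also have "\<dots> \<le> (\<integral>\<omega>. D j \<omega> \<partial>M)" unfolding D_def by (rule integral_abs_bound)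
      also have "\<dots> \<le> (\<integral>\<omega>. min (D j \<omega>) (1 / \<eta>) + \<eta> * (D j \<omega>)\<^sup>2 \<partial>M)"
        using Di mi D2i pw by (intro integral_mono) auto
      also have "\<dots> = (\<integral>\<omega>. min (D j \<omega>) (1 / \<eta>) \<partial>M) + \<eta> * (\<integral>\<omega>. (D j \<omega>)\<^sup>2 \<partial>M)" using mi D2i by simp
      also have "\<dots> \<le> (\<integral>\<omega>. min (D j \<omega>) (1 / \<eta>) \<partial>M) + \<eta> * (4 * B)"
        using D2B[of j] \<eta>(1) by simp
      finally show ?thesis using N[OF that] \<eta>(2) by simp
    qed
    then show "\<exists>N. \<forall>j\<ge>N. norm ((\<integral>\<omega>. X j \<omega> \<partial>M) - (\<integral>\<omega>. Y \<omega> \<partial>M) - 0) < e" by blast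
  qed
  then show ?thesis by (simp add: LIM_zero_iff)
qed

section \<open>The stochastic iteration\<close>

context bregman_block
begin

lemma grad_demicontinuous_interior:
  assumes "\<And>n. u n \<in> interior (eff_dom \<phi>)" "x \<in> interior (eff_dom \<phi>)" "u \<longlonglongrightarrow> x"
  shows "(\<lambda>n. blinfun_apply (grad \<phi> (u n)) v) \<longlonglongrightarrow> blinfun_apply (grad \<phi> x) v"
    "(\<lambda>n. blinfun_apply (grad F (u n)) v) \<longlonglongrightarrow> blinfun_apply (grad F x) v"
  using assms smooth unfolding rel_smooth_def
  by (auto intro!: grad_demicontinuous entropy smooth_part entropy_diff)

text \<open>The value is meaningful only where the resolvent set is a singleton.\<close>

definition resolvent :: "real \<Rightarrow> ('a \<Rightarrow>\<^sub>L real) \<Rightarrow> 'a" where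
  "resolvent \<gamma> \<zeta> = (SOME u. u \<in> bregman_resolvent \<phi> \<gamma> G \<zeta>)"

lemma resolvent_in: "resolvent_single \<phi> \<gamma> G \<zeta> \<Longrightarrow> resolvent \<gamma> \<zeta> \<in> bregman_resolvent \<phi> \<gamma> G \<zeta>"
  unfolding resolvent_def resolvent_single_def by (rule someI_ex) blast

lemma resolvent_continuous:
  assumes \<sigma>: "0 < \<sigma>" "\<And>x y. ereal (\<sigma> / 2 * (norm (x - y))\<^sup>2) \<le> bregman \<phi> x y" and \<gamma>: "0 \<le> \<gamma>"
    and single: "\<And>\<zeta>. \<zeta> \<in> S \<Longrightarrow> resolvent_single \<phi> \<gamma> G \<zeta>"
  shows "continuous_on S (resolvent \<gamma>)"
proof -
  have "dist (resolvent \<gamma> \<zeta>) (resolvent \<gamma> \<eta>) \<le> (1 / \<sigma>) * dist \<zeta> \<eta>" if "\<zeta> \<in> S" "\<eta> \<in> S" for \<zeta> \<eta>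
    using resolvent_lipschitz[OF \<sigma> \<gamma> resolvent_in[OF single[OF that(1)]] resolvent_in[OF single[OF that(2)]]]
    by (simp add: dist_norm)
  then have "(1 / \<sigma>)-lipschitz_on S (resolvent \<gamma>)" using \<sigma>(1) by (intro lipschitz_onI) auto
  then show ?thesis by (rule lipschitz_on_continuous_on)
qed

end

context primal_dual
begin

text \<open>The step-size condition says that the quadratic form
  \<open>\<sigma>p / (2 lam_inf) a\<^sup>2 + \<sigma>d / (2 nu_inf) b\<^sup>2 - norm T a b\<close> is positive definite.\<close>

lemma energy_quadratic_lower_bound:
  assumes \<sigma>: "0 < \<sigma>p" "0 < \<sigma>d"
    and Dp: "\<And>x y. ereal (\<sigma>p / 2 * (norm (x - y))\<^sup>2) \<le> bregman \<phi>p x y"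
    and Dd: "\<And>x y. ereal (\<sigma>d / 2 * (norm (x - y))\<^sup>2) \<le> bregman \<phi>d x y"
    and small: "ereal (nu_inf * lam_inf) < ereal (\<sigma>p * \<sigma>d) / ereal ((norm T)\<^sup>2)"
  obtains c where "0 < c" "\<And>k v w. v \<in> feasible \<Longrightarrow> w \<in> admissible \<Longrightarrow> c * (norm (v - w))\<^sup>2 \<le> energy k v w"
proof -
  define \<alpha> \<beta> \<tau> where "\<alpha> = \<sigma>p / lam_inf" and "\<beta> = \<sigma>d / nu_inf" and "\<tau> = norm T"
  have pos: "0 < \<alpha>" "0 < \<beta>" "0 \<le> \<tau>" using \<sigma> lam_inf_pos nu_inf_pos by (auto simp: \<alpha>_def \<beta>_def \<tau>_def)
  have \<tau>: "\<tau>\<^sup>2 < \<alpha> * \<beta>"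
  proof (cases "\<tau> = 0")
    case False
    then have "nu_inf * lam_inf < \<sigma>p * \<sigma>d / \<tau>\<^sup>2" using small by (simp add: \<tau>_def)
    then have "nu_inf * lam_inf * \<tau>\<^sup>2 < \<sigma>p * \<sigma>d" using False by (simp add: pos_less_divide_eq)
    then show ?thesis using lam_inf_pos nu_inf_pos by (simp add: \<alpha>_def \<beta>_def pos_less_divide_eq mult.commute mult.left_commute)
  qed (use pos in simp)
  define \<kappa> where "\<kappa> = \<tau> / sqrt (\<alpha> * \<beta>)"
  have s: "0 < sqrt (\<alpha> * \<beta>)" using pos by simp
  have "\<tau> < sqrt (\<alpha> * \<beta>)" using \<tau> pos by (intro real_less_rsqrt)
  then have \<kappa>: "0 \<le> \<kappa>" "\<kappa> < 1" "\<tau> = \<kappa> * sqrt (\<alpha> * \<beta>)" using s pos by (auto simp: \<kappa>_def)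
  define c where "c = (1 - \<kappa>) / 2 * min \<alpha> \<beta>"
  have c: "0 < c" using \<kappa> pos by (simp add: c_def)
  have quad: "c * (a\<^sup>2 + b\<^sup>2) \<le> \<alpha> / 2 * a\<^sup>2 + \<beta> / 2 * b\<^sup>2 - \<tau> * a * b" if "0 \<le> a" "0 \<le> b" for a b
  proof -
    have "0 \<le> (sqrt \<alpha> * a - sqrt \<beta> * b)\<^sup>2" by simp
    then have "2 * (sqrt (\<alpha> * \<beta>) * a * b) \<le> \<alpha> * a\<^sup>2 + \<beta> * b\<^sup>2"
      using pos by (simp add: power2_diff power_mult_distrib real_sqrt_mult algebra_simps)
    then have "\<kappa> * (2 * (sqrt (\<alpha> * \<beta>) * a * b)) \<le> \<kappa> * (\<alpha> * a\<^sup>2 + \<beta> * b\<^sup>2)" using \<kappa>(1) by (rule mult_left_mono)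
    then have 1: "\<tau> * a * b \<le> \<kappa> / 2 * (\<alpha> * a\<^sup>2 + \<beta> * b\<^sup>2)" unfolding \<kappa>(3) by (simp add: algebra_simps)
    have "min \<alpha> \<beta> * a\<^sup>2 \<le> \<alpha> * a\<^sup>2" "min \<alpha> \<beta> * b\<^sup>2 \<le> \<beta> * b\<^sup>2" by (auto intro!: mult_right_mono)
    then have "min \<alpha> \<beta> * (a\<^sup>2 + b\<^sup>2) \<le> \<alpha> * a\<^sup>2 + \<beta> * b\<^sup>2" by (simp add: distrib_left)
    then have "(1 - \<kappa>) / 2 * (min \<alpha> \<beta> * (a\<^sup>2 + b\<^sup>2)) \<le> (1 - \<kappa>) / 2 * (\<alpha> * a\<^sup>2 + \<beta> * b\<^sup>2)"
      using \<kappa>(2) by (intro mult_left_mono) auto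
    then have "c * (a\<^sup>2 + b\<^sup>2) \<le> (1 - \<kappa>) / 2 * (\<alpha> * a\<^sup>2 + \<beta> * b\<^sup>2)" by (simp only: c_def mult.assoc)
    also have "\<dots> = (\<alpha> * a\<^sup>2 + \<beta> * b\<^sup>2) / 2 - \<kappa> / 2 * (\<alpha> * a\<^sup>2 + \<beta> * b\<^sup>2)" by (simp add: algebra_simps diff_divide_distrib add_divide_distrib)
    also have "\<dots> \<le> (\<alpha> * a\<^sup>2 + \<beta> * b\<^sup>2) / 2 - \<tau> * a * b" using 1 by linarith
    also have "\<dots> = \<alpha> / 2 * a\<^sup>2 + \<beta> / 2 * b\<^sup>2 - \<tau> * a * b" by (simp add: add_divide_distrib)
    finally show ?thesis .
  qed
  have "c * (norm (v - w))\<^sup>2 \<le> energy k v w" if vw: "v \<in> feasible" "w \<in> admissible" for k v w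
  proof -
    let ?a = "norm (fst v - fst w)" and ?b = "norm (snd v - snd w)"
    have "\<sigma>p / 2 * ?a\<^sup>2 \<le> breg \<phi>p (fst v) (fst w)" "\<sigma>d / 2 * ?b\<^sup>2 \<le> breg \<phi>d (snd v) (snd w)"
      using Dp[of "fst v" "fst w"] Dd[of "snd v" "snd w"] vw by (auto simp: P.bregman_feasible D.bregman_feasible)
    then have "\<alpha> / 2 * ?a\<^sup>2 \<le> 1 / lam_inf * breg \<phi>p (fst v) (fst w)" "\<beta> / 2 * ?b\<^sup>2 \<le> 1 / nu_inf * breg \<phi>d (snd v) (snd w)"
      using lam_inf_pos nu_inf_pos by (auto simp: \<alpha>_def \<beta>_def field_simps)
    moreover have "coupling T v w \<le> \<tau> * ?a * ?b"
    proof -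
      have "coupling T v w \<le> norm (blinfun_apply T (fst v - fst w)) * ?b"
        using norm_blinfun[of "blinfun_apply T (fst v - fst w)" "snd v - snd w"] by (simp add: coupling_def)
      also have "\<dots> \<le> (\<tau> * ?a) * ?b" unfolding \<tau>_def by (intro mult_right_mono norm_blinfun) auto
      finally show ?thesis .
    qed
    ultimately have "c * (?a\<^sup>2 + ?b\<^sup>2) \<le> form (1 / lam_inf) (1 / nu_inf) v w"
      using quad[OF norm_ge_zero norm_ge_zero, of "fst v - fst w" "snd v - snd w"] unfolding form_def by linarith
    also have "\<dots> \<le> energy k v w"
      using lam_pos nu_pos lam_le nu_le vw
      by (intro form_mono) (auto intro!: divide_left_mono mult_pos_pos lam_inf_pos nu_inf_pos)
    finally show ?thesis by (simp add: norm_prod_def)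
  qed
  with c show thesis by (rule that)
qed

end

text \<open>Young's inequality; the parameter \<open>t\<close> distributes the weight between the noise and the point.\<close>

lemma noise_pairing_le:
  fixes \<delta>p :: "'a::real_normed_vector \<Rightarrow>\<^sub>L real" and \<delta>d :: "'b::real_normed_vector \<Rightarrow>\<^sub>L real"
  assumes t: "0 < t"
  shows "\<bar>noise_pairing \<delta>p \<delta>d u\<bar> \<le> ((norm \<delta>p)\<^sup>2 + (norm \<delta>d)\<^sup>2) / (2 * t) + t / 2 * (norm u)\<^sup>2"
proof -
  have young: "a * b \<le> a\<^sup>2 / (2 * t) + t / 2 * b\<^sup>2" for a b :: real
  proof -
    have "0 \<le> (a - t * b)\<^sup>2" by simp
    then have "2 * t * (a * b) \<le> a\<^sup>2 + t * (t * b\<^sup>2)" by (simp add: power2_diff power_mult_distrib power2_eq_square algebra_simps)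
    then show ?thesis using t by (simp add: field_simps power2_eq_square)
  qed
  have "\<bar>noise_pairing \<delta>p \<delta>d u\<bar> \<le> norm \<delta>p * norm (fst u) + norm \<delta>d * norm (snd u)"
    unfolding noise_pairing_def using norm_blinfun[of \<delta>p "fst u"] norm_blinfun[of \<delta>d "snd u"]
    by (simp add: abs_le_iff)
  also have "\<dots> \<le> ((norm \<delta>p)\<^sup>2 / (2 * t) + t / 2 * (norm (fst u))\<^sup>2) + ((norm \<delta>d)\<^sup>2 / (2 * t) + t / 2 * (norm (snd u))\<^sup>2)"
    by (intro add_mono young)
  also have "\<dots> = ((norm \<delta>p)\<^sup>2 + (norm \<delta>d)\<^sup>2) / (2 * t) + t / 2 * (norm u)\<^sup>2"
    by (simp add: norm_prod_def add_divide_distrib distrib_left)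
  finally show ?thesis .
qed

text \<open>Almost every path is a path of the deterministic scheme, so everything proved above holds on the set
  \<open>good\<close> of such outcomes.\<close>

locale stochastic_primal_dual =
  saddle_problem \<phi>p f g Lp \<phi>d h l Ld T lam nu lam_inf nu_inf Cp Cd + prob_space M
  for \<phi>p f g :: "'p::banach \<Rightarrow> ereal" and Lp :: real and \<phi>d :: "'d::banach \<Rightarrow> ereal"
    and h l :: "('d \<Rightarrow>\<^sub>L real) \<Rightarrow> ereal" and Ld T lam nu lam_inf nu_inf Cp Cd and M :: "'w measure" +
  fixes \<delta>p :: "nat \<Rightarrow> 'w \<Rightarrow> ('p \<Rightarrow>\<^sub>L real)" and \<delta>d :: "nat \<Rightarrow> 'w \<Rightarrow> ('d \<Rightarrow>\<^sub>L real)"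
    and x :: "nat \<Rightarrow> 'w \<Rightarrow> 'p" and \<mu> :: "nat \<Rightarrow> 'w \<Rightarrow> 'd" and x0 :: 'p and \<mu>0 :: 'd
  assumes noise_rv: "\<And>k. strongly_measurable M (\<delta>p k)" "\<And>k. strongly_measurable M (\<delta>d k)"
    and iterate_rv: "\<And>k. strongly_measurable M (x k)" "\<And>k. strongly_measurable M (\<mu> k)"
    and start: "\<And>\<omega>. x 0 \<omega> = x0" "\<And>\<omega>. \<mu> 0 \<omega> = \<mu>0" and start_adm: "(x0, \<mu>0) \<in> admissible"
    and path: "AE \<omega> in M. primal_dual_path \<phi>p f g Lp \<phi>d (conjugate h) (conjugate l) Ld T lam nu lam_inf nu_inf
      (\<lambda>k. x k \<omega>) (\<lambda>k. \<mu> k \<omega>) (\<lambda>k. \<delta>p k \<omega>) (\<lambda>k. \<delta>d k \<omega>)"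
begin

abbreviation w :: "nat \<Rightarrow> 'w \<Rightarrow> 'p \<times> 'd" where "w k \<omega> \<equiv> (x k \<omega>, \<mu> k \<omega>)"

abbreviation avg :: "nat \<Rightarrow> 'w \<Rightarrow> 'p \<times> 'd" where "avg k \<omega> \<equiv> (ergodic_mean x k \<omega>, ergodic_mean \<mu> k \<omega>)"

abbreviation noise :: "nat \<Rightarrow> 'p \<times> 'd \<Rightarrow> 'w \<Rightarrow> real" where
  "noise i v \<omega> \<equiv> noise_pairing (\<delta>p i \<omega>) (\<delta>d i \<omega>) (v - w (Suc i) \<omega>)"

definition good :: "'w set" where
  "good = {\<omega> \<in> space M. primal_dual_path \<phi>p f g Lp \<phi>d (conjugate h) (conjugate l) Ld T lam nu lam_inf nu_inf
      (\<lambda>k. x k \<omega>) (\<lambda>k. \<mu> k \<omega>) (\<lambda>k. \<delta>p k \<omega>) (\<lambda>k. \<delta>d k \<omega>)}"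

lemma AE_good: "AE \<omega> in M. \<omega> \<in> good"
  using path AE_space by eventually_elim (simp add: good_def)

lemma good_path: "\<omega> \<in> good \<Longrightarrow> primal_dual_path \<phi>p f g Lp \<phi>d (conjugate h) (conjugate l) Ld T lam nu lam_inf nu_inf
      (\<lambda>k. x k \<omega>) (\<lambda>k. \<mu> k \<omega>) (\<lambda>k. \<delta>p k \<omega>) (\<lambda>k. \<delta>d k \<omega>)"
  by (simp add: good_def)

lemma good_space: "good \<subseteq> space M" by (auto simp: good_def)

lemma feasible_ne: "feasible \<noteq> {}"
  using admissible_feasible[OF start_adm] by blast

lemma closed_dom: "closed (eff_dom \<phi>p)" "closed (eff_dom \<phi>d)"
  using closed dom_p dom_d by auto

lemma avg_eq: "avg k \<omega> = (1 / real k) *\<^sub>R (\<Sum>i<k. w (Suc i) \<omega>)"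
  by (simp add: ergodic_mean_def prod_eq_iff fst_sum snd_sum sum.atLeast1_atMost_eq)

lemma good_avg:
  assumes \<omega>: "\<omega> \<in> good" and k: "1 \<le> k"
  shows "avg k \<omega> \<in> feasible"
    "v \<in> feasible \<Longrightarrow> real k * gap (avg k \<omega>) v \<le> energy 0 v (x0, \<mu>0) + (\<Sum>i<k. noise i v \<omega>)"
proof -
  interpret path: primal_dual_path \<phi>p f g Lp \<phi>d "conjugate h" "conjugate l" Ld T lam nu lam_inf nu_inf
      "\<lambda>k. x k \<omega>" "\<lambda>k. \<mu> k \<omega>" "\<lambda>k. \<delta>p k \<omega>" "\<lambda>k. \<delta>d k \<omega>" by (rule good_path[OF \<omega>])
  have m: "path.mean k = avg k \<omega>" by (simp add: path.mean_def ergodic_mean_def)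
  show "avg k \<omega> \<in> feasible" using path.mean_feasible[OF k] by (simp only: m)
  show "v \<in> feasible \<Longrightarrow> real k * gap (avg k \<omega>) v \<le> energy 0 v (x0, \<mu>0) + (\<Sum>i<k. noise i v \<omega>)"
    using path.mean_gap_bound[OF _ k, of v] by (simp only: m start)
qed

lemma good_admissible: "\<omega> \<in> good \<Longrightarrow> w k \<omega> \<in> admissible"
  using primal_dual_path.iterate_admissible[OF good_path] by blast

lemma w_rv: "strongly_measurable M (w k)"
  by (intro strongly_measurable_Pair iterate_rv)

lemma noise_measurable: "noise i v \<in> borel_measurable M"
proof -
  have "strongly_measurable M (\<lambda>\<omega>. fst v - x (Suc i) \<omega>)"
    by (rule strongly_measurable_compose[OF iterate_rv(1), where R = "\<lambda>y. fst v - y"]) (intro continuous_intros)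
  moreover have "strongly_measurable M (\<lambda>\<omega>. snd v - \<mu> (Suc i) \<omega>)"
    by (rule strongly_measurable_compose[OF iterate_rv(2), where R = "\<lambda>y. snd v - y"]) (intro continuous_intros)
  ultimately show ?thesis unfolding noise_pairing_def fst_diff snd_diff fst_conv snd_conv
    by (intro borel_measurable_add borel_measurable_pairing noise_rv)
qed

text \<open>The pathwise bound is integrated by monotonicity and subadditivity of the extended expectation; no
  integrability of the noise pairings is available here.\<close>

theorem expected_gap_bound:
  assumes k: "1 \<le> k" and xx: "xx \<in> P.feasible" and \<mu>\<mu>: "\<mu>\<mu> \<in> D.feasible"
  shows "ext_expectation M (\<lambda>\<omega>. Lag (ergodic_mean x k \<omega>) \<mu>\<mu> - Lag xx (ergodic_mean \<mu> k \<omega>))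
    \<le> (weighted_bregman (1 / lam 0) (1 / nu 0) \<phi>p \<phi>d (xx, \<mu>\<mu>) (x0, \<mu>0) - ereal (coupling T (xx, \<mu>\<mu>) (x0, \<mu>0))) / ereal (real k)
      + (\<Sum>i<k. ext_expectation M (\<lambda>\<omega>. ereal (noise i (xx, \<mu>\<mu>) \<omega>))) / ereal (real k)"
proof -
  let ?v = "(xx, \<mu>\<mu>)"
  have v: "?v \<in> feasible" using xx \<mu>\<mu> by simp
  have k0: "0 < real k" using k by simp
  define E where "E = energy 0 ?v (x0, \<mu>0)"
  define Z where "Z \<omega> = E + (\<Sum>i<k. noise i ?v \<omega>)" for \<omega>
  have Zm: "Z \<in> borel_measurable M" unfolding Z_def by (intro borel_measurable_add borel_measurable_sum borel_measurable_const noise_measurable)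
  have "ext_expectation M (\<lambda>\<omega>. Lag (ergodic_mean x k \<omega>) \<mu>\<mu> - Lag xx (ergodic_mean \<mu> k \<omega>)) \<le> ext_expectation M (\<lambda>\<omega>. ereal (Z \<omega> / real k))"
  proof (rule ext_expectation_mono_AE)
    show "AE \<omega> in M. Lag (ergodic_mean x k \<omega>) \<mu>\<mu> - Lag xx (ergodic_mean \<mu> k \<omega>) \<le> ereal (Z \<omega> / real k)"
      using AE_good
    proof eventually_elim
      case (elim \<omega>)
      have a: "ergodic_mean x k \<omega> \<in> P.feasible" "ergodic_mean \<mu> k \<omega> \<in> D.feasible" using good_avg(1)[OF elim k] by auto
      have "gap (avg k \<omega>) ?v \<le> Z \<omega> / real k"
        using good_avg(2)[OF elim k v] k0 unfolding Z_def E_def by (simp only: pos_le_divide_eq mult.commute)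
      moreover have "Lag (ergodic_mean x k \<omega>) \<mu>\<mu> - Lag xx (ergodic_mean \<mu> k \<omega>) = ereal (gap (avg k \<omega>) ?v)"
        using a xx \<mu>\<mu> by (simp add: lagrangian_feasible gap_def)
      ultimately show ?case by simp
    qed
  qed
  also have "\<dots> = ext_expectation M (\<lambda>\<omega>. ereal (Z \<omega>)) / ereal (real k)" by (rule ext_expectation_scale[OF Zm k0])
  also have "\<dots> \<le> (ereal E + (\<Sum>i<k. ext_expectation M (\<lambda>\<omega>. ereal (noise i ?v \<omega>)))) / ereal (real k)"
    unfolding Z_def using k0 by (intro ereal_divide_right_mono ext_expectation_affine_sum_le noise_measurable) auto
  also have "\<dots> = ereal E / ereal (real k) + (\<Sum>i<k. ext_expectation M (\<lambda>\<omega>. ereal (noise i ?v \<omega>))) / ereal (real k)"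
  proof -
    have "(ereal a + s) / ereal (real k) = ereal a / ereal (real k) + s / ereal (real k)" for a s
      using k0 by (cases s) (auto simp: add_divide_distrib)
    then show ?thesis .
  qed
  also have "ereal E = weighted_bregman (1 / lam 0) (1 / nu 0) \<phi>p \<phi>d ?v (x0, \<mu>0) - ereal (coupling T ?v (x0, \<mu>0))"
    unfolding E_def by (rule weighted_bregman_eq[OF v start_adm, symmetric])
  finally show ?thesis .
qed

text \<open>The common end of the three noise regimes. An affine minorant \<open>c + Q (\<cdot> - e)\<close> of the gap has
  expectation at most \<open>O(1/k)\<close> along the averages, and its expectations converge to \<open>c\<close>.\<close>

lemma saddle_of_limit_expectation:
  fixes winf :: "'w \<Rightarrow> 'p \<times> 'd" and r :: "nat \<Rightarrow> nat"
  assumes r: "strict_mono r" and winf: "strongly_measurable M winf" "integrable M (\<lambda>\<omega>. norm (winf \<omega>))"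
    and avg_int: "\<And>k (Q :: ('p \<times> 'd) \<Rightarrow>\<^sub>L real). integrable M (\<lambda>\<omega>. blinfun_apply Q (avg k \<omega>))"
    and avg_lim: "\<And>Q :: ('p \<times> 'd) \<Rightarrow>\<^sub>L real. (\<lambda>j. \<integral>\<omega>. blinfun_apply Q (avg (r j) \<omega>) \<partial>M) \<longlonglongrightarrow> (\<integral>\<omega>. blinfun_apply Q (winf \<omega>) \<partial>M)"
    and noise_int: "\<And>i v. v \<in> feasible \<Longrightarrow> integrable M (noise i v)"
    and noise_bound: "\<And>v. v \<in> feasible \<Longrightarrow> \<exists>K. \<forall>k. (\<Sum>i<k. \<integral>\<omega>. noise i v \<omega> \<partial>M) \<le> K"
  shows "\<exists>e. has_bochner_expectation M winf e \<and> saddle_point Lag e"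
proof -
  obtain e where e: "has_bochner_expectation M winf e" using has_bochner_expectation_exists[OF winf] by blast
  have nonpos: "c \<le> 0" if v: "v \<in> feasible" and minor: "\<And>u. u \<in> feasible \<Longrightarrow> c + blinfun_apply Q (u - e) \<le> gap u v"
    for v c and Q :: "('p \<times> 'd) \<Rightarrow>\<^sub>L real"
  proof -
    obtain K where K: "\<And>k. (\<Sum>i<k. \<integral>\<omega>. noise i v \<omega> \<partial>M) \<le> K" using noise_bound[OF v] by blast
    define E where "E = energy 0 v (x0, \<mu>0)"
    have bound: "c + (\<integral>\<omega>. blinfun_apply Q (avg k \<omega>) \<partial>M) - blinfun_apply Q e \<le> (E + K) / real k" if k: "1 \<le> k" for k
    proof -
      have k0: "0 < real k" using k by simp
      have "(\<integral>\<omega>. real k * (c + blinfun_apply Q (avg k \<omega>) - blinfun_apply Q e) \<partial>M) \<le> (\<integral>\<omega>. E + (\<Sum>i<k. noise i v \<omega>) \<partial>M)"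
      proof (rule integral_mono_AE)
        show "integrable M (\<lambda>\<omega>. real k * (c + blinfun_apply Q (avg k \<omega>) - blinfun_apply Q e))" using avg_int by simp
        show "integrable M (\<lambda>\<omega>. E + (\<Sum>i<k. noise i v \<omega>))" using noise_int[OF v] by simp
        show "AE \<omega> in M. real k * (c + blinfun_apply Q (avg k \<omega>) - blinfun_apply Q e) \<le> E + (\<Sum>i<k. noise i v \<omega>)"
          using AE_good
        proof eventually_elim
          case (elim \<omega>)
          have "c + blinfun_apply Q (avg k \<omega>) - blinfun_apply Q e \<le> gap (avg k \<omega>) v"
            using minor[OF good_avg(1)[OF elim k]] by (simp only: blinfun.diff_right)
          then have "real k * (c + blinfun_apply Q (avg k \<omega>) - blinfun_apply Q e) \<le> real k * gap (avg k \<omega>) v"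
            using k0 by (intro mult_left_mono) auto
          also have "\<dots> \<le> E + (\<Sum>i<k. noise i v \<omega>)" unfolding E_def by (rule good_avg(2)[OF elim k v])
          finally show ?case .
        qed
      qed
      also have "\<dots> = E + (\<Sum>i<k. \<integral>\<omega>. noise i v \<omega> \<partial>M)" using noise_int[OF v] by (simp add: prob_space)
      also have "\<dots> \<le> E + K" using K[of k] by simp
      also have "(\<integral>\<omega>. real k * (c + blinfun_apply Q (avg k \<omega>) - blinfun_apply Q e) \<partial>M)
          = real k * (c + (\<integral>\<omega>. blinfun_apply Q (avg k \<omega>) \<partial>M) - blinfun_apply Q e)"
        using avg_int by (simp add: prob_space)
      finally show ?thesis using k0 by (simp only: pos_le_divide_eq mult.commute)
    qed
    have int: "(\<integral>\<omega>. blinfun_apply Q (winf \<omega>) \<partial>M) = blinfun_apply Q e"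
      using has_bochner_expectation_functional[OF e] by (rule has_bochner_integral_integral_eq)
    have "(\<lambda>j. c + (\<integral>\<omega>. blinfun_apply Q (avg (r j) \<omega>) \<partial>M) - blinfun_apply Q e) \<longlonglongrightarrow> c + blinfun_apply Q e - blinfun_apply Q e"
      using avg_lim[of Q] unfolding int by (intro tendsto_intros)
    then have L: "(\<lambda>j. c + (\<integral>\<omega>. blinfun_apply Q (avg (r j) \<omega>) \<partial>M) - blinfun_apply Q e) \<longlonglongrightarrow> c" by simp
    have "filterlim r sequentially sequentially" by (rule filterlim_subseq[OF r])
    then have "(\<lambda>j. (E + K) / real (r j)) \<longlonglongrightarrow> 0"
      by (rule filterlim_compose[OF lim_const_over_n[of "E + K"]])
    moreover have "\<forall>\<^sub>F j in sequentially. c + (\<integral>\<omega>. blinfun_apply Q (avg (r j) \<omega>) \<partial>M) - blinfun_apply Q e \<le> (E + K) / real (r j)"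
      using eventually_ge_at_top[of 1]
    proof eventually_elim
      case (elim j)
      have "j \<le> r j" by (rule seq_suble[OF r])
      then show ?case using elim by (intro bound) simp
    qed
    ultimately show "c \<le> 0" by (intro tendsto_le[OF _ _ L]) auto
  qed
  have "e \<in> feasible" using nonpos by (rule gap_nonpos_of_minorants(1)[OF closed_dom feasible_ne])
  moreover have "gap e v \<le> 0" if "v \<in> feasible" for v
    using nonpos that by (rule gap_nonpos_of_minorants(2)[OF closed_dom feasible_ne])
  ultimately have "saddle_point Lag e" by (rule saddle_pointI)
  with e show ?thesis by blast
qed

lemma avg_functional: "blinfun_apply (Q :: ('p \<times> 'd) \<Rightarrow>\<^sub>L real) (avg k \<omega>) = (\<Sum>i<k. blinfun_apply Q (w (Suc i) \<omega>)) / real k"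
  unfolding avg_eq by (simp add: blinfun.scaleR_right blinfun.sum_right)

lemma functional_measurable: "(\<lambda>\<omega>. blinfun_apply (Q :: ('p \<times> 'd) \<Rightarrow>\<^sub>L real) (w k \<omega>)) \<in> borel_measurable M"
  by (rule borel_measurable_pairing[OF strongly_measurable_const w_rv])

lemma avg_functional_measurable: "(\<lambda>\<omega>. blinfun_apply (Q :: ('p \<times> 'd) \<Rightarrow>\<^sub>L real) (avg k \<omega>)) \<in> borel_measurable M"
  unfolding avg_functional by (intro borel_measurable_divide borel_measurable_sum borel_measurable_const functional_measurable)

lemma avg_norm_sq_le: "(norm (avg k \<omega>))\<^sup>2 \<le> (\<Sum>i<k. (norm (w (Suc i) \<omega>))\<^sup>2) / real k"
proof (cases "k = 0")
  case False
  have "(norm (avg k \<omega>))\<^sup>2 \<le> ((\<Sum>i<k. norm (w (Suc i) \<omega>)) / real k)\<^sup>2"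
    unfolding avg_eq using norm_sum[of "\<lambda>i. w (Suc i) \<omega>" "{..<k}"]
    by (intro power_mono) (simp_all add: divide_right_mono)
  also have "\<dots> = (\<Sum>i<k. norm (w (Suc i) \<omega>))\<^sup>2 / (real k)\<^sup>2" by (rule power_divide)
  also have "\<dots> \<le> ((\<Sum>i<k. (norm (w (Suc i) \<omega>))\<^sup>2) * real k) / (real k)\<^sup>2"
    using sum_squared_le_sum_of_squares[of "\<lambda>i. norm (w (Suc i) \<omega>)" "{..<k}"] by (intro divide_right_mono) auto
  also have "\<dots> = (\<Sum>i<k. (norm (w (Suc i) \<omega>))\<^sup>2) / real k" using False by (simp add: power2_eq_square)
  finally show ?thesis .
qed (simp add: avg_eq)

text \<open>Iterates bounded in mean square: the averages are then bounded in mean square as well, so their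
  weak limit is integrable and the expectations of functionals converge.\<close>

lemma saddle_of_L2_bounded:
  fixes winf :: "'w \<Rightarrow> 'p \<times> 'd" and r :: "nat \<Rightarrow> nat"
  assumes r: "strict_mono r" and winf: "strongly_measurable M winf"
    and weak: "AE \<omega> in M. weakly_converges (\<lambda>j. avg (r j) \<omega>) (winf \<omega>)"
    and w2: "\<And>k. integrable M (\<lambda>\<omega>. (norm (w k \<omega>))\<^sup>2)" "\<And>k. (\<integral>\<omega>. (norm (w k \<omega>))\<^sup>2 \<partial>M) \<le> B"
    and noise_int: "\<And>i v. v \<in> feasible \<Longrightarrow> integrable M (noise i v)"
    and noise_bound: "\<And>v. v \<in> feasible \<Longrightarrow> \<exists>K. \<forall>k. (\<Sum>i<k. \<integral>\<omega>. noise i v \<omega> \<partial>M) \<le> K"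
  shows "\<exists>e. has_bochner_expectation M winf e \<and> saddle_point Lag e"
proof -
  have B: "0 \<le> B" by (rule order_trans[OF _ w2(2)[of 0]]) simp
  define A where "A k \<omega> = (\<Sum>i<k. (norm (w (Suc i) \<omega>))\<^sup>2) / real k" for k \<omega>
  have A0: "0 \<le> A k \<omega>" for k \<omega> by (simp add: A_def sum_nonneg)
  have Ai: "integrable M (A k)" for k unfolding A_def using w2(1) by simp
  have AB: "(\<integral>\<omega>. A k \<omega> \<partial>M) \<le> B" for k
  proof (cases "k = 0")
    case False
    have "(\<integral>\<omega>. A k \<omega> \<partial>M) = (\<Sum>i<k. \<integral>\<omega>. (norm (w (Suc i) \<omega>))\<^sup>2 \<partial>M) / real k" unfolding A_def using w2(1) by simp
    also have "\<dots> \<le> (\<Sum>i<k. B) / real k" using w2(2) by (intro divide_right_mono sum_mono) auto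
    finally show ?thesis using False by simp
  qed (simp add: A_def B)
  have Q2: "(blinfun_apply Q (avg k \<omega>))\<^sup>2 \<le> (norm Q)\<^sup>2 * A k \<omega>" for Q :: "('p \<times> 'd) \<Rightarrow>\<^sub>L real" and k \<omega>
  proof -
    have "\<bar>blinfun_apply Q (avg k \<omega>)\<bar>\<^sup>2 \<le> (norm Q * norm (avg k \<omega>))\<^sup>2"
      using norm_blinfun[of Q "avg k \<omega>"] by (intro power_mono) auto
    also have "\<dots> = (norm Q)\<^sup>2 * (norm (avg k \<omega>))\<^sup>2" by (rule power_mult_distrib)
    also have "\<dots> \<le> (norm Q)\<^sup>2 * A k \<omega>" unfolding A_def by (intro mult_left_mono avg_norm_sq_le) simp
    finally show ?thesis by simp
  qed
  note Qm = avg_functional_measurable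
  have Qi2: "integrable M (\<lambda>\<omega>. (blinfun_apply Q (avg k \<omega>))\<^sup>2)" for Q :: "('p \<times> 'd) \<Rightarrow>\<^sub>L real" and k
  proof (rule Bochner_Integration.integrable_bound)
    show "integrable M (\<lambda>\<omega>. (norm Q)\<^sup>2 * A k \<omega>)" using Ai by simp
    show "(\<lambda>\<omega>. (blinfun_apply Q (avg k \<omega>))\<^sup>2) \<in> borel_measurable M" by (intro borel_measurable_power Qm)
    show "AE \<omega> in M. norm ((blinfun_apply Q (avg k \<omega>))\<^sup>2) \<le> norm ((norm Q)\<^sup>2 * A k \<omega>)"
      using Q2 A0 by (intro AE_I2) simp
  qed
  have Qi: "integrable M (\<lambda>\<omega>. blinfun_apply Q (avg k \<omega>))" for Q :: "('p \<times> 'd) \<Rightarrow>\<^sub>L real" and k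
    by (rule square_integrable_imp_integrable[OF Qm Qi2])
  have QB: "(\<integral>\<omega>. (blinfun_apply Q (avg k \<omega>))\<^sup>2 \<partial>M) \<le> (norm Q)\<^sup>2 * B" for Q :: "('p \<times> 'd) \<Rightarrow>\<^sub>L real" and k
  proof -
    have "(\<integral>\<omega>. (blinfun_apply Q (avg k \<omega>))\<^sup>2 \<partial>M) \<le> (\<integral>\<omega>. (norm Q)\<^sup>2 * A k \<omega> \<partial>M)"
      using Ai by (intro integral_mono Qi2 Q2) auto
    also have "\<dots> = (norm Q)\<^sup>2 * (\<integral>\<omega>. A k \<omega> \<partial>M)" by simp
    also have "\<dots> \<le> (norm Q)\<^sup>2 * B" by (intro mult_left_mono AB) simp
    finally show ?thesis .
  qed
  have wm: "(\<lambda>\<omega>. norm (winf \<omega>)) \<in> borel_measurable M" by (rule borel_measurable_strong_norm[OF winf])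
  have lower: "AE \<omega> in M. ennreal ((norm (winf \<omega>))\<^sup>2) \<le> liminf (\<lambda>j. ennreal (A (r j) \<omega>))"
    using weak
  proof eventually_elim
    case (elim \<omega>)
    obtain p :: "('p \<times> 'd) \<Rightarrow>\<^sub>L real" where p: "norm p \<le> 1" "blinfun_apply p (winf \<omega>) = norm (winf \<omega>)"
      using norming_functional by blast
    have "(\<lambda>j. blinfun_apply p (avg (r j) \<omega>)) \<longlonglongrightarrow> norm (winf \<omega>)" using elim p(2) unfolding weakly_converges_def by metis
    then have "(\<lambda>j. ennreal ((blinfun_apply p (avg (r j) \<omega>))\<^sup>2)) \<longlonglongrightarrow> ennreal ((norm (winf \<omega>))\<^sup>2)"
      by (intro tendsto_ennrealI tendsto_power)
    then have "ennreal ((norm (winf \<omega>))\<^sup>2) = liminf (\<lambda>j. ennreal ((blinfun_apply p (avg (r j) \<omega>))\<^sup>2))"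
      by (intro lim_imp_Liminf[symmetric]) auto
    also have "\<dots> \<le> liminf (\<lambda>j. ennreal (A (r j) \<omega>))"
    proof (rule Liminf_mono, rule always_eventually, rule allI, rule ennreal_leI)
      fix j
      have "(norm p)\<^sup>2 * A (r j) \<omega> \<le> 1 * A (r j) \<omega>" using p(1) A0 by (intro mult_right_mono) (auto simp: power_le_one)
      then show "(blinfun_apply p (avg (r j) \<omega>))\<^sup>2 \<le> A (r j) \<omega>" using Q2[of p "r j" \<omega>] by simp
    qed
    finally show ?case .
  qed
  have Am: "A k \<in> borel_measurable M" for k using Ai by (rule borel_measurable_integrable)
  have "(\<integral>\<^sup>+\<omega>. ennreal ((norm (winf \<omega>))\<^sup>2) \<partial>M) \<le> (\<integral>\<^sup>+\<omega>. liminf (\<lambda>j. ennreal (A (r j) \<omega>)) \<partial>M)"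
    by (rule nn_integral_mono_AE[OF lower])
  also have "\<dots> \<le> liminf (\<lambda>j. \<integral>\<^sup>+\<omega>. ennreal (A (r j) \<omega>) \<partial>M)"
    by (rule nn_integral_liminf) (rule measurable_compose[OF Am measurable_ennreal])
  also have "\<dots> \<le> liminf (\<lambda>j :: nat. ennreal B)"
  proof (rule Liminf_mono, rule always_eventually, rule allI)
    fix j show "(\<integral>\<^sup>+\<omega>. ennreal (A (r j) \<omega>) \<partial>M) \<le> ennreal B"
      using AB[of "r j"] A0 by (subst nn_integral_eq_integral[OF Ai]) (auto intro: ennreal_leI)
  qed
  also have "\<dots> = ennreal B" by (simp add: Liminf_const)
  finally have "(\<integral>\<^sup>+\<omega>. ennreal ((norm (winf \<omega>))\<^sup>2) \<partial>M) < \<infinity>" by (rule order_le_less_trans) simp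
  then have "integrable M (\<lambda>\<omega>. (norm (winf \<omega>))\<^sup>2)" using wm by (intro integrableI_bounded) auto
  then have winf_int: "integrable M (\<lambda>\<omega>. norm (winf \<omega>))" by (rule square_integrable_imp_integrable[OF wm])
  show ?thesis
  proof (rule saddle_of_limit_expectation[OF r winf winf_int Qi _ noise_int noise_bound])
    fix Q :: "('p \<times> 'd) \<Rightarrow>\<^sub>L real"
    show "(\<lambda>j. \<integral>\<omega>. blinfun_apply Q (avg (r j) \<omega>) \<partial>M) \<longlonglongrightarrow> (\<integral>\<omega>. blinfun_apply Q (winf \<omega>) \<partial>M)"
    proof (rule integral_tendsto_of_L2_bounded[OF Qm _ _ Qi2 QB])
      show "(\<lambda>\<omega>. blinfun_apply Q (winf \<omega>)) \<in> borel_measurable M" by (rule borel_measurable_pairing[OF strongly_measurable_const winf])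
      show "AE \<omega> in M. (\<lambda>j. blinfun_apply Q (avg (r j) \<omega>)) \<longlonglongrightarrow> blinfun_apply Q (winf \<omega>)"
        using weak by eventually_elim (auto simp: weakly_converges_def)
    qed
  qed
qed

end

section \<open>The three noise regimes\<close>

context stochastic_primal_dual
begin

lemma good_resolvents:
  assumes "\<omega> \<in> good"
  shows "x (Suc k) \<omega> \<in> bregman_resolvent \<phi>p (lam k) g (primal_point f T \<phi>p (lam k) (\<delta>p k \<omega>) (x k \<omega>) (\<mu> k \<omega>))"
    "\<mu> (Suc k) \<omega> \<in> bregman_resolvent \<phi>d (nu k) (conjugate l) (dual_point (conjugate h) T \<phi>d (nu k) (\<delta>d k \<omega>) (x k \<omega>) (x (Suc k) \<omega>) (\<mu> k \<omega>))"
    "assumption_A1_step f g (conjugate h) (conjugate l) T \<phi>p \<phi>d (lam k) (nu k) (\<delta>p k \<omega>) (\<delta>d k \<omega>) (x k \<omega>) (\<mu> k \<omega>) (x (Suc k) \<omega>)"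
  using primal_dual_path.iterate_resolvent[OF good_path[OF assms], of k] primal_dual_path.resolvents[OF good_path[OF assms], of k]
  by simp_all

text \<open>Without noise the iteration is deterministic, because the resolvents are single-valued.\<close>

lemma noiseless_deterministic:
  assumes \<omega>: "\<omega> \<in> good" "\<And>k. \<delta>p k \<omega> = 0 \<and> \<delta>d k \<omega> = 0" and \<omega>': "\<omega>' \<in> good" "\<And>k. \<delta>p k \<omega>' = 0 \<and> \<delta>d k \<omega>' = 0"
  shows "w k \<omega> = w k \<omega>'"
proof (induction k)
  case 0 show ?case by (simp add: start)
next
  case (Suc k)
  then have eq: "x k \<omega> = x k \<omega>'" "\<mu> k \<omega> = \<mu> k \<omega>'" by simp_all
  have unique: "u = u'" if "resolvent_single \<phi> \<gamma> G \<zeta>" "u \<in> bregman_resolvent \<phi> \<gamma> G \<zeta>" "u' \<in> bregman_resolvent \<phi> \<gamma> G \<zeta>"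
    for \<phi> G :: "'a::real_normed_vector \<Rightarrow> ereal" and \<gamma> \<zeta> u u'
    using that by (auto simp: resolvent_single_def)
  have 1: "x (Suc k) \<omega> = x (Suc k) \<omega>'"
  proof (rule unique)
    show "resolvent_single \<phi>p (lam k) g (primal_point f T \<phi>p (lam k) 0 (x k \<omega>) (\<mu> k \<omega>))"
      using good_resolvents(3)[OF \<omega>(1), of k] by (simp add: assumption_A1_step_def)
    show "x (Suc k) \<omega> \<in> bregman_resolvent \<phi>p (lam k) g (primal_point f T \<phi>p (lam k) 0 (x k \<omega>) (\<mu> k \<omega>))"
      using good_resolvents(1)[OF \<omega>(1), of k] \<omega>(2)[of k] by simp
    show "x (Suc k) \<omega>' \<in> bregman_resolvent \<phi>p (lam k) g (primal_point f T \<phi>p (lam k) 0 (x k \<omega>) (\<mu> k \<omega>))"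
      using good_resolvents(1)[OF \<omega>'(1), of k] \<omega>'(2)[of k] by (simp add: eq)
  qed
  have 2: "\<mu> (Suc k) \<omega> = \<mu> (Suc k) \<omega>'"
  proof (rule unique)
    show "resolvent_single \<phi>d (nu k) (conjugate l) (dual_point (conjugate h) T \<phi>d (nu k) (\<delta>d k \<omega>) (x k \<omega>) (x (Suc k) \<omega>) (\<mu> k \<omega>))"
      using good_resolvents(3)[OF \<omega>(1), of k] by (simp add: assumption_A1_step_def)
    show "\<mu> (Suc k) \<omega> \<in> bregman_resolvent \<phi>d (nu k) (conjugate l) (dual_point (conjugate h) T \<phi>d (nu k) (\<delta>d k \<omega>) (x k \<omega>) (x (Suc k) \<omega>) (\<mu> k \<omega>))"
      by (rule good_resolvents(2)[OF \<omega>(1)])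
    show "\<mu> (Suc k) \<omega>' \<in> bregman_resolvent \<phi>d (nu k) (conjugate l) (dual_point (conjugate h) T \<phi>d (nu k) (\<delta>d k \<omega>) (x k \<omega>) (x (Suc k) \<omega>) (\<mu> k \<omega>))"
      using good_resolvents(2)[OF \<omega>'(1), of k] \<omega>(2)[of k] \<omega>'(2)[of k] by (simp add: eq 1)
  qed
  show ?case using 1 2 by simp
qed

text \<open>All good paths coincide, so the weak limit is almost surely constant, by uniqueness of weak limits.\<close>

lemma saddle_noiseless:
  fixes winf :: "'w \<Rightarrow> 'p \<times> 'd" and r :: "nat \<Rightarrow> nat"
  assumes r: "strict_mono r" and winf: "strongly_measurable M winf"
    and weak: "AE \<omega> in M. weakly_converges (\<lambda>j. avg (r j) \<omega>) (winf \<omega>)"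
    and zero: "AE \<omega> in M. \<forall>k. \<delta>p k \<omega> = 0 \<and> \<delta>d k \<omega> = 0"
  shows "\<exists>e. has_bochner_expectation M winf e \<and> saddle_point Lag e"
proof -
  define ok where "ok \<omega> \<longleftrightarrow> \<omega> \<in> good \<and> (\<forall>k. \<delta>p k \<omega> = 0 \<and> \<delta>d k \<omega> = 0) \<and> weakly_converges (\<lambda>j. avg (r j) \<omega>) (winf \<omega>)" for \<omega>
  have AE_ok: "AE \<omega> in M. ok \<omega>" using AE_good zero weak by eventually_elim (simp add: ok_def)
  have "\<exists>\<omega>0. ok \<omega>0"
  proof (rule ccontr)
    assume "\<not> ?thesis"
    then have "AE \<omega> in M. False" using AE_ok by simp
    then show False by (simp add: AE_False)
  qed
  then obtain \<omega>0 where \<omega>0: "ok \<omega>0" ..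
  have w_eq: "w k \<omega> = w k \<omega>0" if "ok \<omega>" for k \<omega>
    using that \<omega>0 unfolding ok_def by (intro noiseless_deterministic) auto
  have avg_same: "avg k \<omega> = avg k \<omega>0" if "ok \<omega>" for k \<omega>
    unfolding avg_eq by (intro arg_cong2[where f = scaleR] sum.cong refl w_eq that)
  have winf_same: "winf \<omega> = winf \<omega>0" if "ok \<omega>" for \<omega>
  proof (rule blinfun_separates)
    fix p :: "('p \<times> 'd) \<Rightarrow>\<^sub>L real"
    have "(\<lambda>j. blinfun_apply p (avg (r j) \<omega>0)) \<longlonglongrightarrow> blinfun_apply p (winf \<omega>)"
      using that avg_same[OF that] by (simp add: ok_def weakly_converges_def)
    moreover have "(\<lambda>j. blinfun_apply p (avg (r j) \<omega>0)) \<longlonglongrightarrow> blinfun_apply p (winf \<omega>0)"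
      using \<omega>0 by (simp add: ok_def weakly_converges_def)
    ultimately show "blinfun_apply p (winf \<omega>) = blinfun_apply p (winf \<omega>0)" by (rule LIMSEQ_unique)
  qed
  have const: "integrable M X \<and> (\<integral>\<omega>. X \<omega> \<partial>M) = c" if "X \<in> borel_measurable M" "\<And>\<omega>. ok \<omega> \<Longrightarrow> X \<omega> = c" for X :: "'w \<Rightarrow> real" and c
  proof -
    have ae: "AE \<omega> in M. X \<omega> = c" using AE_ok by eventually_elim (rule that(2))
    have "integrable M X" by (rule integrable_cong_AE_imp[of M "\<lambda>_. c"]) (use ae that in \<open>auto elim: eventually_mono\<close>)
    moreover have "(\<integral>\<omega>. X \<omega> \<partial>M) = (\<integral>\<omega>. c \<partial>M)" by (rule integral_cong_AE[OF that(1) _ ae]) simp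
    ultimately show ?thesis by (simp add: prob_space)
  qed
  have noise0: "integrable M (noise i v) \<and> (\<integral>\<omega>. noise i v \<omega> \<partial>M) = 0" for i v
    by (rule const[OF noise_measurable]) (simp add: ok_def noise_pairing_def)
  have avg_const: "integrable M (\<lambda>\<omega>. blinfun_apply Q (avg k \<omega>)) \<and> (\<integral>\<omega>. blinfun_apply Q (avg k \<omega>) \<partial>M) = blinfun_apply Q (avg k \<omega>0)"
    for Q :: "('p \<times> 'd) \<Rightarrow>\<^sub>L real" and k
    by (rule const[OF avg_functional_measurable]) (simp only: avg_same)
  show ?thesis
  proof (rule saddle_of_limit_expectation[OF r winf])
    show "integrable M (\<lambda>\<omega>. norm (winf \<omega>))"
      using const[OF borel_measurable_strong_norm[OF winf], of "norm (winf \<omega>0)"] winf_same by simp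
    fix Q :: "('p \<times> 'd) \<Rightarrow>\<^sub>L real"
    have "(\<integral>\<omega>. blinfun_apply Q (winf \<omega>) \<partial>M) = blinfun_apply Q (winf \<omega>0)"
      using const[OF borel_measurable_pairing[OF strongly_measurable_const winf], of Q "blinfun_apply Q (winf \<omega>0)"] winf_same by simp
    then show "(\<lambda>j. \<integral>\<omega>. blinfun_apply Q (avg (r j) \<omega>) \<partial>M) \<longlonglongrightarrow> (\<integral>\<omega>. blinfun_apply Q (winf \<omega>) \<partial>M)"
      using \<omega>0 avg_const by (simp add: ok_def weakly_converges_def)
  qed (use avg_const noise0 in auto)
qed

lemma summable_in_mean_bound:
  assumes "summable_in_mean M F N"
  shows "integrable M (N k)" "(\<Sum>i<k. \<integral>\<omega>. N i \<omega> \<partial>M) \<le> (\<Sum>i. \<integral>\<omega>. N i \<omega> \<partial>M)"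
  using assms by (auto simp: summable_in_mean_def ell1_plus_def intro!: sum_le_suminf)

text \<open>The iterates stay in the bounded set of admissible points, so each noise pairing is at most a constant
  times the norm of the noise.\<close>

lemma saddle_bounded:
  fixes winf :: "'w \<Rightarrow> 'p \<times> 'd" and r :: "nat \<Rightarrow> nat"
  assumes r: "strict_mono r" and winf: "strongly_measurable M winf"
    and weak: "AE \<omega> in M. weakly_converges (\<lambda>j. avg (r j) \<omega>) (winf \<omega>)"
    and Np: "summable_in_mean M F (\<lambda>k \<omega>. norm (\<delta>p k \<omega>))" and Nd: "summable_in_mean M F (\<lambda>k \<omega>. norm (\<delta>d k \<omega>))"
    and bd: "bounded admissible"
  shows "\<exists>e. has_bochner_expectation M winf e \<and> saddle_point Lag e"
proof -
  obtain R where R: "\<And>u. u \<in> admissible \<Longrightarrow> norm u \<le> R" using bd by (auto simp: bounded_iff)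
  have R0: "0 \<le> R" using R[OF start_adm] norm_ge_zero order_trans by blast
  have wR: "AE \<omega> in M. norm (w k \<omega>) \<le> R" for k using AE_good by eventually_elim (intro R good_admissible)
  have nb: "AE \<omega> in M. \<bar>noise i v \<omega>\<bar> \<le> (norm (\<delta>p i \<omega>) + norm (\<delta>d i \<omega>)) * (norm v + R)" for i v
    using wR[of "Suc i"]
  proof eventually_elim
    case (elim \<omega>)
    let ?u = "v - w (Suc i) \<omega>"
    have u: "norm ?u \<le> norm v + R" using norm_triangle_ineq4[of v "w (Suc i) \<omega>"] elim by linarith
    have "\<bar>noise i v \<omega>\<bar> \<le> \<bar>blinfun_apply (\<delta>p i \<omega>) (fst ?u)\<bar> + \<bar>blinfun_apply (\<delta>d i \<omega>) (snd ?u)\<bar>"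
      unfolding noise_pairing_def by (rule abs_triangle_ineq)
    also have "\<dots> \<le> norm (\<delta>p i \<omega>) * norm (fst ?u) + norm (\<delta>d i \<omega>) * norm (snd ?u)"
      using norm_blinfun[of "\<delta>p i \<omega>" "fst ?u"] norm_blinfun[of "\<delta>d i \<omega>" "snd ?u"] by (intro add_mono) (simp_all only: real_norm_def)
    also have "\<dots> \<le> norm (\<delta>p i \<omega>) * (norm v + R) + norm (\<delta>d i \<omega>) * (norm v + R)"
      by (intro add_mono mult_left_mono order_trans[OF norm_fst_le[of "fst ?u" "snd ?u", unfolded prod.collapse] u]
          order_trans[OF norm_snd_le[of "snd ?u" "fst ?u", unfolded prod.collapse] u] norm_ge_zero)
    finally show ?case by (simp only: distrib_right)
  qed
  have bi: "integrable M (\<lambda>\<omega>. (norm (\<delta>p i \<omega>) + norm (\<delta>d i \<omega>)) * (norm v + R))" for i v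
    using summable_in_mean_bound(1)[OF Np] summable_in_mean_bound(1)[OF Nd] by (intro integrable_mult_left) simp
  have ni: "integrable M (noise i v)" for i v
    by (rule Bochner_Integration.integrable_bound[OF bi noise_measurable]) (use nb[of i v] R0 in \<open>auto elim!: eventually_mono\<close>)
  define S where "S = (\<Sum>i. \<integral>\<omega>. norm (\<delta>p i \<omega>) \<partial>M) + (\<Sum>i. \<integral>\<omega>. norm (\<delta>d i \<omega>) \<partial>M)"
  have nK: "(\<Sum>i<k. \<integral>\<omega>. noise i v \<omega> \<partial>M) \<le> S * (norm v + R)" for k v
  proof -
    have "(\<Sum>i<k. \<integral>\<omega>. noise i v \<omega> \<partial>M) \<le> (\<Sum>i<k. ((\<integral>\<omega>. norm (\<delta>p i \<omega>) \<partial>M) + (\<integral>\<omega>. norm (\<delta>d i \<omega>) \<partial>M)) * (norm v + R))"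
    proof (rule sum_mono)
      fix i
      have "(\<integral>\<omega>. noise i v \<omega> \<partial>M) \<le> (\<integral>\<omega>. (norm (\<delta>p i \<omega>) + norm (\<delta>d i \<omega>)) * (norm v + R) \<partial>M)"
        by (rule integral_mono_AE[OF ni bi]) (use nb[of i v] in \<open>auto elim!: eventually_mono\<close>)
      also have "\<dots> = (\<integral>\<omega>. norm (\<delta>p i \<omega>) + norm (\<delta>d i \<omega>) \<partial>M) * (norm v + R)" by simp
      also have "(\<integral>\<omega>. norm (\<delta>p i \<omega>) + norm (\<delta>d i \<omega>) \<partial>M) = (\<integral>\<omega>. norm (\<delta>p i \<omega>) \<partial>M) + (\<integral>\<omega>. norm (\<delta>d i \<omega>) \<partial>M)"
        using summable_in_mean_bound(1)[OF Np] summable_in_mean_bound(1)[OF Nd] by (rule Bochner_Integration.integral_add)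
      finally show "(\<integral>\<omega>. noise i v \<omega> \<partial>M) \<le> ((\<integral>\<omega>. norm (\<delta>p i \<omega>) \<partial>M) + (\<integral>\<omega>. norm (\<delta>d i \<omega>) \<partial>M)) * (norm v + R)" .
    qed
    also have "\<dots> = ((\<Sum>i<k. \<integral>\<omega>. norm (\<delta>p i \<omega>) \<partial>M) + (\<Sum>i<k. \<integral>\<omega>. norm (\<delta>d i \<omega>) \<partial>M)) * (norm v + R)"
      by (simp only: sum_distrib_right[symmetric] sum.distrib)
    also have "\<dots> \<le> S * (norm v + R)"
      unfolding S_def using R0 by (intro mult_right_mono add_mono summable_in_mean_bound(2)[OF Np] summable_in_mean_bound(2)[OF Nd]) simp
    finally show ?thesis .
  qed
  have sq: "AE \<omega> in M. (norm (w k \<omega>))\<^sup>2 \<le> R\<^sup>2" for k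
    using wR[of k] by eventually_elim (intro power_mono norm_ge_zero)
  have w2: "integrable M (\<lambda>\<omega>. (norm (w k \<omega>))\<^sup>2)" for k
    by (rule Bochner_Integration.integrable_bound[of _ "\<lambda>_. R\<^sup>2"])
      (use sq[of k] borel_measurable_strong_norm[OF w_rv] in \<open>auto intro!: borel_measurable_power elim!: eventually_mono\<close>)
  have "(\<integral>\<omega>. (norm (w k \<omega>))\<^sup>2 \<partial>M) \<le> (\<integral>\<omega>. R\<^sup>2 \<partial>M)" for k by (rule integral_mono_AE[OF w2 _ sq]) simp
  then have "(\<integral>\<omega>. (norm (w k \<omega>))\<^sup>2 \<partial>M) \<le> R\<^sup>2" for k by (simp add: prob_space)
  from saddle_of_L2_bounded[OF r winf weak w2 this ni] nK show ?thesis by blast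
qed

text \<open>The step from the current iterate with the noise switched off.\<close>

definition xhat :: "nat \<Rightarrow> 'w \<Rightarrow> 'p" where
  "xhat k \<omega> = P.resolvent (lam k) (primal_point f T \<phi>p (lam k) 0 (x k \<omega>) (\<mu> k \<omega>))"

definition muhat :: "nat \<Rightarrow> 'w \<Rightarrow> 'd" where
  "muhat k \<omega> = D.resolvent (nu k) (dual_point (conjugate h) T \<phi>d (nu k) 0 (x k \<omega>) (xhat k \<omega>) (\<mu> k \<omega>))"

lemma good_single:
  assumes "\<omega> \<in> good"
  shows "resolvent_single \<phi>p (lam k) g (primal_point f T \<phi>p (lam k) 0 (x k \<omega>) (\<mu> k \<omega>))"
    "resolvent_single \<phi>d (nu k) (conjugate l) (dual_point (conjugate h) T \<phi>d (nu k) 0 (x k \<omega>) (xhat k \<omega>) (\<mu> k \<omega>))"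
proof -
  note A1 = good_resolvents(3)[OF assms, of k, unfolded assumption_A1_step_def]
  show 1: "resolvent_single \<phi>p (lam k) g (primal_point f T \<phi>p (lam k) 0 (x k \<omega>) (\<mu> k \<omega>))" using A1 by simp
  show "resolvent_single \<phi>d (nu k) (conjugate l) (dual_point (conjugate h) T \<phi>d (nu k) 0 (x k \<omega>) (xhat k \<omega>) (\<mu> k \<omega>))"
    unfolding xhat_def using A1 P.resolvent_in[OF 1] by blast
qed

text \<open>The noiseless successor \<open>(xhat k, muhat k)\<close> of the current iterate is determined by \<open>w k\<close>, but
  measurability has to be argued: the gradients are only demicontinuous, so strong measurability of the
  resolvent's argument comes from Pettis' theorem, and the Lipschitz resolvent preserves it.\<close>

lemma noiseless_step_measurable:
  assumes refl: "reflexive_space TYPE('p)" "reflexive_space TYPE('d)"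
    and \<sigma>: "0 < \<sigma>p" "0 < \<sigma>d"
    and Dp: "\<And>x y. ereal (\<sigma>p / 2 * (norm (x - y))\<^sup>2) \<le> bregman \<phi>p x y"
    and Dd: "\<And>x y. ereal (\<sigma>d / 2 * (norm (x - y))\<^sup>2) \<le> bregman \<phi>d x y"
  shows "strongly_measurable_on (history M w k) good (xhat k)" "strongly_measurable_on (history M w k) good (muhat k)"
proof -
  let ?F = "history M w k"
  have sub: "good \<subseteq> space ?F" using good_space by (simp add: space_history)
  have wF: "strongly_measurable_on ?F good (w k)"
    using strongly_measurable_subalgebra[OF w_rv measurable_history[OF order_refl, of w k M] space_history] sub
    by (auto simp: strongly_measurable_iff_on intro: strongly_measurable_on_subset)
  have xF: "strongly_measurable_on ?F good (x k)"
    using strongly_measurable_on_compose[OF wF, of fst] by (simp add: continuous_on_fst continuous_on_id)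
  have adm: "w k ` good \<subseteq> admissible" using good_admissible by blast
  have "strongly_measurable_on ?F good (\<lambda>\<omega>. primal_point f T \<phi>p (lam k) 0 (fst (w k \<omega>)) (snd (w k \<omega>)))"
  proof (rule demicontinuous_compose_strongly_measurable[OF refl(1) wF sub adm])
    fix u :: "nat \<Rightarrow> 'p \<times> 'd" and z v
    assume u: "\<And>n. u n \<in> admissible" and z: "z \<in> admissible" and lim: "u \<longlonglongrightarrow> z"
    have i: "\<And>n. fst (u n) \<in> interior (eff_dom \<phi>p)" "fst z \<in> interior (eff_dom \<phi>p)"
      using u z by (auto simp: mem_Times_iff intro: P.U_set_interior)
    show "(\<lambda>n. blinfun_apply (primal_point f T \<phi>p (lam k) 0 (fst (u n)) (snd (u n))) v)
        \<longlonglongrightarrow> blinfun_apply (primal_point f T \<phi>p (lam k) 0 (fst z) (snd z)) v"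
      unfolding primal_point_def blinfun.diff_left blinfun.scaleR_left blinfun.add_left blinfun_apply_adjoint_op
      by (intro tendsto_intros P.grad_demicontinuous_interior i lim)
  qed
  then have "strongly_measurable_on ?F good (\<lambda>\<omega>. primal_point f T \<phi>p (lam k) 0 (x k \<omega>) (\<mu> k \<omega>))" by simp
  then have "strongly_measurable_on ?F good (\<lambda>\<omega>. P.resolvent (lam k) (primal_point f T \<phi>p (lam k) 0 (x k \<omega>) (\<mu> k \<omega>)))"
    by (rule strongly_measurable_on_compose)
      (rule P.resolvent_continuous[OF \<sigma>(1) Dp less_imp_le[OF lam_pos]], use good_single(1) in blast)
  then show xh: "strongly_measurable_on ?F good (xhat k)" unfolding xhat_def .
  define A where "A z = grad \<phi>d (snd z) - nu k *\<^sub>R grad (conjugate h) (snd z)" for z :: "'p \<times> 'd"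
  have AF: "strongly_measurable_on ?F good (\<lambda>\<omega>. A (w k \<omega>))"
  proof (rule demicontinuous_compose_strongly_measurable[OF refl(2) wF sub adm])
    fix u :: "nat \<Rightarrow> 'p \<times> 'd" and z v
    assume u: "\<And>n. u n \<in> admissible" and z: "z \<in> admissible" and lim: "u \<longlonglongrightarrow> z"
    have i: "\<And>n. snd (u n) \<in> interior (eff_dom \<phi>d)" "snd z \<in> interior (eff_dom \<phi>d)"
      using u z by (auto simp: mem_Times_iff intro: D.U_set_interior)
    show "(\<lambda>n. blinfun_apply (A (u n)) v) \<longlonglongrightarrow> blinfun_apply (A z) v"
      unfolding A_def blinfun.diff_left blinfun.scaleR_left
      by (intro tendsto_intros D.grad_demicontinuous_interior i lim)
  qed
  let ?R = "\<lambda>z. fst z + nu k *\<^sub>R blinfun_apply T (2 *\<^sub>R snd (snd z) - fst (snd z))"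
  have "strongly_measurable_on ?F good (\<lambda>\<omega>. ?R (A (w k \<omega>), (x k \<omega>, xhat k \<omega>)))"
    by (rule strongly_measurable_on_compose[OF strongly_measurable_on_Pair[OF AF strongly_measurable_on_Pair[OF xF xh]], where R = ?R])
      (intro continuous_intros)
  moreover have "?R (A (w k \<omega>), (x k \<omega>, xhat k \<omega>)) = dual_point (conjugate h) T \<phi>d (nu k) 0 (x k \<omega>) (xhat k \<omega>) (\<mu> k \<omega>)" for \<omega>
    by (simp add: A_def dual_point_def algebra_simps)
  ultimately have "strongly_measurable_on ?F good (\<lambda>\<omega>. dual_point (conjugate h) T \<phi>d (nu k) 0 (x k \<omega>) (xhat k \<omega>) (\<mu> k \<omega>))" by simp
  then have "strongly_measurable_on ?F good (\<lambda>\<omega>. D.resolvent (nu k) (dual_point (conjugate h) T \<phi>d (nu k) 0 (x k \<omega>) (xhat k \<omega>) (\<mu> k \<omega>)))"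
    by (rule strongly_measurable_on_compose)
      (rule D.resolvent_continuous[OF \<sigma>(2) Dd less_imp_le[OF nu_pos]], use good_single(2) in blast)
  then show "strongly_measurable_on ?F good (muhat k)" unfolding muhat_def .
qed

text \<open>The noise enters the resolvent's argument additively, and the resolvent is Lipschitz; the dual
  argument also inherits the primal error through \<open>T\<close>.\<close>

lemma noiseless_step_close:
  assumes \<sigma>: "0 < \<sigma>p" "0 < \<sigma>d"
    and Dp: "\<And>x y. ereal (\<sigma>p / 2 * (norm (x - y))\<^sup>2) \<le> bregman \<phi>p x y"
    and Dd: "\<And>x y. ereal (\<sigma>d / 2 * (norm (x - y))\<^sup>2) \<le> bregman \<phi>d x y"
  obtains C where "0 \<le> C" "\<And>\<omega> k. \<omega> \<in> good \<Longrightarrow>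
    (norm ((xhat k \<omega>, muhat k \<omega>) - w (Suc k) \<omega>))\<^sup>2 \<le> C * ((norm (\<delta>p k \<omega>))\<^sup>2 + (norm (\<delta>d k \<omega>))\<^sup>2)"
proof -
  define cp cd where "cp = lam_inf / \<sigma>p" and "cd = nu_inf / \<sigma>d"
  have c: "0 \<le> cp" "0 \<le> cd" using \<sigma> lam_inf_pos nu_inf_pos by (auto simp: cp_def cd_def)
  define C where "C = cp\<^sup>2 + 8 * (cd * norm T * cp)\<^sup>2 + 2 * cd\<^sup>2"
  have "(norm ((xhat k \<omega>, muhat k \<omega>) - w (Suc k) \<omega>))\<^sup>2 \<le> C * ((norm (\<delta>p k \<omega>))\<^sup>2 + (norm (\<delta>d k \<omega>))\<^sup>2)" if \<omega>: "\<omega> \<in> good" for \<omega> k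
  proof -
    let ?a = "norm (\<delta>p k \<omega>)" and ?b = "norm (\<delta>d k \<omega>)"
    let ?x = "norm (xhat k \<omega> - x (Suc k) \<omega>)" and ?m = "norm (muhat k \<omega> - \<mu> (Suc k) \<omega>)"
    have "?x \<le> norm (primal_point f T \<phi>p (lam k) 0 (x k \<omega>) (\<mu> k \<omega>) - primal_point f T \<phi>p (lam k) (\<delta>p k \<omega>) (x k \<omega>) (\<mu> k \<omega>)) / \<sigma>p"
      unfolding xhat_def
      by (rule P.resolvent_lipschitz[OF \<sigma>(1) Dp less_imp_le[OF lam_pos] P.resolvent_in[OF good_single(1)[OF \<omega>]] good_resolvents(1)[OF \<omega>]])
    also have "primal_point f T \<phi>p (lam k) 0 (x k \<omega>) (\<mu> k \<omega>) - primal_point f T \<phi>p (lam k) (\<delta>p k \<omega>) (x k \<omega>) (\<mu> k \<omega>) = lam k *\<^sub>R \<delta>p k \<omega>"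
      by (simp add: primal_point_def algebra_simps)
    also have "norm (lam k *\<^sub>R \<delta>p k \<omega>) / \<sigma>p \<le> lam_inf * ?a / \<sigma>p"
      using lam_pos[of k] lam_le[of k] \<sigma> by (auto intro!: divide_right_mono mult_right_mono)
    finally have x: "?x \<le> cp * ?a" by (simp add: cp_def)
    have "?m \<le> norm (dual_point (conjugate h) T \<phi>d (nu k) 0 (x k \<omega>) (xhat k \<omega>) (\<mu> k \<omega>)
        - dual_point (conjugate h) T \<phi>d (nu k) (\<delta>d k \<omega>) (x k \<omega>) (x (Suc k) \<omega>) (\<mu> k \<omega>)) / \<sigma>d"
      unfolding muhat_def
      by (rule D.resolvent_lipschitz[OF \<sigma>(2) Dd less_imp_le[OF nu_pos] D.resolvent_in[OF good_single(2)[OF \<omega>]] good_resolvents(2)[OF \<omega>]])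
    also have "dual_point (conjugate h) T \<phi>d (nu k) 0 (x k \<omega>) (xhat k \<omega>) (\<mu> k \<omega>)
        - dual_point (conjugate h) T \<phi>d (nu k) (\<delta>d k \<omega>) (x k \<omega>) (x (Suc k) \<omega>) (\<mu> k \<omega>)
        = nu k *\<^sub>R (\<delta>d k \<omega> + blinfun_apply T (2 *\<^sub>R (xhat k \<omega> - x (Suc k) \<omega>)))"
      by (simp add: dual_point_def blinfun.diff_right blinfun.scaleR_right algebra_simps)
    also have "norm (nu k *\<^sub>R (\<delta>d k \<omega> + blinfun_apply T (2 *\<^sub>R (xhat k \<omega> - x (Suc k) \<omega>)))) / \<sigma>d \<le> nu_inf * (?b + 2 * norm T * (cp * ?a)) / \<sigma>d"
    proof -
      have "norm (\<delta>d k \<omega> + blinfun_apply T (2 *\<^sub>R (xhat k \<omega> - x (Suc k) \<omega>))) \<le> ?b + norm (blinfun_apply T (2 *\<^sub>R (xhat k \<omega> - x (Suc k) \<omega>)))"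
        by (rule norm_triangle_ineq)
      also have "\<dots> \<le> ?b + norm T * norm (2 *\<^sub>R (xhat k \<omega> - x (Suc k) \<omega>))" by (intro add_left_mono norm_blinfun)
      also have "\<dots> = ?b + 2 * norm T * ?x" by simp
      also have "\<dots> \<le> ?b + 2 * norm T * (cp * ?a)" by (intro add_left_mono mult_left_mono x) simp
      finally have "norm (nu k *\<^sub>R (\<delta>d k \<omega> + blinfun_apply T (2 *\<^sub>R (xhat k \<omega> - x (Suc k) \<omega>)))) \<le> nu_inf * (?b + 2 * norm T * (cp * ?a))"
        using nu_pos[of k] nu_le[of k] by (simp only: norm_scaleR) (intro mult_mono, auto)
      then show ?thesis using \<sigma>(2) by (intro divide_right_mono) auto
    qed
    finally have m: "?m \<le> cd * ?b + 2 * (cd * norm T * cp) * ?a" by (simp add: cd_def algebra_simps add_divide_distrib)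
    have "?x\<^sup>2 \<le> (cp * ?a)\<^sup>2" using x by (intro power_mono) auto
    moreover have "?m\<^sup>2 \<le> (cd * ?b + 2 * (cd * norm T * cp) * ?a)\<^sup>2" using m by (intro power_mono) auto
    moreover have "(p + q)\<^sup>2 \<le> 2 * p\<^sup>2 + 2 * q\<^sup>2" for p q :: real
    proof -
      have "0 \<le> (p - q)\<^sup>2" by simp
      then show ?thesis by (simp add: power2_sum power2_diff)
    qed
    ultimately have "?x\<^sup>2 + ?m\<^sup>2 \<le> (cp * ?a)\<^sup>2 + (2 * (cd * ?b)\<^sup>2 + 2 * (2 * (cd * norm T * cp) * ?a)\<^sup>2)"
      by (meson add_mono order_trans)
    also have "\<dots> = (cp\<^sup>2 + 8 * (cd * norm T * cp)\<^sup>2) * ?a\<^sup>2 + 2 * cd\<^sup>2 * ?b\<^sup>2" by (simp add: power_mult_distrib algebra_simps)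
    also have "\<dots> \<le> C * ?a\<^sup>2 + C * ?b\<^sup>2" by (intro add_mono mult_right_mono) (auto simp: C_def)
    finally show ?thesis by (simp add: norm_prod_def distrib_left)
  qed
  then show thesis by (intro that[of C]) (auto simp: C_def)
qed

end

context stochastic_primal_dual
begin

text \<open>The pairing of the noise with \<open>v - w (Suc k)\<close> is split at the noiseless successor of \<open>w k\<close>. The first
  part has mean zero, because the noise is conditionally centered and the noiseless successor is
  determined by the past; the second part is quadratic in the noise because the two successors differ by
  at most a multiple of the noise. Hence the expected noise terms are summable for every \<open>v\<close>. For a
  saddle point \<open>e0\<close> the gaps are nonnegative, so the energy relative to \<open>e0\<close>, which dominates the squared
  distance, stays bounded in mean.\<close>

lemma saddle_strongly_convex:
  fixes winf :: "'w \<Rightarrow> 'p \<times> 'd" and r :: "nat \<Rightarrow> nat"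
  assumes r: "strict_mono r" and winf: "strongly_measurable M winf"
    and weak: "AE \<omega> in M. weakly_converges (\<lambda>j. avg (r j) \<omega>) (winf \<omega>)"
    and reflexive: "reflexive_space TYPE('p)" "reflexive_space TYPE('d)"
    and saddle: "saddle_point Lag e0"
    and centered: "\<And>k. is_cond_expectation M (history M w k) (\<delta>p k) (\<lambda>_. 0)"
      "\<And>k. is_cond_expectation M (history M w k) (\<delta>d k) (\<lambda>_. 0)"
    and \<sigma>: "0 < \<sigma>p" "0 < \<sigma>d"
    and Dp: "\<And>x y. ereal (\<sigma>p / 2 * (norm (x - y))\<^sup>2) \<le> bregman \<phi>p x y"
    and Dd: "\<And>x y. ereal (\<sigma>d / 2 * (norm (x - y))\<^sup>2) \<le> bregman \<phi>d x y"
    and small: "ereal (nu_inf * lam_inf) < ereal (\<sigma>p * \<sigma>d) / ereal ((norm T)\<^sup>2)"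
    and Np: "summable_in_mean M F (\<lambda>k \<omega>. (norm (\<delta>p k \<omega>))\<^sup>2)" and Nd: "summable_in_mean M F (\<lambda>k \<omega>. (norm (\<delta>d k \<omega>))\<^sup>2)"
  shows "\<exists>e. has_bochner_expectation M winf e \<and> saddle_point Lag e"
proof -
  define N where "N k \<omega> = (norm (\<delta>p k \<omega>))\<^sup>2 + (norm (\<delta>d k \<omega>))\<^sup>2" for k \<omega>
  note dp2 = summable_in_mean_bound(1)[OF Np] and dd2 = summable_in_mean_bound(1)[OF Nd]
  have N0: "0 \<le> N k \<omega>" for k \<omega> by (simp add: N_def)
  have Ni: "integrable M (N k)" for k unfolding N_def using dp2 dd2 by (rule Bochner_Integration.integrable_add)
  define S where "S = (\<Sum>i. \<integral>\<omega>. (norm (\<delta>p i \<omega>))\<^sup>2 \<partial>M) + (\<Sum>i. \<integral>\<omega>. (norm (\<delta>d i \<omega>))\<^sup>2 \<partial>M)"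
  have NS: "(\<Sum>i<k. \<integral>\<omega>. N i \<omega> \<partial>M) \<le> S" for k
  proof -
    have "(\<Sum>i<k. \<integral>\<omega>. N i \<omega> \<partial>M) = (\<Sum>i<k. (\<integral>\<omega>. (norm (\<delta>p i \<omega>))\<^sup>2 \<partial>M) + (\<integral>\<omega>. (norm (\<delta>d i \<omega>))\<^sup>2 \<partial>M))"
      unfolding N_def by (intro sum.cong refl Bochner_Integration.integral_add dp2 dd2)
    also have "\<dots> \<le> S" unfolding S_def sum.distrib by (intro add_mono summable_in_mean_bound(2)[OF Np] summable_in_mean_bound(2)[OF Nd])
    finally show ?thesis .
  qed
  obtain c where c: "0 < c" "\<And>k v u. v \<in> feasible \<Longrightarrow> u \<in> admissible \<Longrightarrow> c * (norm (v - u))\<^sup>2 \<le> energy k v u"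
    using energy_quadratic_lower_bound[OF \<sigma> Dp Dd small] by metis
  obtain C where C: "0 \<le> C" "\<And>\<omega> k. \<omega> \<in> good \<Longrightarrow> (norm ((xhat k \<omega>, muhat k \<omega>) - w (Suc k) \<omega>))\<^sup>2 \<le> C * N k \<omega>"
    using noiseless_step_close[OF \<sigma> Dp Dd] unfolding N_def by metis
  note e0 = saddle_pointD[OF saddle feasible_ne]
  define E where "E = energy 0 e0 (x0, \<mu>0)"
  define a where "a k \<omega> = (norm (e0 - w k \<omega>))\<^sup>2" for k \<omega>
  have a0: "0 \<le> a k \<omega>" for k \<omega> by (simp add: a_def)
  have am: "a k \<in> borel_measurable M" for k
    unfolding a_def by (intro borel_measurable_power borel_measurable_norm_diff strongly_measurable_const w_rv)
  have energy: "c * a k \<omega> \<le> E + (\<Sum>i<k. noise i e0 \<omega>)" if \<omega>: "\<omega> \<in> good" for k \<omega>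
  proof -
    have "(\<Sum>i<k. gap (w (Suc i) \<omega>) e0) + energy k e0 (w k \<omega>) \<le> E + (\<Sum>i<k. noise i e0 \<omega>)"
      using primal_dual_path.energy_telescope[OF good_path[OF \<omega>] e0(1), of k] unfolding E_def start .
    moreover have "0 \<le> (\<Sum>i<k. gap (w (Suc i) \<omega>) e0)"
      by (intro sum_nonneg e0(2) admissible_feasible good_admissible \<omega>)
    moreover have "c * a k \<omega> \<le> energy k e0 (w k \<omega>)" unfolding a_def by (intro c e0 good_admissible \<omega>)
    ultimately show ?thesis by linarith
  qed
  have noise_le: "\<bar>noise i v \<omega>\<bar> \<le> N i \<omega> / (2 * t) + t / 2 * (norm (v - w (Suc i) \<omega>))\<^sup>2" if "0 < t" for i v t \<omega>
    unfolding N_def by (rule noise_pairing_le[OF that])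
  have noise_int0: "integrable M (noise i e0)" if "integrable M (a (Suc i))" for i
  proof (rule Bochner_Integration.integrable_bound[OF _ noise_measurable])
    show "integrable M (\<lambda>\<omega>. N i \<omega> / (2 * 1) + 1 / 2 * a (Suc i) \<omega>)" using Ni that by simp
    show "AE \<omega> in M. norm (noise i e0 \<omega>) \<le> norm (N i \<omega> / (2 * 1) + 1 / 2 * a (Suc i) \<omega>)"
      unfolding a_def real_norm_def by (rule AE_I2, rule order_trans[OF noise_le abs_ge_self]) simp
  qed
  (* Absorbing the last noise term into the left-hand side gives square integrability of one more iterate. *)
  have ai: "integrable M (a k)" for k
  proof (induction k rule: less_induct)
    case (less k)
    show ?case
    proof (cases k)
      case 0
      then show ?thesis by (simp add: a_def start)
    next
      case (Suc m)
      let ?R = "\<lambda>\<omega>. 2 / c * (E + (\<Sum>i<m. noise i e0 \<omega>) + N m \<omega> / (2 * c))"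
      have "integrable M (noise i e0)" if "i < m" for i using that Suc by (intro noise_int0 less.IH) simp
      then have Ri: "integrable M ?R"
        using Ni by (intro integrable_mult_right Bochner_Integration.integrable_add integrable_const
            Bochner_Integration.integrable_sum integrable_divide) auto
      have "AE \<omega> in M. norm (a k \<omega>) \<le> norm (?R \<omega>)"
        using AE_good
      proof eventually_elim
        case (elim \<omega>)
        have "c * a k \<omega> \<le> E + (\<Sum>i<m. noise i e0 \<omega>) + noise m e0 \<omega>" using energy[OF elim, of k] Suc by simp
        moreover have "\<bar>noise m e0 \<omega>\<bar> \<le> N m \<omega> / (2 * c) + c / 2 * (norm (e0 - w (Suc m) \<omega>))\<^sup>2"
          by (rule noise_le[OF c(1)])
        then have "noise m e0 \<omega> \<le> N m \<omega> / (2 * c) + c / 2 * a k \<omega>" unfolding a_def Suc by linarith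
        ultimately have "c / 2 * a k \<omega> \<le> E + (\<Sum>i<m. noise i e0 \<omega>) + N m \<omega> / (2 * c)" by simp
        then have "2 / c * (c / 2 * a k \<omega>) \<le> ?R \<omega>" using c(1) by (intro mult_left_mono) auto
        then have "a k \<omega> \<le> ?R \<omega>" using c(1) by simp
        then show ?case using a0[of k \<omega>] by (simp only: real_norm_def)
      qed
      then show ?thesis by (rule Bochner_Integration.integrable_bound[OF Ri am])
    qed
  qed
  have sq_add: "(norm (u + v))\<^sup>2 \<le> 2 * (norm u)\<^sup>2 + 2 * (norm v)\<^sup>2" for u v :: "'b::real_normed_vector"
  proof -
    have "(norm (u + v))\<^sup>2 \<le> (norm u + norm v)\<^sup>2" by (intro power_mono norm_triangle_ineq) simp
    also have "\<dots> \<le> 2 * (norm u)\<^sup>2 + 2 * (norm v)\<^sup>2"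
    proof -
      have "0 \<le> (norm u - norm v)\<^sup>2" by simp
      then show ?thesis by (simp add: power2_sum power2_diff)
    qed
    finally show ?thesis .
  qed
  have vi: "integrable M (\<lambda>\<omega>. (norm (v - w k \<omega>))\<^sup>2)" for v k
  proof (rule Bochner_Integration.integrable_bound)
    show "integrable M (\<lambda>\<omega>. 2 * (norm (v - e0))\<^sup>2 + 2 * a k \<omega>)" using ai by simp
    show "(\<lambda>\<omega>. (norm (v - w k \<omega>))\<^sup>2) \<in> borel_measurable M"
      by (intro borel_measurable_power borel_measurable_norm_diff strongly_measurable_const w_rv)
    show "AE \<omega> in M. norm ((norm (v - w k \<omega>))\<^sup>2) \<le> norm (2 * (norm (v - e0))\<^sup>2 + 2 * a k \<omega>)"
    proof (rule AE_I2)
      fix \<omega>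
      have "(norm ((v - e0) + (e0 - w k \<omega>)))\<^sup>2 \<le> 2 * (norm (v - e0))\<^sup>2 + 2 * a k \<omega>" unfolding a_def by (rule sq_add)
      moreover have "(v - e0) + (e0 - w k \<omega>) = v - w k \<omega>" by (simp only: add_diff_eq diff_add_cancel)
      ultimately show "norm ((norm (v - w k \<omega>))\<^sup>2) \<le> norm (2 * (norm (v - e0))\<^sup>2 + 2 * a k \<omega>)" using a0[of k \<omega>] by simp
    qed
  qed
  have noise_int: "integrable M (noise i v)" for i v
  proof (rule Bochner_Integration.integrable_bound[OF _ noise_measurable])
    show "integrable M (\<lambda>\<omega>. N i \<omega> / (2 * 1) + 1 / 2 * (norm (v - w (Suc i) \<omega>))\<^sup>2)" using Ni vi by simp
    show "AE \<omega> in M. norm (noise i v \<omega>) \<le> norm (N i \<omega> / (2 * 1) + 1 / 2 * (norm (v - w (Suc i) \<omega>))\<^sup>2)"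
      unfolding real_norm_def by (rule AE_I2, rule order_trans[OF noise_le abs_ge_self]) simp
  qed
  have noise_mean: "(\<integral>\<omega>. noise k v \<omega> \<partial>M) \<le> (1 + C) / 2 * (\<integral>\<omega>. N k \<omega> \<partial>M)" for k v
  proof -
    let ?F = "history M w k"
    have sub: "sets ?F \<subseteq> sets M" "space ?F = space M"
      by (intro history_subalgebra strongly_measurable_borel w_rv) (rule space_history)
    have gs: "good \<subseteq> space ?F" using good_space sub by simp
    note meas = noiseless_step_measurable[OF reflexive \<sigma> Dp Dd, of k]
    (* The noiseless successor of w k, extended beyond the good outcomes to a variable measurable in the past. *)
    obtain y where y: "strongly_measurable ?F y" "\<And>\<omega>. \<omega> \<in> good \<Longrightarrow> y \<omega> = (xhat k \<omega>, muhat k \<omega>)"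
      using strongly_measurable_on_extend[OF strongly_measurable_on_Pair[OF meas] gs] by blast
    have y1: "strongly_measurable ?F (\<lambda>\<omega>. fst v - fst (y \<omega>))"
      by (rule strongly_measurable_compose[OF y(1), where R = "\<lambda>z. fst v - fst z"]) (intro continuous_intros)
    have y2: "strongly_measurable ?F (\<lambda>\<omega>. snd v - snd (y \<omega>))"
      by (rule strongly_measurable_compose[OF y(1), where R = "\<lambda>z. snd v - snd z"]) (intro continuous_intros)
    have close: "(norm (y \<omega> - w (Suc k) \<omega>))\<^sup>2 \<le> C * N k \<omega>" if "\<omega> \<in> good" for \<omega>
      using C(2)[OF that, of k] y(2)[OF that] by simp
    let ?B = "\<lambda>\<omega>. N k \<omega> + 1 + 2 * (norm (v - w (Suc k) \<omega>))\<^sup>2 + 2 * (C * N k \<omega>)"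
    have Bi: "integrable M ?B" using Ni vi by simp
    have dom: "norm d * (norm q + 1) \<le> ?B \<omega>" if \<omega>: "\<omega> \<in> good" and d: "(norm d)\<^sup>2 \<le> N k \<omega>" and q: "norm q \<le> norm (v - y \<omega>)"
      for \<omega> and d :: "'b::real_normed_vector" and q :: "'c::real_normed_vector"
    proof -
      have "(norm ((v - w (Suc k) \<omega>) + (w (Suc k) \<omega> - y \<omega>)))\<^sup>2 \<le> 2 * (norm (v - w (Suc k) \<omega>))\<^sup>2 + 2 * (norm (w (Suc k) \<omega> - y \<omega>))\<^sup>2"
        by (rule sq_add)
      also have "(v - w (Suc k) \<omega>) + (w (Suc k) \<omega> - y \<omega>) = v - y \<omega>" by (simp only: add_diff_eq diff_add_cancel)
      finally have vy: "(norm (v - y \<omega>))\<^sup>2 \<le> 2 * (norm (v - w (Suc k) \<omega>))\<^sup>2 + 2 * (C * N k \<omega>)"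
        using close[OF \<omega>] by (simp only: norm_minus_commute[of "w (Suc k) \<omega>"])
      have q2: "(norm q)\<^sup>2 \<le> (norm (v - y \<omega>))\<^sup>2" using q by (intro power_mono) auto
      have "norm d * (norm q + 1) \<le> (norm d)\<^sup>2 + (norm q)\<^sup>2 + 1"
      proof -
        have "0 \<le> (norm d - norm q)\<^sup>2" "0 \<le> (norm d - 1)\<^sup>2" by simp_all
        then have "2 * (norm d * norm q) \<le> (norm d)\<^sup>2 + (norm q)\<^sup>2" "2 * norm d \<le> (norm d)\<^sup>2 + 1" by (simp_all add: power2_diff)
        moreover have "0 \<le> (norm q)\<^sup>2" by simp
        ultimately show ?thesis unfolding distrib_left by linarith
      qed
      then show ?thesis using d q2 vy by linarith
    qed
    have c1: "integrable M (\<lambda>\<omega>. norm (\<delta>p k \<omega>) * (norm (fst v - fst (y \<omega>)) + 1))"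
    proof (rule Bochner_Integration.integrable_bound[OF Bi])
      show "(\<lambda>\<omega>. norm (\<delta>p k \<omega>) * (norm (fst v - fst (y \<omega>)) + 1)) \<in> borel_measurable M"
        by (intro borel_measurable_times borel_measurable_add borel_measurable_const borel_measurable_strong_norm noise_rv strongly_measurable_mono[OF y1 sub])
      show "AE \<omega> in M. norm (norm (\<delta>p k \<omega>) * (norm (fst v - fst (y \<omega>)) + 1)) \<le> norm (?B \<omega>)"
        using AE_good
      proof eventually_elim
        case (elim \<omega>)
        have "norm (fst (v - y \<omega>)) \<le> norm (v - y \<omega>)"
          using norm_fst_le[of "fst (v - y \<omega>)" "snd (v - y \<omega>)"] by (simp only: prod.collapse)
        then have "norm (\<delta>p k \<omega>) * (norm (fst v - fst (y \<omega>)) + 1) \<le> ?B \<omega>"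
          unfolding fst_diff by (intro dom[OF elim]) (simp_all add: N_def)
        then show ?case unfolding real_norm_def abs_mult abs_norm_cancel
          by (intro order_trans[OF _ abs_ge_self]) (simp add: abs_of_nonneg)
      qed
    qed
    have c2: "integrable M (\<lambda>\<omega>. norm (\<delta>d k \<omega>) * (norm (snd v - snd (y \<omega>)) + 1))"
    proof (rule Bochner_Integration.integrable_bound[OF Bi])
      show "(\<lambda>\<omega>. norm (\<delta>d k \<omega>) * (norm (snd v - snd (y \<omega>)) + 1)) \<in> borel_measurable M"
        by (intro borel_measurable_times borel_measurable_add borel_measurable_const borel_measurable_strong_norm noise_rv strongly_measurable_mono[OF y2 sub])
      show "AE \<omega> in M. norm (norm (\<delta>d k \<omega>) * (norm (snd v - snd (y \<omega>)) + 1)) \<le> norm (?B \<omega>)"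
        using AE_good
      proof eventually_elim
        case (elim \<omega>)
        have "norm (snd (v - y \<omega>)) \<le> norm (v - y \<omega>)"
          using norm_snd_le[of "snd (v - y \<omega>)" "fst (v - y \<omega>)"] by (simp only: prod.collapse)
        then have "norm (\<delta>d k \<omega>) * (norm (snd v - snd (y \<omega>)) + 1) \<le> ?B \<omega>"
          unfolding snd_diff by (intro dom[OF elim]) (simp_all add: N_def)
        then show ?case unfolding real_norm_def abs_mult abs_norm_cancel
          by (intro order_trans[OF _ abs_ge_self]) (simp add: abs_of_nonneg)
      qed
    qed
    note z1 = centered_noise_pairing[OF centered(1) sub y1 c1] and z2 = centered_noise_pairing[OF centered(2) sub y2 c2]
    let ?Z = "\<lambda>\<omega>. blinfun_apply (\<delta>p k \<omega>) (fst v - fst (y \<omega>)) + blinfun_apply (\<delta>d k \<omega>) (snd v - snd (y \<omega>))"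
    have "(\<integral>\<omega>. noise k v \<omega> \<partial>M) \<le> (\<integral>\<omega>. ?Z \<omega> + (1 + C) / 2 * N k \<omega> \<partial>M)"
    proof (rule integral_mono_AE[OF noise_int])
      show "integrable M (\<lambda>\<omega>. ?Z \<omega> + (1 + C) / 2 * N k \<omega>)" using z1(1) z2(1) Ni by simp
      show "AE \<omega> in M. noise k v \<omega> \<le> ?Z \<omega> + (1 + C) / 2 * N k \<omega>"
        using AE_good
      proof eventually_elim
        case (elim \<omega>)
        have "noise k v \<omega> = ?Z \<omega> + noise_pairing (\<delta>p k \<omega>) (\<delta>d k \<omega>) (y \<omega> - w (Suc k) \<omega>)"
          by (simp add: noise_pairing_def blinfun.diff_right)
        moreover have "\<bar>noise_pairing (\<delta>p k \<omega>) (\<delta>d k \<omega>) (y \<omega> - w (Suc k) \<omega>)\<bar> \<le> N k \<omega> / (2 * 1) + 1 / 2 * (norm (y \<omega> - w (Suc k) \<omega>))\<^sup>2"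
          unfolding N_def by (rule noise_pairing_le) simp
        moreover have "(1 + C) / 2 * N k \<omega> = N k \<omega> / 2 + (C * N k \<omega>) / 2" by (simp add: field_simps)
        ultimately show ?case using close[OF elim] by linarith
      qed
    qed
    also have "\<dots> = (1 + C) / 2 * (\<integral>\<omega>. N k \<omega> \<partial>M)" using z1 z2 Ni by simp
    finally show ?thesis .
  qed
  have noise_sum: "(\<Sum>i<k. \<integral>\<omega>. noise i v \<omega> \<partial>M) \<le> (1 + C) / 2 * S" for k v
  proof -
    have "(\<Sum>i<k. \<integral>\<omega>. noise i v \<omega> \<partial>M) \<le> (\<Sum>i<k. (1 + C) / 2 * (\<integral>\<omega>. N i \<omega> \<partial>M))" by (intro sum_mono noise_mean)
    also have "\<dots> = (1 + C) / 2 * (\<Sum>i<k. \<integral>\<omega>. N i \<omega> \<partial>M)" by (rule sum_distrib_left[symmetric])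
    also have "\<dots> \<le> (1 + C) / 2 * S" using C(1) by (intro mult_left_mono NS) simp
    finally show ?thesis .
  qed
  have aB: "(\<integral>\<omega>. a k \<omega> \<partial>M) \<le> (E + (1 + C) / 2 * S) / c" for k
  proof -
    have "(\<integral>\<omega>. c * a k \<omega> \<partial>M) \<le> (\<integral>\<omega>. E + (\<Sum>i<k. noise i e0 \<omega>) \<partial>M)"
      using ai noise_int by (intro integral_mono_AE) (auto intro: eventually_mono[OF AE_good energy])
    also have "\<dots> = E + (\<Sum>i<k. \<integral>\<omega>. noise i e0 \<omega> \<partial>M)" using noise_int by (simp add: prob_space)
    also have "\<dots> \<le> E + (1 + C) / 2 * S" using noise_sum by simp
    finally have "c * (\<integral>\<omega>. a k \<omega> \<partial>M) \<le> E + (1 + C) / 2 * S" by simp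
    then show ?thesis using c(1) by (simp only: pos_le_divide_eq mult.commute)
  qed
  have w2: "integrable M (\<lambda>\<omega>. (norm (w k \<omega>))\<^sup>2)" for k using vi[of 0 k] by (simp only: diff_0 norm_minus_cancel)
  have "(\<integral>\<omega>. (norm (w k \<omega>))\<^sup>2 \<partial>M) \<le> 2 * (norm e0)\<^sup>2 + 2 * ((E + (1 + C) / 2 * S) / c)" for k
  proof -
    have "(\<integral>\<omega>. (norm (w k \<omega>))\<^sup>2 \<partial>M) \<le> (\<integral>\<omega>. 2 * (norm e0)\<^sup>2 + 2 * a k \<omega> \<partial>M)"
    proof (rule integral_mono[OF w2])
      show "integrable M (\<lambda>\<omega>. 2 * (norm e0)\<^sup>2 + 2 * a k \<omega>)" using ai by simp
      fix \<omega>
      have "(norm (e0 + - (e0 - w k \<omega>)))\<^sup>2 \<le> 2 * (norm e0)\<^sup>2 + 2 * (norm (- (e0 - w k \<omega>)))\<^sup>2" by (rule sq_add)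
      moreover have "e0 + - (e0 - w k \<omega>) = w k \<omega>" by (simp only: minus_diff_eq add_diff_eq add_diff_cancel_left')
      ultimately show "(norm (w k \<omega>))\<^sup>2 \<le> 2 * (norm e0)\<^sup>2 + 2 * a k \<omega>" by (simp only: a_def norm_minus_cancel)
    qed
    also have "\<dots> = 2 * (norm e0)\<^sup>2 + 2 * (\<integral>\<omega>. a k \<omega> \<partial>M)" using ai by (simp add: prob_space)
    finally show ?thesis using aB[of k] by linarith
  qed
  from saddle_of_L2_bounded[OF r winf weak w2 this noise_int] noise_sum show ?thesis by blast
qed

end

section \<open>Ergodic convergence of the stochastic Bregman primal-dual method\<close>

theorem theorem4p1:
  fixes M :: "'w measure"
    and Cp :: "'p::banach set" and Cd :: "'d::banach set"
    and f g \<phi>p :: "'p \<Rightarrow> ereal" and \<phi>d :: "'d \<Rightarrow> ereal"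
    and h l :: "('d \<Rightarrow>\<^sub>L real) \<Rightarrow> ereal"
    and T :: "'p \<Rightarrow>\<^sub>L 'd \<Rightarrow>\<^sub>L real"
    and Lp Ld lam_inf nu_inf :: real and lam nu :: "nat \<Rightarrow> real"
    and \<delta>p :: "nat \<Rightarrow> 'w \<Rightarrow> ('p \<Rightarrow>\<^sub>L real)" and \<delta>d :: "nat \<Rightarrow> 'w \<Rightarrow> ('d \<Rightarrow>\<^sub>L real)"
    and x :: "nat \<Rightarrow> 'w \<Rightarrow> 'p" and \<mu> :: "nat \<Rightarrow> 'w \<Rightarrow> 'd"
    and x0 :: 'p and \<mu>0 :: 'd
    and F :: "nat \<Rightarrow> 'w measure"
  assumes prob: "prob_space M"
    and H: "hypothesis_H Cp Cd f g h l T"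
    and noise_rv: "\<forall>k. strongly_measurable M (\<delta>p k) \<and> strongly_measurable M (\<delta>d k)"
    and iterate_rv: "\<forall>k. strongly_measurable M (x k) \<and> strongly_measurable M (\<mu> k)"
    and F: "F = history M (\<lambda>k \<omega>. (x k \<omega>, \<mu> k \<omega>))"
    and init: "x0 \<in> U_set \<phi>p g" "\<mu>0 \<in> U_set \<phi>d (conjugate l)"
      "\<forall>\<omega>. x 0 \<omega> = x0 \<and> \<mu> 0 \<omega> = \<mu>0"
    and algorithm: "AE \<omega> in M. \<forall>k.
      is_arg_min (primal_objective f g T \<phi>p (lam k) (\<delta>p k \<omega>) (x k \<omega>) (\<mu> k \<omega>))
        (\<lambda>y. y \<in> Cp) (x (Suc k) \<omega>) \<and>
      is_arg_min (dual_objective (conjugate h) (conjugate l) T \<phi>d (nu k) (\<delta>d k \<omega>)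
          (x k \<omega>) (x (Suc k) \<omega>) (\<mu> k \<omega>))
        (\<lambda>\<eta>. \<eta> \<in> Cd) (\<mu> (Suc k) \<omega>)"
    and A1: "assumption_A1_static Cp Cd f (conjugate h) \<phi>p \<phi>d Lp Ld"
      "AE \<omega> in M. \<forall>k. assumption_A1_step f g (conjugate h) (conjugate l) T \<phi>p \<phi>d (lam k) (nu k)
         (\<delta>p k \<omega>) (\<delta>d k \<omega>) (x k \<omega>) (\<mu> k \<omega>) (x (Suc k) \<omega>)"
    and A2: "assumption_A2 lam lam_inf" "assumption_A2 nu nu_inf"
    and A3: "assumption_A3 g (conjugate l) T \<phi>p \<phi>d Lp Ld lam_inf nu_inf"
    and A4: "\<forall>k. is_cond_expectation M (F k) (\<delta>p k) (\<lambda>_. 0) \<and>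
                 is_cond_expectation M (F k) (\<delta>d k) (\<lambda>_. 0)"
  shows "(\<forall>k\<ge>1. \<forall>xx \<in> Cp \<inter> eff_dom g. \<forall>\<mu>\<mu> \<in> Cd \<inter> eff_dom (conjugate l).
           ext_expectation M (\<lambda>\<omega>. lagrangian Cp Cd f g h l T (ergodic_mean x k \<omega>) \<mu>\<mu>
                                  - lagrangian Cp Cd f g h l T xx (ergodic_mean \<mu> k \<omega>))
           \<le> (weighted_bregman (1 / lam 0) (1 / nu 0) \<phi>p \<phi>d (xx, \<mu>\<mu>) (x0, \<mu>0)
                - ereal (coupling T (xx, \<mu>\<mu>) (x0, \<mu>0))) / ereal (real k)
             + (\<Sum>i<k. ext_expectation M (\<lambda>\<omega>.
                  ereal (noise_pairing (\<delta>p i \<omega>) (\<delta>d i \<omega>)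
                    ((xx, \<mu>\<mu>) - (x (Suc i) \<omega>, \<mu> (Suc i) \<omega>))))) / ereal (real k))
       \<and> (assumption_A5_I M \<delta>p \<delta>d \<or>
          assumption_A5_II M F \<delta>p \<delta>d g (conjugate l) \<phi>p \<phi>d \<or>
          assumption_A5_III M F \<delta>p \<delta>d T \<phi>p \<phi>d lam_inf nu_inf \<longrightarrow>
          (\<forall>(r :: nat \<Rightarrow> nat) winf.
             strict_mono r \<and> strongly_measurable M winf \<and>
             (AE \<omega> in M. weakly_converges
                (\<lambda>j. (ergodic_mean x (r j) \<omega>, ergodic_mean \<mu> (r j) \<omega>)) (winf \<omega>)) \<longrightarrow>
             (\<exists>w. has_bochner_expectation M winf w \<and> saddle_point (lagrangian Cp Cd f g h l T) w)))"
proof -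
  note H' = H[unfolded hypothesis_H_def]
  note A1' = A1(1)[unfolded assumption_A1_static_def]
  have doms: "eff_dom \<phi>p = Cp" "eff_dom \<phi>d = Cd" using A1' by simp_all
  obtain \<eta>h where \<eta>h: "\<eta>h \<in> eff_dom (conjugate h)" using H' by blast
  obtain \<eta>l where \<eta>l: "\<eta>l \<in> eff_dom (conjugate l)" using H' by blast
  have hs: "conjugate h \<in> Gamma0" using H' by (intro Gamma0_conjugate[OF _ \<eta>h]) simp
  have ls: "conjugate l \<in> Gamma0" using H' by (intro Gamma0_conjugate[OF _ \<eta>l]) simp
  have P: "bregman_block \<phi>p f g Lp" using H' A1' by (intro bregman_block.intro) auto
  have D: "bregman_block \<phi>d (conjugate h) (conjugate l) Ld" using H' A1' hs ls by (intro bregman_block.intro) auto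
  have PD: "primal_dual \<phi>p f g Lp \<phi>d (conjugate h) (conjugate l) Ld T lam nu lam_inf nu_inf"
    by (intro primal_dual.intro P D primal_dual_axioms.intro A2 A3)
  have SP: "saddle_problem \<phi>p f g Lp \<phi>d h l Ld T lam nu lam_inf nu_inf Cp Cd"
    using H' doms by (intro saddle_problem.intro PD saddle_problem_axioms.intro) auto
  have adm: "(x0, \<mu>0) \<in> U_set \<phi>p g \<times> U_set \<phi>d (conjugate l)" using init by simp
  have path: "AE \<omega> in M. primal_dual_path \<phi>p f g Lp \<phi>d (conjugate h) (conjugate l) Ld T lam nu lam_inf nu_inf
      (\<lambda>k. x k \<omega>) (\<lambda>k. \<mu> k \<omega>) (\<lambda>k. \<delta>p k \<omega>) (\<lambda>k. \<delta>d k \<omega>)"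
    using algorithm A1(2)
  proof eventually_elim
    case (elim \<omega>)
    show ?case
    proof (rule primal_dual_path.intro[OF PD], rule primal_dual_path_axioms.intro)
      show "(x 0 \<omega>, \<mu> 0 \<omega>) \<in> U_set \<phi>p g \<times> U_set \<phi>d (conjugate l)" using adm init(3) by simp
    qed (use elim doms in auto)
  qed
  interpret S: stochastic_primal_dual \<phi>p f g Lp \<phi>d h l Ld T lam nu lam_inf nu_inf Cp Cd M \<delta>p \<delta>d x \<mu> x0 \<mu>0
    by (intro stochastic_primal_dual.intro SP prob stochastic_primal_dual_axioms.intro)
      (use noise_rv iterate_rv init(3) adm path in auto)
  have feas: "S.P.feasible = Cp \<inter> eff_dom g" "S.D.feasible = Cd \<inter> eff_dom (conjugate l)"
    unfolding S.P.feasible_def S.D.feasible_def doms by simp_all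
  obtain e0 where e0: "saddle_point (lagrangian Cp Cd f g h l T) e0" using H' by blast
  show ?thesis
  proof (rule conjI; intro allI ballI impI)
    fix k :: nat and xx \<mu>\<mu> assume "1 \<le> k" "xx \<in> Cp \<inter> eff_dom g" "\<mu>\<mu> \<in> Cd \<inter> eff_dom (conjugate l)"
    then show "ext_expectation M (\<lambda>\<omega>. lagrangian Cp Cd f g h l T (ergodic_mean x k \<omega>) \<mu>\<mu>
                                  - lagrangian Cp Cd f g h l T xx (ergodic_mean \<mu> k \<omega>))
           \<le> (weighted_bregman (1 / lam 0) (1 / nu 0) \<phi>p \<phi>d (xx, \<mu>\<mu>) (x0, \<mu>0)
                - ereal (coupling T (xx, \<mu>\<mu>) (x0, \<mu>0))) / ereal (real k)
             + (\<Sum>i<k. ext_expectation M (\<lambda>\<omega>.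
                  ereal (noise_pairing (\<delta>p i \<omega>) (\<delta>d i \<omega>)
                    ((xx, \<mu>\<mu>) - (x (Suc i) \<omega>, \<mu> (Suc i) \<omega>))))) / ereal (real k)"
      unfolding feas[symmetric] by (rule S.expected_gap_bound)
  next
    fix r :: "nat \<Rightarrow> nat" and winf
    assume A5: "assumption_A5_I M \<delta>p \<delta>d \<or> assumption_A5_II M F \<delta>p \<delta>d g (conjugate l) \<phi>p \<phi>d \<or>
        assumption_A5_III M F \<delta>p \<delta>d T \<phi>p \<phi>d lam_inf nu_inf"
      and "strict_mono r \<and> strongly_measurable M winf \<and>
         (AE \<omega> in M. weakly_converges (\<lambda>j. (ergodic_mean x (r j) \<omega>, ergodic_mean \<mu> (r j) \<omega>)) (winf \<omega>))"
    then have r: "strict_mono r" and winf: "strongly_measurable M winf"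
      and weak: "AE \<omega> in M. weakly_converges (\<lambda>j. (ergodic_mean x (r j) \<omega>, ergodic_mean \<mu> (r j) \<omega>)) (winf \<omega>)" by simp_all
    from A5 show "\<exists>w. has_bochner_expectation M winf w \<and> saddle_point (lagrangian Cp Cd f g h l T) w"
    proof (elim disjE)
      assume "assumption_A5_I M \<delta>p \<delta>d"
      then show ?thesis unfolding assumption_A5_I_def by (rule S.saddle_noiseless[OF r winf weak])
    next
      assume "assumption_A5_II M F \<delta>p \<delta>d g (conjugate l) \<phi>p \<phi>d"
      then show ?thesis
        unfolding assumption_A5_II_def by (intro S.saddle_bounded[OF r winf weak, of F]) (auto intro: bounded_Times)
    next
      assume "assumption_A5_III M F \<delta>p \<delta>d T \<phi>p \<phi>d lam_inf nu_inf"
      then obtain \<sigma>p \<sigma>d where \<sigma>: "0 < \<sigma>p" "0 < \<sigma>d"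
        and Dp: "\<And>x y. ereal (\<sigma>p / 2 * (norm (x - y))\<^sup>2) \<le> bregman \<phi>p x y"
        and Dd: "\<And>\<mu> \<eta>. ereal (\<sigma>d / 2 * (norm (\<mu> - \<eta>))\<^sup>2) \<le> bregman \<phi>d \<mu> \<eta>"
        and small: "ereal (nu_inf * lam_inf) < ereal (\<sigma>p * \<sigma>d) / ereal ((norm T)\<^sup>2)"
        and N: "summable_in_mean M F (\<lambda>k \<omega>. (norm (\<delta>p k \<omega>))\<^sup>2)" "summable_in_mean M F (\<lambda>k \<omega>. (norm (\<delta>d k \<omega>))\<^sup>2)"
        unfolding assumption_A5_III_def by blast
      have refl: "reflexive_space TYPE('p)" "reflexive_space TYPE('d)" using H' by simp_all
      have cent: "is_cond_expectation M (history M (\<lambda>k \<omega>. (x k \<omega>, \<mu> k \<omega>)) k) (\<delta>p k) (\<lambda>_. 0)"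
        "is_cond_expectation M (history M (\<lambda>k \<omega>. (x k \<omega>, \<mu> k \<omega>)) k) (\<delta>d k) (\<lambda>_. 0)" for k
        using A4 unfolding F by simp_all
      show ?thesis by (rule S.saddle_strongly_convex[OF r winf weak refl e0 cent \<sigma> Dp Dd small N])
    qed
  qed
qed

end
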